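(* Let $0\le\lambda<9/20$ and fix a constant $\kappa>0$. Let $\psi\colon\mathbb{R}^+\to\mathbb{R}^+$ be an approximation function and let $g$ be an increasing dimension function such that $q^{-1}g(q)$ is decreasing and $q^{-1}g(q)\to\infty$ as $q\to0$. Let $\mathcal{P}_{3,\lambda}^*$ be the set of irreducible polynomials $P\in\mathbb{Z}[X]$ with $\deg P\le 3$ and $|D(P)|\le\kappa\,H(P)^{2(2-\lambda)}$, and let \[ \mathcal{A}_{3,\lambda}^*(\psi)=\left\{x\in\mathbb{R}:\ |P(x)|\le\psi(H(P)) \text{ for infinitely many } P\in\mathcal{P}_{3,\lambda}^*\right\}. \] If $\sum_{q=1}^\infty g\!\left(\frac{\psi(q)}{q}\right)q^{3-2\lambda/3}<\infty$, then $\mathcal{H}^g(\mathcal{A}_{3,\lambda}^*(\psi))=0$.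
   Context: For an integer polynomial $P$, $H(P)$ (the height) is the maximum absolute value of its coefficients and $D(P)$ is its discriminant. An approximation function is a decreasing function $\psi\colon\mathbb{R}^+\to\mathbb{R}^+$. A dimension function is a continuous increasing $g\colon\mathbb{R}^+\to\mathbb{R}^+$ with $g(r)\to0$ as $r\to0$. For $X\subseteq\mathbb{R}$, $\mathcal{H}^g_\rho(X)=\inf\sum_i g(r(B_i))$ over all countable covers of $X$ by balls $B_i$ of radii $r(B_i)\in(0,\rho]$, and $\mathcal{H}^g(X)=\lim_{\rho\to0^+}\mathcal{H}^g_\rho(X)$ is the Hausdorff $g$-measure. *)

theory Defs
  imports "HOL-Analysis.Analysis" "Subresultants.Resultant_Prelim"
begin

definition poly_height :: "int poly \<Rightarrow> int" where
  "poly_height P = Max ((\<lambda>i. \<bar>coeff P i\<bar>) ` {..degree P})"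

text \<open>The discriminant of \<open>P\<close> is taken with respect to the actual degree of \<open>P\<close>.
  The division is exact when \<open>P\<close> is not constant, since the leading coefficient of \<open>P\<close> divides
  every entry of one column of the Sylvester matrix. The value for constant \<open>P\<close> carries no meaning.\<close>

definition poly_discriminant :: "int poly \<Rightarrow> int" where
  "poly_discriminant P =
     (-1) ^ (degree P * (degree P - 1) div 2) * (resultant P (pderiv P) div lead_coeff P)"

lemma det_Suc_expand:
  fixes f :: "nat \<times> nat \<Rightarrow> 'a :: comm_ring_1"
  shows "Determinant.det (Matrix.mat (Suc n) (Suc n) f) =
    (\<Sum>i<Suc n. f (i, 0) * ((-1) ^ i *
       Determinant.det (Matrix.mat n n (\<lambda>(a, b). f (if a < i then a else Suc a, Suc b)))))"
  apply (subst laplace_expansion_column[of _ "Suc n" 0])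
    apply simp
   apply simp
  apply (rule sum.cong, simp)
  apply (auto simp: cofactor_def mat_delete_def intro!: arg_cong[where f = Determinant.det] arg_cong2[where f="(*)"])
  done



definition col_minor :: "(nat \<times> nat \<Rightarrow> 'a :: comm_ring_1) \<Rightarrow> nat list \<Rightarrow> nat \<Rightarrow> 'a" where
  "col_minor f rs k =
     Determinant.det (Matrix.mat (length rs) (length rs) (\<lambda>(a, b). f (rs ! a, k + b)))"

lemma col_minor_Nil: "col_minor f [] k = 1"
  by (simp add: col_minor_def)

lemma col_minor_Cons:
  "col_minor f (x # xs) k =
     (\<Sum>i<Suc (length xs). (-1) ^ i * f ((x # xs) ! i, k) *
        col_minor f (take i (x # xs) @ drop (Suc i) (x # xs)) (Suc k))"
proof -
  have "col_minor f (take i (x # xs) @ drop (Suc i) (x # xs)) (Suc k) =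
      Determinant.det (Matrix.mat (length xs) (length xs)
          (\<lambda>(a, b). f ((x # xs) ! (if a < i then a else Suc a), k + Suc b)))"
    if "i < Suc (length xs)" for i
  proof -
    have "length (take i (x # xs) @ drop (Suc i) (x # xs)) = length xs"
      using that by auto
    then show ?thesis
      unfolding col_minor_def using that
      by (intro arg_cong[where f = Determinant.det] eq_matI) (auto simp: nth_append)
  qed
  then show ?thesis
    by (simp add: col_minor_def[of f "x # xs"] det_Suc_expand mult_ac del: sum.lessThan_Suc)
qed

lemma poly_discriminant_linear:
  "a \<noteq> 0 \<Longrightarrow> poly_discriminant [:b, a:] = 1"
  by (simp add: poly_discriminant_def pderiv_pCons)
lemma poly_discriminant_quadratic:
  "a \<noteq> 0 \<Longrightarrow> poly_discriminant [:c, b, a:] = b\<^sup>2 - 4 * a * c"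
proof -
  assume a: "a \<noteq> 0"
  have "resultant [:c, b, a:] (pderiv [:c, b, a:]) = a * (4 * a * c - b\<^sup>2)"
    using a by (simp add: resultant_def sylvester_mat_def sylvester_mat_sub_def pderiv_pCons
        numeral_eq_Suc det_Suc_expand, simp add: algebra_simps power2_eq_square)
  with a show ?thesis by (simp add: poly_discriminant_def)
qed
lemma poly_discriminant_cubic:
  "a \<noteq> 0 \<Longrightarrow> poly_discriminant [:d, c, b, a:] =
     b\<^sup>2 * c\<^sup>2 - 4 * a * c ^ 3 - 4 * b ^ 3 * d - 27 * a\<^sup>2 * d\<^sup>2 + 18 * a * b * c * d"
    (is "_ \<Longrightarrow> _ = ?D")
proof -
  assume a: "a \<noteq> 0"
  define D where "D = ?D"
  define F where "F = (\<lambda>(i, j). if i < Suc (Suc 0)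
      then if i \<le> j \<and> j - i \<le> Suc (Suc (Suc 0))
           then coeff [:d, c, b, a:] (Suc (Suc (Suc 0)) + i - j) else 0
      else if i - Suc (Suc 0) \<le> j \<and> j \<le> i then coeff [:c, 2 * b, 3 * a:] (i - j) else 0)"
  have F: "F (0, 0) = a" "F (0, Suc 0) = b" "F (0, Suc (Suc 0)) = c" "F (0, Suc (Suc (Suc 0))) = d"
    "F (0, Suc (Suc (Suc (Suc 0)))) = 0"
    "F (Suc 0, 0) = 0" "F (Suc 0, Suc 0) = a" "F (Suc 0, Suc (Suc 0)) = b"
    "F (Suc 0, Suc (Suc (Suc 0))) = c" "F (Suc 0, Suc (Suc (Suc (Suc 0)))) = d"
    "F (Suc (Suc 0), 0) = 3 * a" "F (Suc (Suc 0), Suc 0) = 2 * b" "F (Suc (Suc 0), Suc (Suc 0)) = c"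
    "F (Suc (Suc 0), Suc (Suc (Suc 0))) = 0" "F (Suc (Suc 0), Suc (Suc (Suc (Suc 0)))) = 0"
    "F (Suc (Suc (Suc 0)), 0) = 0" "F (Suc (Suc (Suc 0)), Suc 0) = 3 * a"
    "F (Suc (Suc (Suc 0)), Suc (Suc 0)) = 2 * b" "F (Suc (Suc (Suc 0)), Suc (Suc (Suc 0))) = c"
    "F (Suc (Suc (Suc 0)), Suc (Suc (Suc (Suc 0)))) = 0"
    "F (Suc (Suc (Suc (Suc 0))), 0) = 0" "F (Suc (Suc (Suc (Suc 0))), Suc 0) = 0"
    "F (Suc (Suc (Suc (Suc 0))), Suc (Suc 0)) = 3 * a"
    "F (Suc (Suc (Suc (Suc 0))), Suc (Suc (Suc 0))) = 2 * b"
    "F (Suc (Suc (Suc (Suc 0))), Suc (Suc (Suc (Suc 0)))) = c"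
    by (simp_all add: F_def)
  have "resultant [:d, c, b, a:] (pderiv [:d, c, b, a:]) =
      col_minor F [0, Suc 0, Suc (Suc 0), Suc (Suc (Suc 0)), Suc (Suc (Suc (Suc 0)))] 0"
    (is "?L = ?R")
  proof -
    have "?R = Determinant.det (Matrix.mat (Suc (Suc (Suc (Suc (Suc 0))))) (Suc (Suc (Suc (Suc (Suc 0))))) F)"
      by (auto simp: col_minor_def less_Suc_eq intro!: arg_cong[where f = Determinant.det] eq_matI)
    then show ?thesis
    using a by (simp add: resultant_def sylvester_mat_def sylvester_mat_sub_def pderiv_pCons F_def)
  qed
  also have "\<dots> = a * (- D)"
    by (simp add: col_minor_Cons col_minor_Nil F)
      (simp add: D_def algebra_simps power2_eq_square power3_eq_cube)
  finally have "poly_discriminant [:d, c, b, a:] = D"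
    using a nonzero_mult_div_cancel_left[OF a, of "- D"] by (simp add: poly_discriminant_def)
  then show ?thesis by (simp only: D_def)
qed

text \<open>Throughout, the positive reals are represented as the set \<open>{0<..}\<close>, and the values
  of functions outside it are irrelevant. Increasing and decreasing are meant
  in the weak sense.\<close>

definition approximation_function :: "(real \<Rightarrow> real) \<Rightarrow> bool" where
  "approximation_function \<psi> \<longleftrightarrow> (\<forall>r>0. \<psi> r > 0) \<and> antimono_on {0<..} \<psi>"

definition dimension_function :: "(real \<Rightarrow> real) \<Rightarrow> bool" where
  "dimension_function g \<longleftrightarrow>
     (\<forall>r>0. g r > 0) \<and> continuous_on {0<..} g \<and> mono_on {0<..} g \<and> (g \<longlongrightarrow> 0) (at_right 0)"

text \<open>A countable cover is indexed by an arbitrary set \<open>I\<close> of natural numbers, so that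
  finite covers are included. The balls are open; for continuous \<open>g\<close> the limit below is the
  same with closed balls.\<close>

definition hausdorff_premeasure :: "(real \<Rightarrow> real) \<Rightarrow> real \<Rightarrow> real set \<Rightarrow> ennreal" where
  "hausdorff_premeasure g \<rho> X =
     Inf {(\<Sum>\<^sub>\<infinity>i\<in>I. ennreal (g (r i))) | (I :: nat set) (c :: nat \<Rightarrow> real) (r :: nat \<Rightarrow> real).
            (\<forall>i\<in>I. 0 < r i \<and> r i \<le> \<rho>) \<and> X \<subseteq> (\<Union>i\<in>I. ball (c i) (r i))}"

definition hausdorff_measure :: "(real \<Rightarrow> real) \<Rightarrow> real set \<Rightarrow> ennreal" where
  "hausdorff_measure g X = Lim (at_right 0) (\<lambda>\<rho>. hausdorff_premeasure g \<rho> X)"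

lemma hausdorff_premeasure_antimono:
  assumes "\<rho> \<le> \<rho>'"
  shows "hausdorff_premeasure g \<rho>' X \<le> hausdorff_premeasure g \<rho> X"
  unfolding hausdorff_premeasure_def using assms
  by (intro Inf_superset_mono) (blast intro: order_trans)

lemma hausdorff_premeasure_tendsto_SUP:
  "((\<lambda>\<rho>. hausdorff_premeasure g \<rho> X) \<longlongrightarrow> (SUP \<rho>\<in>{0<..}. hausdorff_premeasure g \<rho> X)) (at_right 0)"
proof (rule order_tendstoI)
  fix a assume "a < (SUP \<rho>\<in>{0<..}. hausdorff_premeasure g \<rho> X)"
  then obtain \<rho> where \<rho>: "\<rho> > 0" "a < hausdorff_premeasure g \<rho> X"
    by (auto simp: less_SUP_iff)
  show "eventually (\<lambda>\<rho>. a < hausdorff_premeasure g \<rho> X) (at_right 0)"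
    unfolding eventually_at_right_field
    using \<rho> by (intro exI[of _ \<rho>])
      (auto intro: less_le_trans[OF _ hausdorff_premeasure_antimono])
next
  fix a assume a: "(SUP \<rho>\<in>{0<..}. hausdorff_premeasure g \<rho> X) < a"
  show "eventually (\<lambda>\<rho>. hausdorff_premeasure g \<rho> X < a) (at_right 0)"
    unfolding eventually_at_right_field
    by (intro exI[of _ 1]) (auto intro!: le_less_trans[OF SUP_upper a])
qed

lemma hausdorff_measure_eq_SUP:
  "hausdorff_measure g X = (SUP \<rho>\<in>{0<..}. hausdorff_premeasure g \<rho> X)"
  unfolding hausdorff_measure_def
  by (intro tendsto_Lim hausdorff_premeasure_tendsto_SUP) simp

text \<open>Irreducibility is meant in the ring of integer polynomials, so an irreducible polynomial is
  either primitive of positive degree or, up to sign, a prime constant.\<close>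

definition P3_star :: "real \<Rightarrow> real \<Rightarrow> int poly set" where
  "P3_star \<kappa> lam =
     {P. Factorial_Ring.irreducible P \<and> degree P \<le> 3 \<and>
         real_of_int \<bar>poly_discriminant P\<bar> \<le> \<kappa> * real_of_int (poly_height P) powr (2 * (2 - lam))}"

definition A3_star :: "real \<Rightarrow> real \<Rightarrow> (real \<Rightarrow> real) \<Rightarrow> real set" where
  "A3_star \<kappa> lam \<psi> =
     {x. infinite {P \<in> P3_star \<kappa> lam. \<bar>poly (of_int_poly P) x\<bar> \<le> \<psi> (real_of_int (poly_height P))}}"

end

theory Submission
  imports Defs "HOL-Computational_Algebra.Fundamental_Theorem_Algebra"
begin

text \<open>
  The argument is a Cantelli argument over the dyadic blocks \<open>Q \<le> H(P) < 2 Q\<close> with \<open>Q = 2 ^ k\<close>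
  and \<open>\<delta> = \<psi>(Q)\<close>. Since \<open>g(r) \<ge> r\<close> for small \<open>r\<close>, the convergence of the series forces
  \<open>\<delta> \<le> Q powr (- 27 / 10)\<close> eventually.

  If \<open>\<bar>P(x)\<bar> \<le> \<delta>\<close> then \<open>\<bar>x - \<alpha>\<bar> \<le> 4 \<delta> / \<bar>P'(\<alpha>)\<bar>\<close> for the complex root \<open>\<alpha>\<close> nearest to \<open>x\<close>. As
  \<open>g(s r) \<le> s g(r)\<close> for \<open>s \<ge> 1\<close>, a block is harmless once the sum of \<open>Q / \<bar>P'(\<alpha>)\<bar>\<close> over its roots
  near a fixed interval is \<open>O(Q powr (4 - 2 \<lambda> / 3))\<close>. Write \<open>\<bar>P'(\<alpha>)\<bar> = Q t\<close>.

  For \<open>t \<ge> Q powr (- 1 / 2)\<close>, fix the coefficients \<open>a, b, c\<close> of \<open>P\<close>: intervals of length \<open>1 / (4 \<bar>P'(\<alpha>)\<bar>)\<close>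
  around the roots are then disjoint, because two such polynomials differ by an integer. So the sum is
  at most the integral over \<open>y\<close> of the number of triples \<open>(a, b, c)\<close> allowed near \<open>y\<close>. Since
  \<open>D(P) = P'(\<alpha>)\<^sup>2 (P''(\<alpha>)\<^sup>2 / 4 - 4 a P'(\<alpha>))\<close>, a small discriminant makes one of the two
  factors small, and the triples with this property are easy to count.

  For smaller \<open>t\<close> the discriminant bound is not needed: cubics with a root of derivative at most \<open>Q t\<close> almost
  have a double root at some \<open>y\<close>, and two of them with the same leading coefficient differ by a point
  of a lattice of quadratics in a box. A quadratic in this box is not too short, since its resultant
  with an irreducible cubic is a nonzero integer; and neither are two of them spanning a plane, even if they
  share a root, since that root is rational and the cubic does not vanish there. This bounds the number of
  lattice points in the box. For \<open>t \<le> Q powr (- 13 / 10)\<close> the resultant of two of the cubics would be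
  less than 1 in absolute value, so a cell contains essentially one cubic. Finally \<open>\<bar>D(P)\<bar> \<ge> 1\<close> excludes
  \<open>t\<close> much smaller than \<open>Q powr (- 2)\<close>.
\<close>

section \<open>Resultants and discriminants of cubics\<close>

text \<open>The exponent 2 lam / 3 comes from a balance. Put T = Q powr (- 2 lam / 3). The
  discriminant bound is then a constant times Q^4 T^3, so either |P'(\<alpha>)| \<le> Q T or the
  cofactor of P'(\<alpha>)^2 in D(P) is at most a constant times Q^2 T, and either alternative keeps
  a proportion T of the Q^3 triples. The cut at t = Q powr (- 1 / 2) is forced: over an interval of
  length 1 / |P'(\<alpha>)| the quadratic Taylor term can reach Q / |P'(\<alpha>)|^2, which stays
  bounded only while |P'(\<alpha>)| is at least of order sqrt Q. Below the cut polynomials are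
  counted instead. The obstacle there is that the box of quadratics has volume about Q^3 t^3, and
  volume alone does not bound the number of lattice points in a box; lower bounds for short vectors
  and for short planes fill the gap. Each range of small derivatives may spend Q powr (37 / 10), and
  37 / 10 = 4 - (2 / 3) (9 / 20) is where the bound on lam enters.\<close>

lemma irreducible_no_common_root:
  fixes P M :: "int poly" and z :: complex
  assumes irr: "Factorial_Ring.irreducible P" and M: "M \<noteq> 0" "degree M < degree P"
    and z: "poly (of_int_poly P) z = 0"
  shows "poly (of_int_poly M) z \<noteq> 0"
proof
  assume "poly (of_int_poly M) z = 0"
  then have ex: "\<exists>n M. M \<noteq> 0 \<and> degree M < degree P \<and> poly (of_int_poly M) z = 0 \<and> degree M = n"
    using M by blast
  \<comment> \<open>A polynomial of least degree vanishing at \<open>z\<close>: pseudo-division of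
    \<open>P\<close> by it leaves remainder zero, and primality of \<open>P\<close> then makes it
    divide a nonzero constant.\<close>
  define n where "n = (LEAST n. \<exists>M. M \<noteq> 0 \<and> degree M < degree P \<and> poly (of_int_poly M) z = 0 \<and> degree M = n)"
  obtain A where A: "A \<noteq> 0" "degree A < degree P" "poly (of_int_poly A) z = 0" "degree A = n"
    using LeastI_ex[OF ex] unfolding n_def by blast
  have least: "degree A \<le> degree B" if "B \<noteq> 0" "degree B < degree P" "poly (of_int_poly B) z = 0" for B
    unfolding A(4) n_def by (rule Least_le) (use that in blast)
  obtain q r where qr: "pseudo_divmod P A = (q, r)" by fastforce
  define k where "k = Suc (degree P) - degree A"
  have eq: "Polynomial.smult (lead_coeff A ^ k) P = A * q + r" and deg: "r = 0 \<or> degree r < degree A"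
    using pseudo_divmod[OF A(1) qr] by (auto simp: k_def)
  have "poly (of_int_poly (Polynomial.smult (lead_coeff A ^ k) P)) z = poly (of_int_poly (A * q + r)) z"
    using eq by simp
  then have "poly (of_int_poly r) z = 0"
    using z A(3) by (simp add: of_int_poly_hom.hom_add of_int_poly_hom.hom_mult hom_distribs)
  with least[of r] deg A have r: "r = 0" by force
  have prime: "prime_elem P" using irr by (simp add: irreducible_imp_prime_elem)
  have "P dvd A * q" using eq r by (metis add.right_neutral dvd_smult dvd_refl)
  with prime have "P dvd A \<or> P dvd q" by (simp add: prime_elem_dvd_mult_iff)
  moreover have "\<not> P dvd A" using A by (auto dest: dvd_imp_degree_le)
  ultimately obtain q' where q': "q = P * q'" by (auto elim: dvdE)
  have "P * [:lead_coeff A ^ k:] = P * (A * q')" using eq r q' by (simp add: ac_simps)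
  moreover have "P \<noteq> 0" using irr by auto
  ultimately have "[:lead_coeff A ^ k:] = A * q'" by (metis mult_cancel_left)
  then have "degree A + degree q' = 0"
    by (metis A(1) degree_mult_eq degree_pCons_0 leading_coeff_0_iff mult_eq_0_iff pCons_eq_0_iff power_not_zero)
  then obtain a where "A = [:a:]" by (metis add_is_0 degree_eq_zeroE)
  with A show False by simp
qed

lemma complex_cubic_roots:
  fixes a b c d :: complex
  assumes "a \<noteq> 0"
  obtains x y z where "b = - a * (x + y + z)" "c = a * (x * y + y * z + z * x)" "d = - a * (x * y * z)"
proof -
  have "\<not> constant (poly [:d, c, b, a:])"
    using assms by (simp add: constant_degree)
  then obtain x where x: "poly [:d, c, b, a:] x = 0" using fundamental_theorem_of_algebra by blast
  define e where "e = b + a * x"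
  define f where "f = c + e * x"
  have "d + x * (c + x * (b + x * a)) = 0" using x by simp
  then have d: "d = - f * x" unfolding f_def e_def by Groebner_Basis.algebra
  have "\<not> constant (poly [:f, e, a:])"
    using assms by (simp add: constant_degree)
  then obtain y where y: "poly [:f, e, a:] y = 0" using fundamental_theorem_of_algebra by blast
  define z where "z = - (e + a * y) / a"
  have az: "a * z = - (e + a * y)" using assms by (simp add: z_def)
  have f: "f = a * (y * z)" 
  proof -
    have "f + y * (e + y * a) = 0" using y by simp
    with az show ?thesis by Groebner_Basis.algebra
  qed
  show ?thesis
  proof (rule that)
    show "b = - a * (x + y + z)" using az e_def by Groebner_Basis.algebra
    show "c = a * (x * y + y * z + z * x)" using az f e_def f_def by Groebner_Basis.algebra
    show "d = - a * (x * y * z)" using d f by Groebner_Basis.algebra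
  qed
qed

text \<open>
  Up to sign the resultants of \<open>u + v X + w X\<^sup>2\<close>, respectively \<open>a' X\<^sup>3 + b' X\<^sup>2 + c' X + d'\<close>, with
  \<open>a X\<^sup>3 + b X\<^sup>2 + c X + d\<close>. The second one is the Bezout determinant.
\<close>

definition res23 :: "'a::comm_ring_1 \<Rightarrow> 'a \<Rightarrow> 'a \<Rightarrow> 'a \<Rightarrow> 'a \<Rightarrow> 'a \<Rightarrow> 'a \<Rightarrow> 'a" where
  "res23 u v w a b c d =
    (d * w - b * u)^2 * w + 2 * a * (d * w - b * u) * u * v
    - (d * v - c * u) * w * (c * w - b * v - a * u) - a * (d * v - c * u) * v^2
    - a * u^2 * (c * w - b * v - a * u)"

definition res33 :: "'a::comm_ring_1 \<Rightarrow> 'a \<Rightarrow> 'a \<Rightarrow> 'a \<Rightarrow> 'a \<Rightarrow> 'a \<Rightarrow> 'a \<Rightarrow> 'a \<Rightarrow> 'a" where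
  "res33 a b c d a' b' c' d' =
    (let m01 = d * c' - c * d'; m02 = d * b' - b * d'; m03 = d * a' - a * d';
         m12 = c * b' - b * c'; m13 = c * a' - a * c'; m23 = b * a' - a * b'
     in m01 * ((m03 + m12) * m23 - m13^2) - m02 * (m02 * m23 - m13 * m03)
        + m03 * (m02 * m13 - (m03 + m12) * m03))"

lemma res23_roots:
  fixes a x y z :: complex
  shows "res23 u v w a (- a * (x + y + z)) (a * (x * y + y * z + z * x)) (- a * (x * y * z)) =
    a^2 * ((u + v * x + w * x^2) * (u + v * y + w * y^2) * (u + v * z + w * z^2))"
  unfolding res23_def by Groebner_Basis.algebra

lemma res33_roots:
  fixes a x y z :: complex
  shows "res33 a (- a * (x + y + z)) (a * (x * y + y * z + z * x)) (- a * (x * y * z)) a' b' c' d' =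
    (a^3 * ((d' + c' * x + b' * x^2 + a' * x^3) * (d' + c' * y + b' * y^2 + a' * y^3) * (d' + c' * z + b' * z^2 + a' * z^3)))"
  unfolding res33_def Let_def by Groebner_Basis.algebra

text \<open>Primitivity turns proportionality of two irreducible cubics into equality up to
  sign.\<close>

lemma irreducible_content:
  fixes P :: "int poly"
  assumes "Factorial_Ring.irreducible P" "degree P > 0"
  shows "content P = 1"
proof -
  have "P = [:content P:] * primitive_part P" by simp
  with assms(1) have "is_unit [:content P:] \<or> is_unit (primitive_part P)"
    by (metis irreducibleD)
  moreover have "\<not> is_unit (primitive_part P)"
    using assms(2) by (auto simp: is_unit_poly_iff) (metis degree_primitive_part degree_pCons_0 less_irrefl)
  ultimately have "\<bar>content P\<bar> = 1" by (auto simp: is_unit_poly_iff)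
  then show ?thesis using normalize_content[of P] by simp
qed

text \<open>Resultants are invariant under translation. Hence an integer resultant can be estimated
  from Taylor coefficients at any real \<open>y\<close>, in particular at a point where these are
  small.\<close>

lemma res23_shift:
  fixes a b c d u v w y :: "'a::field_char_0"
  shows "res23 (u + v * y + w * y^2) (v + 2 * w * y) w
     a (b + 3 * a * y) (c + 2 * b * y + 3 * a * y^2) (d + c * y + b * y^2 + a * y^3) = res23 u v w a b c d"
  unfolding res23_def by Groebner_Basis.algebra

lemma res33_shift:
  fixes a b c d a' b' c' d' y :: "'a::field_char_0"
  shows "res33 a (b + 3 * a * y) (c + 2 * b * y + 3 * a * y^2) (d + c * y + b * y^2 + a * y^3)
     a' (b' + 3 * a' * y) (c' + 2 * b' * y + 3 * a' * y^2) (d' + c' * y + b' * y^2 + a' * y^3) = res33 a b c d a' b' c' d'"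
  unfolding res33_def Let_def by Groebner_Basis.algebra

definition disc3 :: "'a::comm_ring_1 \<Rightarrow> 'a \<Rightarrow> 'a \<Rightarrow> 'a \<Rightarrow> 'a" where
  "disc3 a b c d = b\<^sup>2 * c\<^sup>2 - 4 * a * c ^ 3 - 4 * b ^ 3 * d - 27 * a\<^sup>2 * d\<^sup>2 + 18 * a * b * c * d"

lemma disc3_roots:
  fixes a x y z :: complex
  shows "disc3 a (- a * (x + y + z)) (a * (x * y + y * z + z * x)) (- a * (x * y * z)) =
    a^4 * ((x - y) * (y - z) * (z - x))^2"
  unfolding disc3_def by Groebner_Basis.algebra

text \<open>Dividing out the root leaves, in the variable shifted by \<open>z\<close>, the quadratic
  with coefficients \<open>a\<close>, \<open>b + 3 * a * z\<close> and the derivative at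
  \<open>z\<close>. Its discriminant is the second factor; the first is the square of its value at
  the removed root.\<close>

lemma disc3_at_root:
  fixes a b c d z :: "'a::field_char_0"
  assumes "d + c * z + b * z^2 + a * z^3 = 0"
  shows "disc3 a b c d = (c + 2 * b * z + 3 * a * z^2)^2 * ((b + 3 * a * z)^2 - 4 * a * (c + 2 * b * z + 3 * a * z^2))"
proof -
  have d: "d = - (c * z + b * z^2 + a * z^3)" using assms by Groebner_Basis.algebra
  show ?thesis unfolding disc3_def d by Groebner_Basis.algebra
qed

definition irr3 :: "int \<Rightarrow> int \<Rightarrow> int \<Rightarrow> int \<Rightarrow> bool" where
  "irr3 a b c d \<longleftrightarrow> a \<noteq> 0 \<and> Factorial_Ring.irreducible [:d, c, b, a:]"

lemma irr3_quadratic_at_root: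
  fixes z :: complex
  assumes "irr3 a b c d" and "of_int d + of_int c * z + of_int b * z^2 + of_int a * z^3 = 0"
    and "(u, v, w) \<noteq> (0, 0, 0)"
  shows "of_int u + of_int v * z + of_int w * z^2 \<noteq> (0::complex)"
proof -
  have "poly (of_int_poly [:u, v, w:]) z \<noteq> 0"
  proof (rule irreducible_no_common_root)
    show "Factorial_Ring.irreducible [:d, c, b, a:]" using assms(1) by (simp add: irr3_def)
    show "[:u, v, w:] \<noteq> 0" using assms(3) by auto
    show "degree [:u, v, w:] < degree [:d, c, b, a:]" using assms(1) by (simp add: irr3_def)
    have "poly (of_int_poly [:d, c, b, a:]) z = of_int d + of_int c * z + of_int b * z^2 + of_int a * z^3"
      by (simp add: of_int_hom.map_poly_pCons_hom power2_eq_square power3_eq_cube algebra_simps)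
    then show "poly (of_int_poly [:d, c, b, a:]) z = 0" using assms(2) by simp
  qed
  then show ?thesis by (simp add: of_int_hom.map_poly_pCons_hom power2_eq_square algebra_simps)
qed

lemma irr3_roots:
  assumes "irr3 a b c d"
  obtains x y z :: complex where
    "of_int b = - of_int a * (x + y + z)" "of_int c = of_int a * (x * y + y * z + z * x)"
    "of_int d = - of_int a * (x * y * z)"
    "\<And>t. t \<in> {x, y, z} \<Longrightarrow> of_int d + of_int c * t + of_int b * t^2 + of_int a * t^3 = 0"
proof -
  have a: "(of_int a :: complex) \<noteq> 0" using assms by (simp add: irr3_def)
  obtain x y z where xyz: "(of_int b :: complex) = - of_int a * (x + y + z)"
    "(of_int c :: complex) = of_int a * (x * y + y * z + z * x)"
    "(of_int d :: complex) = - of_int a * (x * y * z)"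
    using complex_cubic_roots[OF a] by blast
  have "of_int d + of_int c * t + of_int b * t^2 + of_int a * t^3 = of_int a * ((t - x) * (t - y) * (t - z))" for t
    unfolding xyz by Groebner_Basis.algebra
  with xyz show ?thesis by (intro that[of x y z]) auto
qed

lemma res23_nonzero:
  assumes "irr3 a b c d" "(u, v, w) \<noteq> (0, 0, 0)"
  shows "res23 u v w a b c d \<noteq> 0"
proof -
  obtain x y z :: complex where r: "of_int b = - of_int a * (x + y + z)" "of_int c = of_int a * (x * y + y * z + z * x)"
    "of_int d = - of_int a * (x * y * z)"
    "\<And>t. t \<in> {x, y, z} \<Longrightarrow> of_int d + of_int c * t + of_int b * t^2 + of_int a * t^3 = 0"
    using irr3_roots[OF assms(1)] by blast
  have "(of_int (res23 u v w a b c d) :: complex) =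
     res23 (of_int u) (of_int v) (of_int w) (of_int a) (of_int b) (of_int c) (of_int d)"
    by (simp add: res23_def)
  also have "\<dots> = of_int a ^ 2 * ((of_int u + of_int v * x + of_int w * x^2) * (of_int u + of_int v * y + of_int w * y^2)
     * (of_int u + of_int v * z + of_int w * z^2))"
    unfolding r(1-3) by (rule res23_roots)
  also have "\<dots> \<noteq> 0"
    using irr3_quadratic_at_root[OF assms(1) r(4) assms(2)] assms(1) by (simp add: irr3_def)
  finally show ?thesis by (metis of_int_0)
qed

lemma res33_nonzero:
  assumes "irr3 a b c d" "irr3 a' b' c' d'"
    and "(a', b', c', d') \<noteq> (a, b, c, d)" "(a', b', c', d') \<noteq> (- a, - b, - c, - d)"
  shows "res33 a b c d a' b' c' d' \<noteq> 0"
proof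
  assume 0: "res33 a b c d a' b' c' d' = 0"
  obtain x y z :: complex where r: "of_int b = - of_int a * (x + y + z)" "of_int c = of_int a * (x * y + y * z + z * x)"
    "of_int d = - of_int a * (x * y * z)"
    "\<And>t. t \<in> {x, y, z} \<Longrightarrow> of_int d + of_int c * t + of_int b * t^2 + of_int a * t^3 = 0"
    using irr3_roots[OF assms(1)] by blast
  have "(of_int (res33 a b c d a' b' c' d') :: complex) =
     res33 (of_int a) (of_int b) (of_int c) (of_int d) (of_int a') (of_int b') (of_int c') (of_int d')"
    by (simp add: res33_def Let_def)
  also have "\<dots> = of_int a ^ 3 * ((of_int d' + of_int c' * x + of_int b' * x^2 + of_int a' * x^3) * 
     (of_int d' + of_int c' * y + of_int b' * y^2 + of_int a' * y^3) * (of_int d' + of_int c' * z + of_int b' * z^2 + of_int a' * z^3))"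
    unfolding r(1-3) by (rule res33_roots)
  finally obtain t where t: "t \<in> {x, y, z}" "of_int d' + of_int c' * t + of_int b' * t^2 + of_int a' * t^3 = 0"
    using 0 assms(1) by (auto simp: irr3_def)
  \<comment> \<open>Eliminating the cubic term leaves an integer quadratic vanishing at the common
    root; it must be zero, so the two cubics are proportional.\<close>
  have "(of_int (a' * d - a * d') + of_int (a' * c - a * c') * t + of_int (a' * b - a * b') * t^2 :: complex) = 0"
    using r(4)[OF t(1)] t(2) by (simp, Groebner_Basis.algebra)
  then have eq: "(a' * d - a * d', a' * c - a * c', a' * b - a * b') = (0, 0, 0)"
    using irr3_quadratic_at_root[OF assms(1) r(4)[OF t(1)]] by blast
  have irr: "Factorial_Ring.irreducible [:d, c, b, a:]" "Factorial_Ring.irreducible [:d', c', b', a':]" "a \<noteq> 0" "a' \<noteq> 0"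
    using assms by (auto simp: irr3_def)
  have "Polynomial.smult a' [:d, c, b, a:] = Polynomial.smult a [:d', c', b', a':]"
    using eq by (simp add: mult.commute)
  then have "\<bar>a'\<bar> * content [:d, c, b, a:] = \<bar>a\<bar> * content [:d', c', b', a':]"
    by (metis content_smult normalize_int_def)
  moreover have "content [:d, c, b, a:] = 1" "content [:d', c', b', a':] = 1"
    using irr by (auto intro!: irreducible_content)
  ultimately have "\<bar>a'\<bar> = \<bar>a\<bar>" by simp
  then have "a' = a \<or> a' = - a" by linarith
  then show False
  proof
    assume "a' = a"
    with eq irr(3) have "d' = d" "c' = c" "b' = b" by auto
    with \<open>a' = a\<close> assms(3) show False by simp
  next
    assume "a' = - a"
    with eq have "a * (d' + d) = 0" "a * (c' + c) = 0" "a * (b' + b) = 0" by (auto simp: algebra_simps)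
    then have "d' = - d" "c' = - c" "b' = - b" using irr(3) by auto
    with \<open>a' = - a\<close> assms(4) show False by simp
  qed
qed

lemma disc3_nonzero:
  assumes "irr3 a b c d"
  shows "disc3 a b c d \<noteq> 0"
proof
  assume 0: "disc3 a b c d = 0"
  obtain x y z :: complex where r: "of_int b = - of_int a * (x + y + z)" "of_int c = of_int a * (x * y + y * z + z * x)"
    "of_int d = - of_int a * (x * y * z)"
    "\<And>t. t \<in> {x, y, z} \<Longrightarrow> of_int d + of_int c * t + of_int b * t^2 + of_int a * t^3 = 0"
    using irr3_roots[OF assms(1)] by blast
  have "(of_int (disc3 a b c d) :: complex) = disc3 (of_int a) (of_int b) (of_int c) (of_int d)"
    by (simp add: disc3_def)
  also have "\<dots> = of_int a ^ 4 * ((x - y) * (y - z) * (z - x))^2"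
    unfolding r(1-3) by (rule disc3_roots)
  finally have "x = y \<or> y = z \<or> z = x" using 0 assms by (auto simp: irr3_def)
  then obtain t where t: "t \<in> {x, y, z}" "of_int c + of_int (2 * b) * t + of_int (3 * a) * t^2 = (0::complex)"
  proof (elim disjE)
    assume e: "x = y" have "of_int c + of_int (2 * b) * x + of_int (3 * a) * x^2 = (0::complex)"
      unfolding of_int_mult of_int_numeral r(1-3) e by Groebner_Basis.algebra
    then show ?thesis using that by blast
  next
    assume e: "y = z" have "of_int c + of_int (2 * b) * y + of_int (3 * a) * y^2 = (0::complex)"
      unfolding of_int_mult of_int_numeral r(1-3) e by Groebner_Basis.algebra
    then show ?thesis using that by blast
  next
    assume e: "z = x" have "of_int c + of_int (2 * b) * z + of_int (3 * a) * z^2 = (0::complex)"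
      unfolding of_int_mult of_int_numeral r(1-3) e by Groebner_Basis.algebra
    then show ?thesis using that by blast
  qed
  moreover have "(c, 2 * b, 3 * a) \<noteq> (0, 0, 0)" using assms by (simp add: irr3_def)
  ultimately show False using irr3_quadratic_at_root[OF assms r(4)[OF t(1)], of c "2 * b" "3 * a"] by simp
qed

lemma irr3_no_rational_root:
  fixes p q :: int
  assumes "irr3 a b c d" "q \<noteq> 0"
  shows "d * q^3 + c * p * q^2 + b * p^2 * q + a * p^3 \<noteq> 0"
proof
  assume *: "d * q^3 + c * p * q^2 + b * p^2 * q + a * p^3 = 0"
  define z :: complex where "z = of_int p / of_int q"
  have z: "of_int q * z = of_int p" using assms(2) by (simp add: z_def)
  have "of_int q ^ 3 * (of_int d + of_int c * z + of_int b * z^2 + of_int a * z^3) =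
     of_int d * of_int q ^ 3 + of_int c * (of_int q * z) * of_int q^2 + of_int b * (of_int q * z)^2 * of_int q + of_int a * (of_int q * z)^3"
    by Groebner_Basis.algebra
  also have "\<dots> = of_int (d * q^3 + c * p * q^2 + b * p^2 * q + a * p^3)" unfolding z by simp
  finally have "of_int d + of_int c * z + of_int b * z^2 + of_int a * z^3 = 0"
    using * assms(2) by simp
  from irr3_quadratic_at_root[OF assms(1) this, of "- p" q 0] z assms(2) show False by simp
qed

section \<open>Lattice points in a box\<close>

text \<open>Letting \<open>p\<close> go up to \<open>q + 1\<close> includes some empty intervals;
  beyond that point the bound would be negative.\<close>

lemma card_int_interval:
  fixes p q :: real
  assumes "p \<le> q + 1"
  shows "finite {n::int. p \<le> n \<and> n \<le> q}" "real (card {n::int. p \<le> n \<and> n \<le> q}) \<le> q - p + 1"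
proof -
  have eq: "{n::int. p \<le> n \<and> n \<le> q} = {\<lceil>p\<rceil>..\<lfloor>q\<rfloor>}"
    by (auto simp: ceiling_le_iff le_floor_iff)
  show "finite {n::int. p \<le> n \<and> n \<le> q}" unfolding eq by simp
  have "real (nat (\<lfloor>q\<rfloor> + 1 - \<lceil>p\<rceil>)) \<le> q - p + 1"
    using assms by (cases "\<lfloor>q\<rfloor> + 1 - \<lceil>p\<rceil> \<ge> 0") (auto, linarith+)
  then show "real (card {n::int. p \<le> n \<and> n \<le> q}) \<le> q - p + 1"
    unfolding eq by simp
qed

lemma card_int_subset_interval:
  fixes p q :: real
  assumes "p \<le> q + 1" "\<And>n::int. n \<in> A \<Longrightarrow> p \<le> real_of_int n \<and> real_of_int n \<le> q"
  shows "finite A" "real (card A) \<le> q - p + 1"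
proof -
  have sub: "A \<subseteq> {n::int. p \<le> n \<and> n \<le> q}" using assms(2) by auto
  show "finite A" using finite_subset[OF sub card_int_interval(1)[OF assms(1)]] .
  show "real (card A) \<le> q - p + 1"
    using card_mono[OF card_int_interval(1)[OF assms(1)] sub] card_int_interval(2)[OF assms(1)] by linarith
qed

lemma card_le_fibres:
  fixes m :: real
  assumes "finite A" "\<And>y. y \<in> f ` A \<Longrightarrow> real (card {x \<in> A. f x = y}) \<le> m"
  shows "real (card A) \<le> real (card (f ` A)) * m"
proof -
  have "real (card A) = (\<Sum>x\<in>A. 1)" by simp
  also have "\<dots> = (\<Sum>y\<in>f ` A. \<Sum>x\<in>{x \<in> A. f x = y}. 1)"
    by (rule sum.image_gen[OF assms(1)])
  also have "\<dots> = (\<Sum>y\<in>f ` A. real (card {x \<in> A. f x = y}))" by simp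
  also have "\<dots> \<le> (\<Sum>y\<in>f ` A. m)" by (rule sum_mono) (rule assms(2))
  finally show ?thesis by simp
qed

text \<open>Cells of length \<open>\<nu>\<close> hold at most one point each, so the index of the
  cell is injective on \<open>A\<close>.\<close>

lemma card_separated:
  fixes f :: "'a \<Rightarrow> real"
  assumes "\<nu> > 0" "p \<le> q" "\<And>x. x \<in> A \<Longrightarrow> p \<le> f x \<and> f x \<le> q"
    and sep: "\<And>x y. x \<in> A \<Longrightarrow> y \<in> A \<Longrightarrow> x \<noteq> y \<Longrightarrow> \<nu> \<le> \<bar>f x - f y\<bar>"
  shows "finite A" "real (card A) \<le> (q - p) / \<nu> + 1"
proof -
  define g where "g x = \<lfloor>(f x - p) / \<nu>\<rfloor>" for x
  have inj: "inj_on g A"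
  proof (rule inj_onI, rule ccontr)
    fix x y assume "x \<in> A" "y \<in> A" "g x = g y" "x \<noteq> y"
    then have "\<bar>(f x - p) / \<nu> - (f y - p) / \<nu>\<bar> < 1" unfolding g_def by linarith
    then have "\<bar>f x - f y\<bar> < \<nu>" using assms(1) by (simp add: diff_divide_distrib[symmetric] abs_divide)
    with sep[OF \<open>x \<in> A\<close> \<open>y \<in> A\<close> \<open>x \<noteq> y\<close>] show False by simp
  qed
  have range: "0 \<le> real_of_int n \<and> n \<le> (q - p) / \<nu>" if "n \<in> g ` A" for n
  proof -
    from that obtain x where x: "x \<in> A" "n = g x" by auto
    have "0 \<le> (f x - p) / \<nu>" "(f x - p) / \<nu> \<le> (q - p) / \<nu>"
      using assms(1) assms(3)[OF x(1)] by (auto simp: divide_right_mono)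
    then show ?thesis using x(2) unfolding g_def by (auto, linarith)
  qed
  have "0 \<le> (q - p) / \<nu> + 1" using assms by (simp add: add_nonneg_nonneg)
  note c = card_int_subset_interval[OF this range]
  show "finite A" using c(1) inj by (rule finite_imageD)
  show "real (card A) \<le> (q - p) / \<nu> + 1"
    using c(2)[of "g ` A"] card_image[OF inj] by simp
qed

text \<open>
  The lattice is \<open>\<int>\<^sup>3\<close>, embedded by the coordinates \<open>e\<close> that turn the box into a cube; \<open>D\<close> is the inverse of the
  covolume, so that the determinant of the embedded vectors is integral after multiplication by \<open>D\<close>.
\<close>

locale rank3_lattice =
  fixes e :: "nat \<Rightarrow> int \<times> int \<times> int \<Rightarrow> real" and h :: "int \<times> int \<times> int \<Rightarrow> real"
    and det :: "int \<times> int \<times> int \<Rightarrow> int \<times> int \<times> int \<Rightarrow> int \<times> int \<times> int \<Rightarrow> int" and D :: real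
  assumes h_def: "h x = max \<bar>e 0 x\<bar> (max \<bar>e 1 x\<bar> \<bar>e 2 x\<bar>)"
    and lin: "e i (x - y) = e i x - e i y"
    and pos: "x \<noteq> 0 \<Longrightarrow> h x > 0"
    and D: "D > 0"
    and fin: "finite {x. h x \<le> R}"
    and det: "real_of_int (det v w x) = D * ((e 1 v * e 2 w - e 2 v * e 1 w) * e 0 x
       + (e 2 v * e 0 w - e 0 v * e 2 w) * e 1 x + (e 0 v * e 1 w - e 1 v * e 0 w) * e 2 x)"
begin

text \<open>Linear dependence of the embedded vectors, as the vanishing of their cross
  product.\<close>

definition par where "par v x \<longleftrightarrow> (e 1 v * e 2 x = e 2 v * e 1 x \<and> e 2 v * e 0 x = e 0 v * e 2 x \<and> e 0 v * e 1 x = e 1 v * e 0 x)"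

lemma coord_cases: obtains i where "i \<in> {0, 1, 2}" "\<bar>e i v\<bar> = h v"
  unfolding h_def by (metis insertCI max_def)

lemma coord_le: "i \<in> {0, 1, 2} \<Longrightarrow> \<bar>e i v\<bar> \<le> h v"
  unfolding h_def by auto

text \<open>All vectors on the line of \<open>v\<close> attain their norm in the same coordinate, so
  this coordinate alone separates lattice points on the line.\<close>

lemma par_separated:
  assumes i: "i \<in> {0, 1, 2}" "\<bar>e i v\<bar> = h v" and v: "v \<noteq> 0" and p: "par v x"
  shows "\<bar>e i x\<bar> = h x"
proof -
  have hv: "h v > 0" using pos[OF v] .
  have *: "\<bar>e j x\<bar> \<le> \<bar>e i x\<bar>" if "j \<in> {0, 1, 2}" for j
  proof -
    have "e j x * e i v = e i x * e j v"
      using p i(1) that unfolding par_def by (auto simp: mult.commute)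
    then have "\<bar>e j x\<bar> * h v = \<bar>e i x\<bar> * \<bar>e j v\<bar>" using i(2) by (metis abs_mult)
    also have "\<dots> \<le> \<bar>e i x\<bar> * h v" using coord_le[OF that] by (intro mult_left_mono) auto
    finally show ?thesis using hv by simp
  qed
  show ?thesis using *[of 0] *[of 1] *[of 2] coord_le[OF i(1), of x] unfolding h_def
    by (intro antisym) simp_all
qed

text \<open>Projected to the coordinate in which \<open>v\<close> attains its norm, the points have
  gaps of at least \<open>h v\<close>, because \<open>v\<close> is a shortest vector. The rounding
  term 1 is absorbed by \<open>h v \<le> d\<close>.\<close>

lemma count_parallel:
  assumes v: "v \<noteq> 0" and min: "\<And>z. z \<noteq> 0 \<Longrightarrow> h v \<le> h z"
    and A: "\<And>x y. x \<in> A \<Longrightarrow> y \<in> A \<Longrightarrow> par v (x - y)"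
    and d: "\<And>x y. x \<in> A \<Longrightarrow> y \<in> A \<Longrightarrow> h (x - y) \<le> d" and "h v \<le> d"
  shows "real (card A) \<le> 3 * d / h v"
proof (cases "A = {}")
  case True then show ?thesis using pos[OF v] assms(5) by simp
next
  case False
  then obtain x0 where x0: "x0 \<in> A" by auto
  obtain i where i: "i \<in> {0, 1, 2}" "\<bar>e i v\<bar> = h v" by (rule coord_cases)
  have hv: "h v > 0" using pos[OF v] .
  have sep: "\<bar>e i x - e i y\<bar> = h (x - y)" if "x \<in> A" "y \<in> A" for x y
    using par_separated[OF i v A[OF that]] by (simp add: lin)
  have "real (card A) \<le> ((e i x0 + d) - (e i x0 - d)) / h v + 1"
  proof (rule card_separated(2)[where f = "e i"])
    show "e i x0 - d \<le> e i x0 + d" using hv assms(5) by simp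
    show "e i x0 - d \<le> e i x \<and> e i x \<le> e i x0 + d" if "x \<in> A" for x
      using sep[OF that x0] d[OF that x0] by (auto simp: abs_le_iff)
    show "h v \<le> \<bar>e i x - e i y\<bar>" if "x \<in> A" "y \<in> A" "x \<noteq> y" for x y
      using sep[OF that(1,2)] min[of "x - y"] that(3) by simp
  qed (use hv in simp)
  also have "\<dots> \<le> 3 * d / h v" using assms(5) hv by (simp add: field_simps)
  finally show ?thesis .
qed

text \<open>
  On a plane parallel to \<open>v\<close> and \<open>w\<close> the coordinate belonging to the largest entry of the normal vector is controlled
  by the other two, so packing squares in these two coordinates suffices.
\<close>

lemma count_plane:
  assumes v: "v \<noteq> 0" and min: "\<And>z. z \<noteq> 0 \<Longrightarrow> h v \<le> h z"
    and w: "\<not> par v w" and minw: "\<And>z. \<not> par v z \<Longrightarrow> h w \<le> h z"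
    and A: "finite A" "\<And>x. x \<in> A \<Longrightarrow> h x \<le> R" "\<And>x. x \<in> A \<Longrightarrow> det v w x = k"
    and R: "h w \<le> R"
  shows "real (card A) \<le> 192 * R\<^sup>2 / (h v * h w)"
proof -
  define n where "n = (\<lambda>j::nat. if j = 0 then e 1 v * e 2 w - e 2 v * e 1 w
     else if j = 1 then e 2 v * e 0 w - e 0 v * e 2 w else e 0 v * e 1 w - e 1 v * e 0 w)"
  have hv: "h v > 0" using pos[OF v] .
  have w0: "w \<noteq> 0" using w lin[of _ w w] by (auto simp: par_def)
  have hw: "h w > 0" using pos[OF w0] .
  have n0: "n 0 \<noteq> 0 \<or> n 1 \<noteq> 0 \<or> n 2 \<noteq> 0"
    using w unfolding n_def par_def by auto
  have plane: "n 0 * (e 0 x - e 0 y) + n 1 * (e 1 x - e 1 y) + n 2 * (e 2 x - e 2 y) = 0" if "x \<in> A" "y \<in> A" for x y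
  proof -
    have "D * (n 0 * e 0 x + n 1 * e 1 x + n 2 * e 2 x) = D * (n 0 * e 0 y + n 1 * e 1 y + n 2 * e 2 y)"
      using A(3)[OF that(1)] A(3)[OF that(2)] det[of v w x] det[of v w y] by (simp add: n_def)
    then have "n 0 * e 0 x + n 1 * e 1 x + n 2 * e 2 x = n 0 * e 0 y + n 1 * e 1 y + n 2 * e 2 y"
      using D by (simp del: One_nat_def)
    then show ?thesis by (simp add: algebra_simps)
  qed
  obtain i j l where ijl: "{i, j, l} = {0, 1, 2::nat}" "n l \<noteq> 0" "\<bar>n i\<bar> \<le> \<bar>n l\<bar>" "\<bar>n j\<bar> \<le> \<bar>n l\<bar>"
    and sum3: "\<And>f :: nat \<Rightarrow> real. f 0 + f 1 + f 2 = f i + f j + f l"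
  proof -
    consider "\<bar>n 0\<bar> \<le> \<bar>n 2\<bar>" "\<bar>n 1\<bar> \<le> \<bar>n 2\<bar>" | "\<bar>n 0\<bar> \<le> \<bar>n 1\<bar>" "\<bar>n 2\<bar> \<le> \<bar>n 1\<bar>" | "\<bar>n 1\<bar> \<le> \<bar>n 0\<bar>" "\<bar>n 2\<bar> \<le> \<bar>n 0\<bar>"
      by linarith
    then show ?thesis
    proof cases
      case 1 then show ?thesis using that[of 0 1 2] n0 by auto
    next
      case 2 then show ?thesis using that[of 0 2 1] n0 by (auto simp: insert_commute)
    next
      case 3 then show ?thesis using that[of 1 2 0] n0 by (auto simp: insert_commute)
    qed
  qed
  have ij: "i \<in> {0, 1, 2}" "j \<in> {0, 1, 2}" "l \<in> {0, 1, 2}" using ijl(1) by blast+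
  have third: "\<bar>e l x - e l y\<bar> \<le> \<bar>e i x - e i y\<bar> + \<bar>e j x - e j y\<bar>" if "x \<in> A" "y \<in> A" for x y
  proof -
    have "n i * (e i x - e i y) + n j * (e j x - e j y) + n l * (e l x - e l y) = 0"
      using plane[OF that] sum3[of "\<lambda>i. n i * (e i x - e i y)"] by simp
    then have "\<bar>n l\<bar> * \<bar>e l x - e l y\<bar> = \<bar>n i * (e i x - e i y) + n j * (e j x - e j y)\<bar>"
      by (simp add: abs_mult[symmetric])
    also have "\<dots> \<le> \<bar>n i\<bar> * \<bar>e i x - e i y\<bar> + \<bar>n j\<bar> * \<bar>e j x - e j y\<bar>"
      by (metis abs_mult abs_triangle_ineq)
    also have "\<dots> \<le> \<bar>n l\<bar> * \<bar>e i x - e i y\<bar> + \<bar>n l\<bar> * \<bar>e j x - e j y\<bar>"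
      using ijl by (intro add_mono mult_right_mono) auto
    also have "\<dots> = \<bar>n l\<bar> * (\<bar>e i x - e i y\<bar> + \<bar>e j x - e j y\<bar>)" by (simp add: algebra_simps)
    finally show ?thesis using ijl(2) by simp
  qed
  \<comment> \<open>Squares of side \<open>h w / 3\<close> in the coordinates \<open>i\<close> and
    \<open>j\<close>. Within a square the third coordinate differs by less than
    \<open>2 * h w / 3\<close>, so two points are closer than \<open>h w\<close>; as
    \<open>w\<close> is shortest off the line of \<open>v\<close>, their difference is parallel to
    \<open>v\<close>.\<close>
  define g where "g x = (\<lfloor>3 * e i x / h w\<rfloor>, \<lfloor>3 * e j x / h w\<rfloor>)" for x
  define N where "N = {n::int. - 3 * R / h w - 1 \<le> n \<and> n \<le> 3 * R / h w}"
  have Rw: "R / h w \<ge> 1" using R hw by simp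
  have N: "finite N" "real (card N) \<le> 8 * (R / h w)"
  proof -
    have *: "- 3 * R / h w - 1 \<le> 3 * R / h w + 1" using Rw by simp
    show "finite N" unfolding N_def by (rule card_int_interval(1)[OF *])
    have "real (card N) \<le> 3 * R / h w - (- 3 * R / h w - 1) + 1" unfolding N_def by (rule card_int_interval(2)[OF *])
    also have "\<dots> = 6 * (R / h w) + 2" by simp
    finally show "real (card N) \<le> 8 * (R / h w)" using Rw by linarith
  qed
  have inN: "\<lfloor>3 * e i x / h w\<rfloor> \<in> N" if "x \<in> A" "i \<in> {0, 1, 2}" for x i
  proof -
    have "\<bar>e i x\<bar> \<le> R" using coord_le[OF that(2), of x] A(2)[OF that(1)] by linarith
    then have "3 * e i x \<le> 3 * R" "- 3 * R \<le> 3 * e i x" by auto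
    then have "3 * e i x / h w \<le> 3 * R / h w" "- 3 * R / h w \<le> 3 * e i x / h w"
      using hw by (intro divide_right_mono; simp)+
    then show ?thesis unfolding N_def by (simp, linarith)
  qed
  have "real (card A) \<le> real (card (g ` A)) * (3 * h w / h v)"
  proof (rule card_le_fibres[OF A(1)])
    fix c assume "c \<in> g ` A"
    have close: "h (x - y) < h w" if "x \<in> A" "y \<in> A" "g x = g y" for x y
    proof -
      have *: "\<bar>e m x - e m y\<bar> < h w / 3" if "\<lfloor>3 * e m x / h w\<rfloor> = \<lfloor>3 * e m y / h w\<rfloor>" for m
      proof -
        have "\<bar>3 * e m x / h w - 3 * e m y / h w\<bar> < 1" using that by linarith
        then have "\<bar>3 * (e m x - e m y) / h w\<bar> < 1" by (simp add: diff_divide_distrib algebra_simps)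
        then have "\<bar>3 * (e m x - e m y)\<bar> < h w" using hw by (simp only: abs_divide) simp
        then show ?thesis unfolding abs_less_iff by auto
      qed
      have "\<bar>e i x - e i y\<bar> < h w / 3" "\<bar>e j x - e j y\<bar> < h w / 3" using that(3) * by (auto simp: g_def)
      moreover from third[OF that(1,2)] this have "\<bar>e l x - e l y\<bar> < h w" by linarith
      ultimately have "\<forall>m\<in>{i, j, l}. \<bar>e m (x - y)\<bar> < h w" using hw by (auto simp: lin)
      then show ?thesis unfolding ijl(1) by (simp add: h_def)
    qed
    show "real (card {x \<in> A. g x = c}) \<le> 3 * h w / h v"
    proof (rule count_parallel[OF v min])
      show "par v (x - y)" if "x \<in> {x \<in> A. g x = c}" "y \<in> {x \<in> A. g x = c}" for x y
        using close[of x y] minw[of "x - y"] that by fastforce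
      show "h (x - y) \<le> h w" if "x \<in> {x \<in> A. g x = c}" "y \<in> {x \<in> A. g x = c}" for x y
        using close[of x y] that by fastforce
      show "h v \<le> h w" using min[OF w0] .
    qed
  qed
  also have "\<dots> \<le> (8 * (R / h w) * (8 * (R / h w))) * (3 * h w / h v)"
  proof (intro mult_right_mono)
    have "card (g ` A) \<le> card (N \<times> N)"
      using N(1) inN ij by (intro card_mono) (auto simp: g_def)
    then have "real (card (g ` A)) \<le> real (card N) * real (card N)"
      by (metis card_cartesian_product of_nat_le_iff of_nat_mult)
    also have "\<dots> \<le> 8 * (R / h w) * (8 * (R / h w))" using N(2) by (intro mult_mono) auto
    finally show "real (card (g ` A)) \<le> 8 * (R / h w) * (8 * (R / h w))" .
  qed (use hv hw in simp)
  also have "\<dots> = 192 * R\<^sup>2 / (h v * h w)" using hv hw by (simp add: power2_eq_square field_simps)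
  finally show ?thesis .
qed

text \<open>Slicing by the integer \<open>det v w\<close>, with \<open>v\<close> a shortest vector
  and \<open>w\<close> a shortest one off the line of \<open>v\<close>: its absolute value on the
  box is at most \<open>6 * D * h v * h w * R\<close>, which bounds the number of planes. The three
  outcomes are boxes whose points span rank 0, rank 1, and more; in the last one
  \<open>2304 * D * R ^ 3\<close> is the volume and the other summand comes from a single
  plane.\<close>

lemma count_box:
  assumes R: "R > 0"
  shows "card {x. h x \<le> R} \<le> 1 \<or> (\<exists>v. v \<noteq> 0 \<and> h v \<le> R \<and> real (card {x. h x \<le> R}) \<le> 6 * R / h v) \<or>
    (\<exists>v w. h v \<le> R \<and> h w \<le> R \<and> \<not> par v w \<and> real (card {x. h x \<le> R}) \<le> 192 * R\<^sup>2 / (h v * h w) + 2304 * D * R ^ 3)"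
proof -
  define X where "X = {x. h x \<le> R}"
  have finX: "finite X" using fin by (simp add: X_def)
  have ez: "e i 0 = 0" for i using lin[of i 0 0] by simp
  have zX: "0 \<in> X" using R by (simp add: X_def h_def ez)
  show ?thesis
  proof (cases "X = {0}")
    case True then show ?thesis by (simp add: X_def)
  next
    case False
    then have ne: "X - {0} \<noteq> {}" using zX by auto
    obtain v where v: "v \<in> X - {0}" "\<And>z. z \<in> X - {0} \<Longrightarrow> h v \<le> h z"
      using ex_min_if_finite[of "h ` (X - {0})"] finX ne
      by (metis (no_types, lifting) arg_min_if_finite(1) arg_min_least finite_Diff)
    have min: "h v \<le> h z" if "z \<noteq> 0" for z
      using v that by (cases "z \<in> X") (auto simp: X_def)
    have v0: "v \<noteq> 0" "h v \<le> R" "h v > 0" using v pos by (auto simp: X_def)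
    have hdiff: "h (x - y) \<le> 2 * R" if "x \<in> X" "y \<in> X" for x y
    proof -
      have "\<bar>e i (x - y)\<bar> \<le> 2 * R" if i: "i \<in> {0, 1, 2}" for i
        using coord_le[OF i, of x] coord_le[OF i, of y] \<open>x \<in> X\<close> \<open>y \<in> X\<close> by (auto simp: X_def lin)
      then show ?thesis by (simp add: h_def)
    qed
    have par_diff: "par v (x - y)" if "par v x" "par v y" for x y
      using that unfolding par_def lin by (simp add: algebra_simps)
    show ?thesis
    proof (cases "\<forall>x\<in>X. par v x")
      case True
      have "real (card X) \<le> 3 * (2 * R) / h v"
        by (rule count_parallel[OF v0(1) min]) (use True par_diff hdiff v0 R in auto)
      then have "real (card X) \<le> 6 * R / h v" by simp
      then show ?thesis using v0 unfolding X_def by blast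
    next
      case False
      define Y where "Y = {x \<in> X. \<not> par v x}"
      have "finite Y" "Y \<noteq> {}" using False finX by (auto simp: Y_def)
      then obtain w where w: "w \<in> Y" "\<And>z. z \<in> Y \<Longrightarrow> h w \<le> h z"
        by (metis (no_types, lifting) arg_min_if_finite(1) arg_min_least)
      have minw: "h w \<le> h z" if "\<not> par v z" for z
        using w that by (cases "z \<in> X") (auto simp: X_def Y_def)
      have wp: "\<not> par v w" "h w \<le> R" using w by (auto simp: Y_def X_def)
      have w0: "w \<noteq> 0" using wp(1) by (auto simp: par_def ez)
      define B where "B = 6 * D * h v * h w * R"
      have B0: "B \<ge> 0" using D v0 pos[OF w0] R by (simp add: B_def)
      have detb: "\<bar>real_of_int (det v w x)\<bar> \<le> B" if "x \<in> X" for x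
      proof -
        have hx: "h x \<le> R" using that by (simp add: X_def)
        have p: "\<bar>(e i v * e j w - e j v * e i w) * e k x\<bar> \<le> 2 * (h v * h w) * R"
          if "i \<in> {0, 1, 2}" "j \<in> {0, 1, 2}" "k \<in> {0, 1, 2}" for i j k
        proof -
          have "\<bar>e i v * e j w\<bar> \<le> h v * h w" "\<bar>e j v * e i w\<bar> \<le> h v * h w"
            unfolding abs_mult using coord_le[OF that(1), of v] coord_le[OF that(2), of v]
              coord_le[OF that(1), of w] coord_le[OF that(2), of w] by (auto intro!: mult_mono)
          then have "\<bar>e i v * e j w - e j v * e i w\<bar> \<le> 2 * (h v * h w)" by linarith
          then show ?thesis unfolding abs_mult using coord_le[OF that(3), of x] hx
            by (intro mult_mono) auto
        qed
        have "\<bar>real_of_int (det v w x)\<bar> = D * \<bar>(e 1 v * e 2 w - e 2 v * e 1 w) * e 0 x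
           + (e 2 v * e 0 w - e 0 v * e 2 w) * e 1 x + (e 0 v * e 1 w - e 1 v * e 0 w) * e 2 x\<bar>"
          unfolding det abs_mult using D by simp
        also have "\<dots> \<le> D * (2 * (h v * h w) * R + 2 * (h v * h w) * R + 2 * (h v * h w) * R)"
          using D p[of 1 2 0, OF _ _ _] p[of 2 0 1] p[of 0 1 2]
          by (intro mult_left_mono order_trans[OF abs_triangle_ineq] add_mono) auto
        finally show ?thesis by (simp add: B_def algebra_simps)
      qed
      have "real (card X) \<le> real (card (det v w ` X)) * (192 * R\<^sup>2 / (h v * h w))"
      proof (rule card_le_fibres[OF finX])
        fix k
        show "real (card {x \<in> X. det v w x = k}) \<le> 192 * R\<^sup>2 / (h v * h w)"
          by (rule count_plane[OF v0(1) min wp(1) minw]) (use finX wp in \<open>auto simp: X_def\<close>)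
      qed
      also have "\<dots> \<le> (2 * B + 1) * (192 * R\<^sup>2 / (h v * h w))"
      proof (rule mult_right_mono)
        have "real (card (det v w ` X)) \<le> B - (- B) + 1"
          by (rule card_int_subset_interval(2)) (use B0 detb in \<open>auto simp: abs_le_iff minus_le_iff\<close>)
        then show "real (card (det v w ` X)) \<le> 2 * B + 1" by simp
      qed (use v0 pos[OF w0] in simp)
      also have "\<dots> = 192 * R\<^sup>2 / (h v * h w) + 2304 * D * R ^ 3"
        using v0 pos[OF w0] by (simp add: B_def field_simps power2_eq_square power3_eq_cube)
      finally show ?thesis using wp v0 unfolding X_def by blast
    qed
  qed
qed

end

section \<open>Cubics with an approximate double root\<close>

text \<open>
  The Taylor coefficients of \<open>a X\<^sup>3 + b X\<^sup>2 + c X + d\<close> at \<open>y\<close>; \<open>taylor2\<close> is half of the second derivative.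
\<close>

definition taylor0 :: "int \<Rightarrow> int \<Rightarrow> int \<Rightarrow> int \<Rightarrow> 'a \<Rightarrow> 'a::comm_ring_1" where
  "taylor0 a b c d y = of_int d + of_int c * y + of_int b * y^2 + of_int a * y^3"
definition taylor1 :: "int \<Rightarrow> int \<Rightarrow> int \<Rightarrow> 'a \<Rightarrow> 'a::comm_ring_1" where
  "taylor1 a b c y = of_int c + 2 * of_int b * y + 3 * of_int a * y^2"
definition taylor2 :: "int \<Rightarrow> int \<Rightarrow> 'a \<Rightarrow> 'a::comm_ring_1" where
  "taylor2 a b y = of_int b + 3 * of_int a * y"

abbreviation coeff_le :: "real \<Rightarrow> int \<Rightarrow> bool" where
  "coeff_le Q n \<equiv> \<bar>real_of_int n\<bar> \<le> 2 * Q"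

text \<open>\<open>t\<close> is the size of the derivative relative to \<open>Q\<close>, and
  \<open>l\<close> the mesh to which \<open>y\<close> is rounded. For \<open>l = t\<close> the
  bounds are those of a double root seen from distance \<open>t\<close>: the value scales like
  \<open>t^2\<close> and the derivative like \<open>t\<close>.\<close>

definition near_double :: "real \<Rightarrow> real \<Rightarrow> real \<Rightarrow> real \<Rightarrow> real \<Rightarrow> int \<Rightarrow> int \<Rightarrow> int \<Rightarrow> int \<Rightarrow> bool" where
  "near_double K Q t l y a b c d \<longleftrightarrow> irr3 a b c d \<and> \<bar>taylor0 a b c d y\<bar> \<le> K * Q * t * l \<and> \<bar>taylor1 a b c y\<bar> \<le> K * Q * t
     \<and> \<bar>taylor2 a b y\<bar> \<le> K * Q \<and> \<bar>real_of_int a\<bar> \<le> K * Q"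

lemma abs_mult_le: "\<bar>x\<bar> \<le> X \<Longrightarrow> \<bar>y\<bar> \<le> Y \<Longrightarrow> \<bar>x * y\<bar> \<le> X * (Y::real)"
  unfolding abs_mult by (rule mult_mono) auto

lemma abs_add_le: "\<bar>x\<bar> \<le> X \<Longrightarrow> \<bar>y\<bar> \<le> Y \<Longrightarrow> \<bar>x + y\<bar> \<le> X + (Y::real)" by linarith
lemma abs_diff_le: "\<bar>x\<bar> \<le> X \<Longrightarrow> \<bar>y\<bar> \<le> Y \<Longrightarrow> \<bar>x - y\<bar> \<le> X + (Y::real)" by linarith

section \<open>Lower bounds from nonzero integer resultants\<close>

text \<open>In Taylor coordinates at \<open>y\<close> the Bezout minors have size \<open>Q^2\<close>
  times \<open>t^2 * l\<close> (for \<open>m01\<close>), \<open>t * l\<close> (\<open>m02\<close>,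
  \<open>m03\<close>), \<open>t\<close> (\<open>m12\<close>, \<open>m13\<close>) or 1
  (\<open>m23\<close>). As \<open>l \<le> t \<le> 1\<close>, every term of the determinant is at
  most a constant times \<open>Q^6 * t^3 * l\<close>, while the determinant is a nonzero
  integer.\<close>

lemma res33_lower_bound:
  fixes K Q t l y :: real
  assumes "Q > 0" "0 < l" "l \<le> t" "t \<le> 1" "K > 0"
    and P: "near_double K Q t l y a b c d" and P': "near_double K Q t l y a' b' c' d'"
    and ne: "(a', b', c', d') \<noteq> (a, b, c, d)" "(a', b', c', d') \<noteq> (- a, - b, - c, - d)"
  shows "1 \<le> 64 * K^6 * Q^6 * t^3 * l"
proof -
  define p0 p1 p2 p3 where p: "p0 = taylor0 a b c d y" "p1 = taylor1 a b c y" "p2 = taylor2 a b y" "p3 = real_of_int a"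
  define q0 q1 q2 q3 where q: "q0 = taylor0 a' b' c' d' y" "q1 = taylor1 a' b' c' y" "q2 = taylor2 a' b' y" "q3 = real_of_int a'"
  define B where "B = K^2 * Q^2"
  have B: "B > 0" using assms by (simp add: B_def)
  have t: "t > 0" using assms by linarith
  have b0: "\<bar>p0\<bar> \<le> K * Q * t * l" "\<bar>q0\<bar> \<le> K * Q * t * l" and b1: "\<bar>p1\<bar> \<le> K * Q * t" "\<bar>q1\<bar> \<le> K * Q * t"
    and b2: "\<bar>p2\<bar> \<le> K * Q" "\<bar>q2\<bar> \<le> K * Q" and b3: "\<bar>p3\<bar> \<le> K * Q" "\<bar>q3\<bar> \<le> K * Q"
    using P P' by (auto simp: near_double_def p q)
  have i: "irr3 a b c d" "irr3 a' b' c' d'" using P P' by (auto simp: near_double_def)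
  have "res33 a b c d a' b' c' d' \<noteq> 0" by (rule res33_nonzero[OF i ne])
  then have "1 \<le> \<bar>real_of_int (res33 a b c d a' b' c' d')\<bar>" by linarith
  also have "real_of_int (res33 a b c d a' b' c' d') =
     res33 (real_of_int a) (real_of_int b) (real_of_int c) (real_of_int d) (real_of_int a') (real_of_int b') (real_of_int c') (real_of_int d')"
    by (simp add: res33_def Let_def)
  also have "\<dots> = res33 p3 p2 p1 p0 q3 q2 q1 q0"
    unfolding p q taylor0_def taylor1_def taylor2_def by (rule res33_shift[symmetric])
  finally have one: "1 \<le> \<bar>res33 p3 p2 p1 p0 q3 q2 q1 q0\<bar>" .
  define m01 where "m01 = p0 * q1 - p1 * q0"
  define m02 where "m02 = p0 * q2 - p2 * q0"
  define m03 where "m03 = p0 * q3 - p3 * q0"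
  define m12 where "m12 = p1 * q2 - p2 * q1"
  define m13 where "m13 = p1 * q3 - p3 * q1"
  define m23 where "m23 = p2 * q3 - p3 * q2"
  note bb = abs_diff_le[OF abs_mult_le abs_mult_le]
  have m01: "\<bar>m01\<bar> \<le> 2 * B * (t^2 * l)"
    using bb[OF b0(1) b1(2) b1(1) b0(2)] unfolding m01_def B_def by (simp add: power2_eq_square algebra_simps)
  have m02: "\<bar>m02\<bar> \<le> 2 * B * (t * l)"
    using bb[OF b0(1) b2(2) b2(1) b0(2)] unfolding m02_def B_def by (simp add: power2_eq_square algebra_simps)
  have m03: "\<bar>m03\<bar> \<le> 2 * B * (t * l)"
    using bb[OF b0(1) b3(2) b3(1) b0(2)] unfolding m03_def B_def by (simp add: power2_eq_square algebra_simps)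
  have m12: "\<bar>m12\<bar> \<le> 2 * B * t"
    using bb[OF b1(1) b2(2) b2(1) b1(2)] unfolding m12_def B_def by (simp add: power2_eq_square algebra_simps)
  have m13: "\<bar>m13\<bar> \<le> 2 * B * t"
    using bb[OF b1(1) b3(2) b3(1) b1(2)] unfolding m13_def B_def by (simp add: power2_eq_square algebra_simps)
  have m23: "\<bar>m23\<bar> \<le> 2 * B"
    using bb[OF b2(1) b3(2) b3(1) b2(2)] unfolding m23_def B_def by (simp add: power2_eq_square algebra_simps)
  have tl: "t * l \<le> t" using assms t by (simp add: mult_left_le)
  have m0312: "\<bar>m03 + m12\<bar> \<le> 4 * B * t"
    using abs_add_le[OF m03 m12] mult_left_mono[OF tl, of "2 * B"] B by linarith
  have lt: "t * l * (t * l) \<le> t^3 * l" "t * (t * l) * (t * l) \<le> t^3 * l" "t^2 * l * t * t \<le> t^3 * l"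
  proof -
    have *: "t * l * (t * l) \<le> t * l * (t * t)" using assms t by (intro mult_left_mono) auto
    then show 1: "t * l * (t * l) \<le> t^3 * l" by (simp add: power3_eq_cube algebra_simps)
    have "t * (t * l * (t * l)) \<le> 1 * (t * l * (t * l))" using assms t by (intro mult_right_mono) auto
    with 1 show "t * (t * l) * (t * l) \<le> t^3 * l" by (simp add: algebra_simps)
    have "t * (t^3 * l) \<le> 1 * (t^3 * l)" using assms t by (intro mult_right_mono) auto
    then show "t^2 * l * t * t \<le> t^3 * l" by (simp add: power2_eq_square power3_eq_cube algebra_simps)
  qed
  have B3: "B^3 > 0" using B by simp
  have T1: "\<bar>m01 * ((m03 + m12) * m23 - m13^2)\<bar> \<le> 24 * B^3 * (t^3 * l)"
  proof -
    have "\<bar>m01 * ((m03 + m12) * m23 - m13 * m13)\<bar> \<le> (2 * B * (t^2 * l)) * (4 * B * t * (2 * B) + 2 * B * t * (2 * B * t))"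
      by (rule abs_mult_le[OF m01 abs_diff_le[OF abs_mult_le[OF m0312 m23] abs_mult_le[OF m13 m13]]])
    also have "\<dots> = 16 * B^3 * (t^3 * l) + 8 * B^3 * (t^2 * l * t * t)" by (simp add: power2_eq_square power3_eq_cube algebra_simps)
    also have "\<dots> \<le> 16 * B^3 * (t^3 * l) + 8 * B^3 * (t^3 * l)" using lt B3 t by (intro add_mono mult_left_mono) auto
    finally show ?thesis by (simp add: power2_eq_square ac_simps)
  qed
  have T2: "\<bar>m02 * (m02 * m23 - m13 * m03)\<bar> \<le> 16 * B^3 * (t^3 * l)"
  proof -
    have "\<bar>m02 * (m02 * m23 - m13 * m03)\<bar> \<le> (2 * B * (t * l)) * (2 * B * (t * l) * (2 * B) + 2 * B * t * (2 * B * (t * l)))"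
      by (rule abs_mult_le[OF m02 abs_diff_le[OF abs_mult_le[OF m02 m23] abs_mult_le[OF m13 m03]]])
    also have "\<dots> = 8 * B^3 * (t * l * (t * l)) + 8 * B^3 * (t * (t * l) * (t * l))" by (simp add: power2_eq_square power3_eq_cube algebra_simps)
    also have "\<dots> \<le> 8 * B^3 * (t^3 * l) + 8 * B^3 * (t^3 * l)" using lt B3 t by (intro add_mono mult_left_mono) auto
    finally show ?thesis by (simp add: ac_simps)
  qed
  have T3: "\<bar>m03 * (m02 * m13 - (m03 + m12) * m03)\<bar> \<le> 24 * B^3 * (t^3 * l)"
  proof -
    have "\<bar>m03 * (m02 * m13 - (m03 + m12) * m03)\<bar> \<le> (2 * B * (t * l)) * (2 * B * (t * l) * (2 * B * t) + 4 * B * t * (2 * B * (t * l)))"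
      by (rule abs_mult_le[OF m03 abs_diff_le[OF abs_mult_le[OF m02 m13] abs_mult_le[OF m0312 m03]]])
    also have "\<dots> = 24 * B^3 * (t * (t * l) * (t * l))" by (simp add: power2_eq_square power3_eq_cube algebra_simps)
    also have "\<dots> \<le> 24 * B^3 * (t^3 * l)" using lt B3 by (intro mult_left_mono) auto
    finally show ?thesis by (simp add: ac_simps)
  qed
  have "\<bar>res33 p3 p2 p1 p0 q3 q2 q1 q0\<bar> \<le> 24 * B^3 * (t^3 * l) + 16 * B^3 * (t^3 * l) + 24 * B^3 * (t^3 * l)"
    unfolding res33_def Let_def m01_def[symmetric] m02_def[symmetric] m03_def[symmetric] m12_def[symmetric] m13_def[symmetric] m23_def[symmetric]
    by (rule abs_add_le[OF abs_diff_le[OF T1 T2] T3])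
  also have "\<dots> = 64 * K^6 * Q^6 * t^3 * l"
    by (simp add: B_def power_mult_distrib)
  finally show ?thesis using one by linarith
qed

text \<open>\<open>\<nu>\<close> is the norm of the quadratic in the coordinates of the box. The
  resultant has degree 3 in the quadratic and 2 in the cubic, whence \<open>\<nu>^3\<close> and
  \<open>Q^5\<close>; the weights \<open>t^2\<close>, \<open>t\<close>, 1 of the Taylor coefficients
  give \<open>t^4\<close>. So no quadratic in the lattice is very short.\<close>

lemma res23_lower_bound:
  fixes K Q t y \<nu> :: real and a b c d u v w :: int
  assumes "Q > 0" "0 < t" "t \<le> 1" "K > 0" "\<nu> > 0"
    and P: "near_double K Q t t y a b c d" and ne: "(u, v, w) \<noteq> (0, 0, 0)"
    and U: "\<bar>u + v * y + w * y^2\<bar> \<le> \<nu> * (Q * t^2)" "\<bar>v + 2 * real_of_int w * y\<bar> \<le> \<nu> * (Q * t)" "\<bar>real_of_int w\<bar> \<le> \<nu> * Q"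
  shows "1 \<le> 19 * K^2 * (Q^5 * t^4) * \<nu>^3"
proof -
  define p0 p1 p2 p3 where p: "p0 = taylor0 a b c d y" "p1 = taylor1 a b c y" "p2 = taylor2 a b y" "p3 = real_of_int a"
  define u0 u1 u2 where u: "u0 = u + v * y + w * y^2" "u1 = v + 2 * real_of_int w * y" "u2 = real_of_int w"
  have b: "\<bar>p0\<bar> \<le> K * Q * t^2" "\<bar>p1\<bar> \<le> K * Q * t" "\<bar>p2\<bar> \<le> K * Q" "\<bar>p3\<bar> \<le> K * Q"
    using P by (auto simp: near_double_def p power2_eq_square algebra_simps)
  have U: "\<bar>u0\<bar> \<le> \<nu> * (Q * t^2)" "\<bar>u1\<bar> \<le> \<nu> * (Q * t)" "\<bar>u2\<bar> \<le> \<nu> * Q" using U by (auto simp: u)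
  have i: "irr3 a b c d" using P by (auto simp: near_double_def)
  have "1 \<le> \<bar>real_of_int (res23 u v w a b c d)\<bar>" using res23_nonzero[OF i ne] by linarith
  also have "real_of_int (res23 u v w a b c d) = res23 (real_of_int u) (real_of_int v) (real_of_int w) (real_of_int a) (real_of_int b) (real_of_int c) (real_of_int d)"
    by (simp add: res23_def)
  also have "\<dots> = res23 u0 u1 u2 p3 p2 p1 p0"
    unfolding p u taylor0_def taylor1_def taylor2_def of_int_mult of_int_numeral by (rule res23_shift[symmetric])
  finally have one: "1 \<le> \<bar>res23 u0 u1 u2 p3 p2 p1 p0\<bar>" .
  define B where "B = K * Q^2 * \<nu>"
  define Z where "Z = K^2 * Q^5 * \<nu>^3"
  have B: "B > 0" "Z > 0" using assms by (auto simp: B_def Z_def)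
  note bb = abs_diff_le[OF abs_mult_le abs_mult_le]
  define X where "X = p0 * u2 - p2 * u0"
  define Y where "Y = p0 * u1 - p1 * u0"
  define V where "V = p1 * u2 - p2 * u1 - p3 * u0"
  have X: "\<bar>X\<bar> \<le> 2 * B * t^2"
    using bb[OF b(1) U(3) b(3) U(1)] unfolding X_def B_def by (simp add: power2_eq_square algebra_simps)
  have Y: "\<bar>Y\<bar> \<le> 2 * B * t^3"
    using bb[OF b(1) U(2) b(2) U(1)] unfolding Y_def B_def by (simp add: power2_eq_square power3_eq_cube algebra_simps)
  have tt: "t^2 \<le> t" "t^5 \<le> t^4" using assms power_decreasing[of 1 2 t] power_decreasing[of 4 5 t] by auto
  have V: "\<bar>V\<bar> \<le> 3 * B * t"
  proof -
    have "\<bar>V\<bar> \<le> 2 * B * t + B * t^2"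
      using abs_diff_le[OF bb[OF b(2) U(3) b(3) U(2)] abs_mult_le[OF b(4) U(1)]] unfolding V_def B_def
      by (simp add: power2_eq_square algebra_simps)
    also have "\<dots> \<le> 2 * B * t + B * t" using tt B by simp
    finally show ?thesis by simp
  qed
  have *: "res23 u0 u1 u2 p3 p2 p1 p0 = X * X * u2 + 2 * (p3 * X * u0 * u1) - Y * u2 * V - p3 * Y * (u1 * u1) - p3 * (u0 * u0) * V"
    unfolding res23_def X_def Y_def V_def by (simp add: power2_eq_square algebra_simps)
  have S1: "\<bar>X * X * u2\<bar> \<le> 4 * Z * t^4"
    using abs_mult_le[OF abs_mult_le[OF X X] U(3)] by (simp add: B_def Z_def eval_nat_numeral algebra_simps)
  have S2: "\<bar>p3 * X * u0 * u1\<bar> \<le> 2 * Z * t^5"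
    using abs_mult_le[OF abs_mult_le[OF abs_mult_le[OF b(4) X] U(1)] U(2)] by (simp add: B_def Z_def eval_nat_numeral algebra_simps)
  have S3: "\<bar>Y * u2 * V\<bar> \<le> 6 * Z * t^4"
    using abs_mult_le[OF abs_mult_le[OF Y U(3)] V] by (simp add: B_def Z_def eval_nat_numeral algebra_simps)
  have S4: "\<bar>p3 * Y * (u1 * u1)\<bar> \<le> 2 * Z * t^5"
    using abs_mult_le[OF abs_mult_le[OF b(4) Y] abs_mult_le[OF U(2) U(2)]] by (simp add: B_def Z_def eval_nat_numeral algebra_simps)
  have S5: "\<bar>p3 * (u0 * u0) * V\<bar> \<le> 3 * Z * t^5"
    using abs_mult_le[OF abs_mult_le[OF b(4) abs_mult_le[OF U(1) U(1)]] V] by (simp add: B_def Z_def eval_nat_numeral algebra_simps)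
  have "Z * t^5 \<le> Z * t^4" using tt B by simp
  then have "\<bar>res23 u0 u1 u2 p3 p2 p1 p0\<bar> \<le> 19 * (Z * t^4)"
    using S1 S2 S3 S4 S5 unfolding * by linarith
  also have "\<dots> = 19 * K^2 * (Q^5 * t^4) * \<nu>^3" by (simp add: Z_def)
  finally show ?thesis using one by linarith
qed

text \<open>
  The minors of two quadratics with resultant zero: the quadratics share the rational root \<open>p / q\<close>.
\<close>

lemma isotropic_minors:
  fixes m01 m02 m12 :: int
  assumes "m02^2 = m01 * m12" "m12 \<noteq> 0"
  obtains f p q where "f \<noteq> 0" "q \<noteq> 0" "m12 = f * q^2" "m02 = - f * p * q" "m01 = f * p^2"
proof -
  define g where "g = gcd m12 m02"
  have g: "g \<noteq> 0" using assms(2) by (simp add: g_def)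
  obtain q p' where qp: "m12 = g * q" "m02 = g * p'" "coprime q p'"
    using gcd_coprime_exists[of m12 m02] g unfolding g_def by (metis mult.commute)
  have "g * (g * p'^2) = g * (m01 * q)" using assms(1) unfolding qp by (simp add: power2_eq_square algebra_simps)
  then have e: "g * p'^2 = m01 * q" using g by simp
  then have "q dvd g * p'^2" by simp
  then have "q dvd g" using qp(3) by (simp add: coprime_dvd_mult_left_iff)
  then obtain f where f: "g = q * f" by auto
  have q: "q \<noteq> 0" using assms(2) qp(1) by auto
  have "q * m01 = q * (f * p'^2)" using e f by (auto simp: algebra_simps)
  then have "m01 = f * p'^2" using q by (metis mult_left_cancel)
  with that[of f q "- p'"] f g q qp show ?thesis by (simp add: power2_eq_square algebra_simps)
qed

text \<open>The minors are the Pluecker coordinates of the plane of the two quadratics, and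
  \<open>m02^2 - m01 * m12\<close> is their resultant. If it is nonzero, its size gives the first
  alternative. If it vanishes, either \<open>m12 = 0\<close> and \<open>m01\<close> is a nonzero
  integer, or there is a common root \<open>p / q\<close>, where \<open>q^3\<close> times the value
  of the cubic is a nonzero integer.\<close>

lemma minors_lower_bound:
  fixes K Q t y \<nu> \<mu> :: real and a b c d u v w u' v' w' :: int
  assumes "Q > 0" "0 < t" "t \<le> 1" "K > 0" "\<nu> > 0" "\<mu> > 0"
    and P: "near_double K Q t t y a b c d"
    and U: "\<bar>u + v * y + w * y^2\<bar> \<le> \<nu> * (Q * t^2)" "\<bar>v + 2 * real_of_int w * y\<bar> \<le> \<nu> * (Q * t)" "\<bar>real_of_int w\<bar> \<le> \<nu> * Q"
    and U': "\<bar>u' + v' * y + w' * y^2\<bar> \<le> \<mu> * (Q * t^2)" "\<bar>v' + 2 * real_of_int w' * y\<bar> \<le> \<mu> * (Q * t)" "\<bar>real_of_int w'\<bar> \<le> \<mu> * Q"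
    and ne: "(v * w' - w * v', u * w' - w * u', u * v' - v * u') \<noteq> (0, 0, 0 :: int)"
  shows "1 \<le> 9 * (Q^2 * t^2 * (\<nu> * \<mu>))^2 \<or> 1 \<le> 128 * K^2 * (Q^8 * t^7) * (\<nu> * \<mu>)^3"
proof -
  define m01 m02 m12 where m: "m01 = u * v' - v * u'" "m02 = u * w' - w * u'" "m12 = v * w' - w * v'"
  define u0 u1 u2 where u: "u0 = u + v * y + w * y^2" "u1 = v + 2 * real_of_int w * y" "u2 = real_of_int w"
  define z0 z1 z2 where z: "z0 = u' + v' * y + w' * y^2" "z1 = v' + 2 * real_of_int w' * y" "z2 = real_of_int w'"
  have U: "\<bar>u0\<bar> \<le> \<nu> * (Q * t^2)" "\<bar>u1\<bar> \<le> \<nu> * (Q * t)" "\<bar>u2\<bar> \<le> \<nu> * Q" using U by (auto simp: u)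
  have U': "\<bar>z0\<bar> \<le> \<mu> * (Q * t^2)" "\<bar>z1\<bar> \<le> \<mu> * (Q * t)" "\<bar>z2\<bar> \<le> \<mu> * Q" using U' by (auto simp: z)
  define E where "E = 2 * (\<nu> * \<mu>) * Q^2 * t"
  have E: "E > 0" using assms by (simp add: E_def)
  define n12 where "n12 = u1 * z2 - u2 * z1"
  define n02 where "n02 = u0 * z2 - u2 * z0"
  define n01 where "n01 = u0 * z1 - u1 * z0"
  note bb = abs_diff_le[OF abs_mult_le abs_mult_le]
  have n: "\<bar>n12\<bar> \<le> E" "\<bar>n02\<bar> \<le> E * t" "\<bar>n01\<bar> \<le> E * t^2"
    using bb[OF U(2) U'(3) U(3) U'(2)] bb[OF U(1) U'(3) U(3) U'(1)] bb[OF U(1) U'(2) U(2) U'(1)]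
    unfolding n12_def n02_def n01_def E_def by (simp_all add: power2_eq_square algebra_simps)
  have nm: "n12 = m12" "n02 = m02 + y * m12" "n01 = m01 + 2 * y * m02 + y^2 * m12"
    unfolding n12_def n02_def n01_def m u z by (simp_all add: power2_eq_square algebra_simps)
  show ?thesis
  proof (cases "m02^2 = m01 * m12")
    case False
    then have "1 \<le> \<bar>real_of_int (m02^2 - m01 * m12)\<bar>" by linarith
    also have "real_of_int (m02^2 - m01 * m12) = n02 * n02 - n01 * n12"
      unfolding nm by (simp add: power2_eq_square algebra_simps)
    also have "\<bar>\<dots>\<bar> \<le> 2 * (E * t)^2"
      using bb[OF n(2) n(2) n(3) n(1)] by (simp add: power2_eq_square algebra_simps)
    also have "\<dots> = 8 * (Q^2 * t^2 * (\<nu> * \<mu>))^2" by (simp add: E_def power2_eq_square algebra_simps)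
    also have "\<dots> \<le> 9 * (Q^2 * t^2 * (\<nu> * \<mu>))^2" by simp
    finally show ?thesis by simp
  next
    case True
    show ?thesis
    proof (cases "m12 = 0")
      case m12: True
      with True ne have "m02 = 0" "m01 \<noteq> 0" by (auto simp: m)
      then have "1 \<le> \<bar>real_of_int m01\<bar>" by linarith
      also have "real_of_int m01 = n01" using m12 \<open>m02 = 0\<close> nm by simp
      also have "\<bar>\<dots>\<bar> \<le> E * t^2" by (rule n)
      also have "\<dots> \<le> E * t" using assms E power_decreasing[of 1 2 t] by simp
      finally have "1^2 \<le> (E * t)^2" by (intro power_mono) auto
      then have "1 \<le> 4 * (Q^2 * t^2 * (\<nu> * \<mu>))^2" by (simp add: E_def power2_eq_square algebra_simps)
      also have "\<dots> \<le> 9 * (Q^2 * t^2 * (\<nu> * \<mu>))^2" by simp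
      finally show ?thesis by simp
    next
      case False
      obtain f p q where fpq: "f \<noteq> 0" "q \<noteq> 0" "m12 = f * q^2" "m02 = - f * p * q" "m01 = f * p^2"
        using isotropic_minors[OF True False] by metis
      \<comment> \<open>The identities \<open>n12 = f * q^2\<close> and \<open>n01 = f * r^2\<close>
        with |f| at least 1 bound the height of the common root through the minors; the cubic,
        expanded at \<open>y\<close>, becomes a binary form in \<open>q\<close> and
        \<open>r\<close>.\<close>
      define r where "r = p - y * q"
      have f1: "1 \<le> \<bar>real_of_int f\<bar>" using fpq(1) by linarith
      have "n12 = f * q^2" "n01 = f * r^2" unfolding nm fpq r_def by (simp_all add: power2_eq_square algebra_simps)
      then have "real_of_int q^2 \<le> E" "r^2 \<le> E * t^2"
        using n(1,3) mult_right_mono[OF f1, of "real_of_int q^2"] mult_right_mono[OF f1, of "r^2"] by (auto simp: abs_mult)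
      then have qr: "\<bar>real_of_int q\<bar> \<le> sqrt E" "\<bar>r\<bar> \<le> sqrt E * t"
        using E assms by (auto simp: real_le_rsqrt abs_le_square_iff power_mult_distrib intro: power2_le_imp_le)
      define s where "s = sqrt E"
      have s: "s > 0" "s^2 = E" using E by (auto simp: s_def)
      define p0 p1 p2 p3 where p: "p0 = taylor0 a b c d y" "p1 = taylor1 a b c y" "p2 = taylor2 a b y" "p3 = real_of_int a"
      have pb: "\<bar>p0\<bar> \<le> K * Q * t^2" "\<bar>p1\<bar> \<le> K * Q * t" "\<bar>p2\<bar> \<le> K * Q" "\<bar>p3\<bar> \<le> K * Q"
        using P by (auto simp: near_double_def p power2_eq_square algebra_simps)
      have i: "irr3 a b c d" using P by (auto simp: near_double_def)
      have "1 \<le> \<bar>real_of_int (d * q^3 + c * p * q^2 + b * p^2 * q + a * p^3)\<bar>"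
        using irr3_no_rational_root[OF i fpq(2), of p] by linarith
      also have "real_of_int (d * q^3 + c * p * q^2 + b * p^2 * q + a * p^3) =
          p0 * (real_of_int q * q * q) + p1 * (real_of_int q * q * r) + p2 * (q * r * r) + p3 * (r * r * r)"
        unfolding p taylor0_def taylor1_def taylor2_def r_def by (simp add: power2_eq_square power3_eq_cube algebra_simps)
      also have "\<bar>\<dots>\<bar> \<le> K * Q * t^2 * (s * s * s) + K * Q * t * (s * s * (s * t)) + K * Q * (s * (s * t) * (s * t)) + K * Q * (s * t * (s * t) * (s * t))"
        using qr[folded s_def] pb by (intro abs_add_le abs_mult_le)
      also have "\<dots> = 3 * (K * Q * t^2 * s^3) + K * Q * s^3 * t^3" by (simp add: power2_eq_square power3_eq_cube algebra_simps)
      also have "\<dots> \<le> 3 * (K * Q * t^2 * s^3) + K * Q * s^3 * t^2"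
        using assms s power_decreasing[of 2 3 t] by simp
      also have "\<dots> = 4 * (K * Q * t^2 * s^3)" by simp
      \<comment> \<open>Squaring replaces \<open>s^3\<close> by \<open>E^3\<close>, a polynomial in
        the data; this is the origin of the exponents 8, 7 and 3.\<close>
      finally have "1^2 \<le> (4 * (K * Q * t^2 * s^3))^2" by (intro power_mono) auto
      also have "\<dots> = 16 * K^2 * Q^2 * t^4 * (s^2)^3" by (simp add: power_mult_distrib)
      also have "\<dots> = 128 * K^2 * (Q^8 * t^7) * (\<nu> * \<mu>)^3" unfolding s by (simp add: E_def eval_nat_numeral algebra_simps)
      finally show ?thesis by simp
    qed
  qed
qed

section \<open>Counting cubics with an approximate double root\<close>

lemma cube_root_bound:
  fixes x c Z :: real
  assumes "x > 0" "c \<ge> 1" "Z \<ge> 0" "x^3 \<le> c * Z"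
  shows "x \<le> c * Z powr (1/3)"
proof -
  have "x^3 = x powr 3" using assms by simp
  then have "x = (x^3) powr (1/3)" using assms by (simp add: powr_powr del: powr_numeral)
  also have "\<dots> \<le> (c * Z) powr (1/3)" using assms by (intro powr_mono2) auto
  also have "\<dots> = c powr (1/3) * Z powr (1/3)" using assms by (simp add: powr_mult)
  also have "\<dots> \<le> c * Z powr (1/3)"
    using assms powr_mono[of "1/3" 1 c] by (intro mult_right_mono) auto
  finally show ?thesis .
qed

text \<open>The summands follow the outcomes of \<open>count_box\<close>: at most one point; points
  on a line, by the resultant with the cubic; points spanning a plane, by the two alternatives for
  the minors; and the volume of the box.\<close>

definition cell_bound :: "real \<Rightarrow> real \<Rightarrow> real" where
  "cell_bound Q t = 1 + (Q^5 * t^4) powr (1/3) + Q^2 * t^2 + (Q^8 * t^7) powr (1/3) + Q^3 * t^3"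

text \<open>With \<open>a\<close> and \<open>y\<close> fixed, two cubics of the cell differ by an
  integer quadratic in a box with sides of order \<open>Q * t^2\<close>, \<open>Q * t\<close> and
  \<open>Q\<close>. One cubic of the cell is the base point and also the irreducible partner in the
  lower bounds for short vectors.\<close>

lemma cell_count:
  fixes K Q t y :: real and a :: int
  assumes Q: "Q > 0" and t: "0 < t" "t \<le> 1" and K: "K \<ge> 1"
  defines "S \<equiv> {(d, c, b). near_double K Q t t y a b c d}"
  shows "finite S" "real (card S) \<le> 200000 * K^4 * cell_bound Q t"
proof -
  \<comment> \<open>Taylor coefficients at \<open>y\<close> divided by the sides of the box. The
    shift by \<open>y\<close> is unimodular, so the inverse covolume is the product
    \<open>Q^3 * t^3\<close> of the three sides.\<close>
  define e :: "nat \<Rightarrow> int \<times> int \<times> int \<Rightarrow> real" where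
    "e = (\<lambda>i (u, v, w). if i = 0 then (u + v * y + w * y^2) / (Q * t^2) else if i = 1 then (v + 2 * real_of_int w * y) / (Q * t) else w / Q)"
  define h where "h x = max \<bar>e 0 x\<bar> (max \<bar>e 1 x\<bar> \<bar>e 2 x\<bar>)" for x
  define det :: "int \<times> int \<times> int \<Rightarrow> int \<times> int \<times> int \<Rightarrow> int \<times> int \<times> int \<Rightarrow> int" where
    "det = (\<lambda>(v0, v1, v2) (w0, w1, w2) (x0, x1, x2). (v1 * w2 - v2 * w1) * x0 + (v2 * w0 - v0 * w2) * x1 + (v0 * w1 - v1 * w0) * x2)"
  have e: "e 0 (u, v, w) = (u + v * y + w * y^2) / (Q * t^2)" "e 1 (u, v, w) = (v + 2 * real_of_int w * y) / (Q * t)" "e 2 (u, v, w) = w / Q" for u v w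
    by (simp_all add: e_def)
  have bnd: "\<bar>u + v * y + w * y^2\<bar> \<le> R * (Q * t^2)" "\<bar>v + 2 * real_of_int w * y\<bar> \<le> R * (Q * t)" "\<bar>real_of_int w\<bar> \<le> R * Q"
    if "h (u, v, w) \<le> R" for u v w R
    using that Q t unfolding h_def e by (simp_all add: abs_mult pos_divide_le_eq)
  have bnd': "h (u, v, w) \<le> R" if "\<bar>u + v * y + w * y^2\<bar> \<le> R * (Q * t^2)" "\<bar>v + 2 * real_of_int w * y\<bar> \<le> R * (Q * t)" "\<bar>real_of_int w\<bar> \<le> R * Q"
    for u v w R
    using that Q t unfolding h_def e by (simp add: abs_mult pos_divide_le_eq)
  interpret L: rank3_lattice e h det "Q^3 * t^3"
  proof
    show "h x = max \<bar>e 0 x\<bar> (max \<bar>e 1 x\<bar> \<bar>e 2 x\<bar>)" for x by (simp add: h_def)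
    show "e i (x - z) = e i x - e i z" for i x z
      by (cases x; cases z) (simp add: e_def add_divide_distrib diff_divide_distrib algebra_simps)
    show "0 < h x" if "x \<noteq> 0" for x
    proof (rule ccontr)
      obtain u v w where x: "x = (u, v, w)" by (cases x) auto
      assume "\<not> 0 < h x"
      then have "h (u, v, w) \<le> 0" by (simp add: x)
      from bnd[OF this] have "w = 0" "v = 0" "u = 0" by auto
      with that show False by (simp add: x zero_prod_def)
    qed
    show "0 < Q^3 * t^3" using Q t by simp
    show "finite {x. h x \<le> R}" for R
    proof -
      \<comment> \<open>The leading coefficient is bounded first; the other two follow by undoing
        the shift by \<open>y\<close> one degree at a time.\<close>
      define M1 where "M1 = R * Q"
      define M2 where "M2 = R * (Q * t) + 2 * M1 * \<bar>y\<bar>"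
      define M3 where "M3 = R * (Q * t^2) + M2 * \<bar>y\<bar> + M1 * y^2"
      have "u \<in> {-\<lceil>M3\<rceil>..\<lceil>M3\<rceil>} \<and> v \<in> {-\<lceil>M2\<rceil>..\<lceil>M2\<rceil>} \<and> w \<in> {-\<lceil>M1\<rceil>..\<lceil>M1\<rceil>}" if "h (u, v, w) \<le> R" for u v w
      proof -
        have w: "\<bar>real_of_int w\<bar> \<le> M1" using bnd(3)[OF that] by (simp add: M1_def)
        have "\<bar>real_of_int w * y\<bar> \<le> M1 * \<bar>y\<bar>" using w by (simp add: abs_mult mult_right_mono)
        then have v: "\<bar>real_of_int v\<bar> \<le> M2" using bnd(2)[OF that] unfolding M2_def by linarith
        have "\<bar>real_of_int v * y\<bar> \<le> M2 * \<bar>y\<bar>" "\<bar>w * y^2\<bar> \<le> M1 * y^2" using v w by (simp_all add: abs_mult mult_right_mono)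
        then have u: "\<bar>real_of_int u\<bar> \<le> M3" using bnd(1)[OF that] unfolding M3_def by linarith
        have *: "n \<in> {-\<lceil>M\<rceil>..\<lceil>M\<rceil>}" if "\<bar>real_of_int n\<bar> \<le> M" for n M
        proof -
          have "real_of_int n \<le> M" "- M \<le> real_of_int n" using that by linarith+
          then show ?thesis unfolding atLeastAtMost_iff by linarith
        qed
        show ?thesis using *[OF u] *[OF v] *[OF w] by blast
      qed
      then have "{x. h x \<le> R} \<subseteq> {-\<lceil>M3\<rceil>..\<lceil>M3\<rceil>} \<times> {-\<lceil>M2\<rceil>..\<lceil>M2\<rceil>} \<times> {-\<lceil>M1\<rceil>..\<lceil>M1\<rceil>}" by auto
      then show ?thesis by (rule finite_subset) simp
    qed
    show "real_of_int (det v w x) = Q^3 * t^3 * ((e 1 v * e 2 w - e 2 v * e 1 w) * e 0 x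
       + (e 2 v * e 0 w - e 0 v * e 2 w) * e 1 x + (e 0 v * e 1 w - e 1 v * e 0 w) * e 2 x)" for v w x
    proof -
      obtain v0 v1 v2 w0 w1 w2 x0 x1 x2 where "v = (v0, v1, v2)" "w = (w0, w1, w2)" "x = (x0, x1, x2)"
        by (cases v; cases w; cases x) auto
      have k: "Q^3 * t^3 * ((A / (Q * t) * (B / Q) - C / Q * (D / (Q * t))) * (E / (Q * t^2))) = (A * B - C * D) * E"
        "Q^3 * t^3 * ((A / Q * (B / (Q * t^2)) - C / (Q * t^2) * (D / Q)) * (E / (Q * t))) = (A * B - C * D) * E"
        "Q^3 * t^3 * ((A / (Q * t^2) * (B / (Q * t)) - C / (Q * t) * (D / (Q * t^2))) * (E / Q)) = (A * B - C * D) * E"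
        for A B C D E :: real
      proof -
        have 1: "A / (Q * t) * (B / Q) - C / Q * (D / (Q * t)) = (A * B - C * D) / (Q * t * Q)"
          "A / Q * (B / (Q * t^2)) - C / (Q * t^2) * (D / Q) = (A * B - C * D) / (Q * (Q * t^2))"
          "A / (Q * t^2) * (B / (Q * t)) - C / (Q * t) * (D / (Q * t^2)) = (A * B - C * D) / (Q * t^2 * (Q * t))"
          by (simp_all add: diff_divide_distrib mult.commute)
        have 2: "Q * t * Q * (Q * t^2) = Q^3 * t^3" "Q * (Q * t^2) * (Q * t) = Q^3 * t^3" "Q * t^2 * (Q * t) * Q = Q^3 * t^3"
          by (simp_all add: power2_eq_square power3_eq_cube)
        have 3: "P * (X / Y * (E / Z)) = X * E" if "Y * Z = P" "P \<noteq> 0" for P X Y Z E :: real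
          using that by auto
        have "Q^3 * t^3 \<noteq> 0" using Q t by simp
        note 3 = 3[OF _ this]
        show "Q^3 * t^3 * ((A / (Q * t) * (B / Q) - C / Q * (D / (Q * t))) * (E / (Q * t^2))) = (A * B - C * D) * E"
          unfolding 1 by (rule 3) (rule 2)
        show "Q^3 * t^3 * ((A / Q * (B / (Q * t^2)) - C / (Q * t^2) * (D / Q)) * (E / (Q * t))) = (A * B - C * D) * E"
          unfolding 1 by (rule 3) (rule 2)
        show "Q^3 * t^3 * ((A / (Q * t^2) * (B / (Q * t)) - C / (Q * t) * (D / (Q * t^2))) * (E / Q)) = (A * B - C * D) * E"
          unfolding 1 by (rule 3) (rule 2)
      qed
      show ?thesis unfolding det_def \<open>v = _\<close> \<open>w = _\<close> \<open>x = _\<close> e distrib_left k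
        by (simp add: algebra_simps power2_eq_square)
    qed
  qed
  show fin_card: "finite S" "real (card S) \<le> 200000 * K^4 * cell_bound Q t"
  proof -
    have cb: "cell_bound Q t \<ge> 1" using Q t by (simp add: cell_bound_def)
    have K4: "K^4 \<ge> 1" "K^3 \<le> K^4" using K power_increasing[of 3 4 K] by (simp_all add: one_le_power)
    have main: "finite S \<and> real (card S) \<le> 200000 * K^4 * cell_bound Q t"
    proof (cases "S = {}")
      case True
      then show ?thesis using cb K4 by simp
    next
      case False
      then obtain d0 c0 b0 where P: "near_double K Q t t y a b0 c0 d0" by (auto simp: S_def)
      define X where "X = {x. h x \<le> 2 * K}"
      have "h (x - (d0, c0, b0)) \<le> 2 * K" if xS: "x \<in> S" for x
      proof -
        obtain b c d where x: "x = (d, c, b)" and nd: "near_double K Q t t y a b c d"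
          using xS unfolding S_def by auto
        have 0: "\<bar>taylor0 a b c d y - taylor0 a b0 c0 d0 y\<bar> \<le> 2 * K * (Q * t^2)" "\<bar>taylor1 a b c y - taylor1 a b0 c0 y\<bar> \<le> 2 * K * (Q * t)"
          "\<bar>taylor2 a b y - taylor2 a b0 y\<bar> \<le> 2 * K * Q"
          using P nd unfolding near_double_def by (auto simp: power2_eq_square algebra_simps)
        show ?thesis unfolding x minus_prod_def fst_conv snd_conv
          by (rule bnd') (use 0 in \<open>simp_all add: taylor0_def taylor1_def taylor2_def algebra_simps\<close>)
      qed
      then have sub: "(\<lambda>x. x - (d0, c0, b0)) ` S \<subseteq> X" by (auto simp: X_def)
      have inj: "inj_on (\<lambda>x. x - (d0, c0, b0)) S" by (auto simp: inj_on_def)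
      have finX: "finite X" using L.fin by (simp add: X_def)
      have "finite S" using finite_imageD[OF finite_subset[OF sub finX] inj] .
      moreover have "real (card X) \<le> 200000 * K^4 * cell_bound Q t"
      proof -
        have terms: "(Q^5 * t^4) powr (1/3) \<le> cell_bound Q t" "Q^2 * t^2 \<le> cell_bound Q t"
           "(Q^8 * t^7) powr (1/3) \<le> cell_bound Q t" "Q^3 * t^3 \<le> cell_bound Q t"
          using Q t by (auto simp: cell_bound_def)
        have "K > 0" "2 * K > 0" using K by auto
        from L.count_box[OF this(2)] show ?thesis
        proof (elim disjE exE conjE)
          assume "card {x. h x \<le> 2 * K} \<le> 1"
          then have "real (card X) \<le> 1" by (simp add: X_def)
          moreover have "1 * 1 \<le> (200000 * K^4) * cell_bound Q t" using cb K4 by (intro mult_mono) auto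
          ultimately show ?thesis by linarith
        next
          fix v assume v: "v \<noteq> 0" "real (card {x. h x \<le> 2 * K}) \<le> 6 * (2 * K) / h v"
          obtain v0 v1 v2 where v': "v = (v0, v1, v2)" by (cases v) auto
          have hv: "h v > 0" using L.pos v by simp
          have "1 \<le> 19 * K^2 * (Q^5 * t^4) * (h v)^3"
            by (rule res23_lower_bound[OF Q t \<open>K > 0\<close> hv P _ bnd]) (use v v' in \<open>auto simp: zero_prod_def\<close>)
          then have "(1 / h v)^3 \<le> 19 * K^2 * (Q^5 * t^4)" using hv by (simp add: power_divide pos_divide_le_eq)
          then have "1 / h v \<le> 19 * K^2 * (Q^5 * t^4) powr (1/3)"
            using hv Q t K by (intro cube_root_bound) (auto simp: one_le_power intro: order_trans[of 1 "K^2"])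
          also have "\<dots> \<le> 19 * K^2 * cell_bound Q t" using terms by (intro mult_left_mono) auto
          finally have "12 * K * (1 / h v) \<le> 12 * K * (19 * K^2 * cell_bound Q t)" using K by (intro mult_left_mono) auto
          also have "\<dots> = 228 * K^3 * cell_bound Q t" by (simp add: power2_eq_square power3_eq_cube)
          also have "\<dots> \<le> 200000 * K^4 * cell_bound Q t" using K4 cb by (intro mult_right_mono) auto
          finally show ?thesis using v by (simp add: X_def)
        next
          fix v w assume vw: "\<not> L.par v w" "real (card {x. h x \<le> 2 * K}) \<le> 192 * (2 * K)\<^sup>2 / (h v * h w) + 2304 * (Q^3 * t^3) * (2 * K) ^ 3"
          obtain v0 v1 v2 w0 w1 w2 where v': "v = (v0, v1, v2)" "w = (w0, w1, w2)" by (cases v; cases w) auto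
          have e00: "e i 0 = 0" for i using L.lin[of i 0 0] by simp
          have "v \<noteq> 0" "w \<noteq> 0" using vw(1) by (auto simp: L.par_def e00)
          then have hv: "h v > 0" "h w > 0" using L.pos by auto
          have ne: "(v1 * w2 - v2 * w1, v0 * w2 - v2 * w0, v0 * w1 - v1 * w0) \<noteq> (0, 0, 0)"
          proof
            assume "(v1 * w2 - v2 * w1, v0 * w2 - v2 * w0, v0 * w1 - v1 * w0) = (0, 0, 0)"
            then have "v1 * w2 = v2 * w1" "v0 * w2 = v2 * w0" "v0 * w1 = v1 * w0" by auto
            then have 0: "real_of_int v1 * real_of_int w2 = real_of_int v2 * real_of_int w1" "real_of_int v0 * real_of_int w2 = real_of_int v2 * real_of_int w0" "real_of_int v0 * real_of_int w1 = real_of_int v1 * real_of_int w0"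
              by (metis of_int_mult)+
            have "L.par v w"
              unfolding L.par_def v' e
            proof (intro conjI)
              show "(v1 + 2 * real_of_int v2 * y) / (Q * t) * (w2 / Q) = v2 / Q * ((w1 + 2 * real_of_int w2 * y) / (Q * t))"
                using 0 by (simp add: algebra_simps)
              have *: "(v0 + v1 * y + v2 * y^2) * w2 = v2 * (w0 + w1 * y + w2 * y^2)"
                using 0 by Groebner_Basis.algebra
              show "v2 / Q * ((w0 + w1 * y + w2 * y^2) / (Q * t^2)) = (v0 + v1 * y + v2 * y^2) / (Q * t^2) * (w2 / Q)"
                using * by (simp add: field_simps)
              have *: "(v0 + v1 * y + v2 * y^2) * (w1 + 2 * real_of_int w2 * y) = (v1 + 2 * real_of_int v2 * y) * (w0 + w1 * y + w2 * y^2)"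
                using 0 by Groebner_Basis.algebra
              show "(v0 + v1 * y + v2 * y^2) / (Q * t^2) * ((w1 + 2 * real_of_int w2 * y) / (Q * t)) = (v1 + 2 * real_of_int v2 * y) / (Q * t) * ((w0 + w1 * y + w2 * y^2) / (Q * t^2))"
                unfolding times_divide_times_eq * by (simp add: mult.commute)
            qed
            with vw(1) show False by simp
          qed
          have inv: "1 / (h v * h w) \<le> 128 * K^2 * cell_bound Q t"
          proof -
            have hvw: "h v * h w > 0" using hv by simp
            have K2: "K^2 \<ge> 1" using K by (simp add: one_le_power)
            from minors_lower_bound[OF Q t \<open>K > 0\<close> hv P bnd[of v0 v1 v2] bnd[of w0 w1 w2] ne]
            have "1 \<le> 9 * (Q^2 * t^2 * (h v * h w))^2 \<or> 1 \<le> 128 * K^2 * (Q^8 * t^7) * (h v * h w)^3"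
              using v' by simp
            then show ?thesis
            proof
              assume "1 \<le> 9 * (Q^2 * t^2 * (h v * h w))^2"
              then have "1^2 \<le> (3 * (Q^2 * t^2 * (h v * h w)))^2" by (simp add: power_mult_distrib)
              then have "1 \<le> 3 * (Q^2 * t^2 * (h v * h w))"
                by (rule power2_le_imp_le) (use hvw in simp)
              then have "1 / (h v * h w) \<le> 3 * (Q^2 * t^2)" using hvw by (simp add: pos_divide_le_eq algebra_simps)
              also have "\<dots> \<le> 128 * K^2 * cell_bound Q t"
                using terms(2) K2 cb by (intro mult_mono) auto
              finally show ?thesis .
            next
              assume "1 \<le> 128 * K^2 * (Q^8 * t^7) * (h v * h w)^3"
              then have "(1 / (h v * h w))^3 \<le> 128 * K^2 * (Q^8 * t^7)" 
                unfolding power_divide using hvw by (simp only: pos_divide_le_eq zero_less_power power_one)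
              then have "1 / (h v * h w) \<le> 128 * K^2 * (Q^8 * t^7) powr (1/3)"
                using hvw Q t K2 by (intro cube_root_bound) auto
              also have "\<dots> \<le> 128 * K^2 * cell_bound Q t" using terms by (intro mult_left_mono) auto
              finally show ?thesis .
            qed
          qed
          have "real (card X) \<le> 768 * K^2 * (1 / (h v * h w)) + 18432 * K^3 * (Q^3 * t^3)"
            using vw(2) by (simp add: X_def power_mult_distrib algebra_simps)
          also have "\<dots> \<le> 768 * K^2 * (128 * K^2 * cell_bound Q t) + 18432 * K^4 * cell_bound Q t"
            using inv terms(4) K4 K cb Q t hv by (intro add_mono mult_mono) auto
          also have "\<dots> = 116736 * (K^4 * cell_bound Q t)" by (simp add: eval_nat_numeral algebra_simps)
          also have "\<dots> \<le> 200000 * (K^4 * cell_bound Q t)" using K4 cb by (intro mult_right_mono) auto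
          finally show ?thesis by (simp add: mult.assoc)
        qed
      qed
      moreover have "card S \<le> card X" using card_mono[OF finX sub] card_image[OF inj] by simp
      ultimately show ?thesis by auto
    qed
    show "finite S" "real (card S) \<le> 200000 * K^4 * cell_bound Q t" using main by auto
  qed
qed

section \<open>Counting cubics with a small derivative near a root\<close>

text \<open>The point \<open>x\<close> may differ from cubic to cubic; rounding it to a grid lets
  all cubics of one cell share a point.\<close>

definition small_deriv :: "real \<Rightarrow> real \<Rightarrow> real \<Rightarrow> real \<Rightarrow> real \<Rightarrow> (int \<times> int \<times> int \<times> int) set" where
  "small_deriv N K Q t l = {(a, b, c, d). irr3 a b c d \<and>
     coeff_le Q a \<and> coeff_le Q b \<and> coeff_le Q c \<and> coeff_le Q d \<and>
     (\<exists>x::real. \<bar>x\<bar> \<le> N \<and> \<bar>taylor0 a b c d x\<bar> \<le> Q * t * l \<and> \<bar>taylor1 a b c x\<bar> \<le> K * Q * t)}"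

lemma finite_small_deriv: "finite (small_deriv N K Q t l)"
proof -
  define I where "I = {n::int. coeff_le Q n}"
  have "finite I"
  proof (rule finite_subset)
    show "I \<subseteq> {-\<lfloor>2 * Q\<rfloor>..\<lfloor>2 * Q\<rfloor>}" by (auto simp: I_def le_floor_iff abs_le_iff) linarith
  qed simp
  then have "finite (I \<times> I \<times> I \<times> I)" by simp
  then show ?thesis by (rule rev_finite_subset) (auto simp: small_deriv_def I_def)
qed

lemma taylor_add:
  fixes x h :: "'a::comm_ring_1"
  shows "taylor0 a b c d (x + h) = taylor0 a b c d x + taylor1 a b c x * h + taylor2 a b x * h^2 + of_int a * h^3"
    and "taylor1 a b c (x + h) = taylor1 a b c x + 2 * taylor2 a b x * h + 3 * of_int a * h^2"
    and "taylor2 a b (x + h) = taylor2 a b x + 3 * of_int a * h"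
  by (simp_all add: taylor0_def taylor1_def taylor2_def power2_eq_square power3_eq_cube algebra_simps)

text \<open>Rounding \<open>x\<close> down to a multiple of \<open>l\<close> moves it by at most
  \<open>l\<close>; by Taylor expansion each bound then grows only by a factor depending on
  \<open>K\<close> and \<open>N\<close>.\<close>

lemma small_deriv_near_double:
  fixes N K Q t l :: real
  assumes N: "N \<ge> 1" and K: "K \<ge> 1" and Q: "Q > 0" and l: "0 < l" "l \<le> t" "t \<le> 1"
    and m: "(a, b, c, d) \<in> small_deriv N K Q t l"
  obtains k :: int where "- N / l - 1 \<le> k" "k \<le> N / l" "near_double (K + 12 * N + 10) Q t l (k * l) a b c d"
proof -
  obtain x where x: "irr3 a b c d" "coeff_le Q a" "coeff_le Q b" "\<bar>x\<bar> \<le> N" "\<bar>taylor0 a b c d x\<bar> \<le> Q * t * l" "\<bar>taylor1 a b c x\<bar> \<le> K * Q * t"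
    using m by (auto simp: small_deriv_def)
  define k where "k = \<lfloor>x / l\<rfloor>"
  define h where "h = k * l - x"
  have kx: "k \<le> x / l" "x / l < k + 1" by (auto simp: k_def)
  then have "k * l \<le> x" "x < (k + 1) * l" using l by (simp_all add: pos_le_divide_eq pos_divide_less_eq)
  then have h: "\<bar>h\<bar> \<le> l" by (auto simp: h_def algebra_simps)
  have y: "k * l = x + h" by (simp add: h_def)
  have "x / l \<le> N / l" "- N / l \<le> x / l" using x(4) l by (intro divide_right_mono; simp add: abs_le_iff)+
  then have k: "- N / l - 1 \<le> k" "k \<le> N / l" using kx by linarith+
  \<comment> \<open>\<open>M * Q\<close> bounds half the second derivative for |x| \<le> N. The
    derivative is the most expensive of the estimates and needs \<open>K + 2 * M + 6\<close>, which
    equals \<open>K + 12 * N + 10\<close>.\<close>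
  define M where "M = 6 * N + 2"
  have s2: "\<bar>taylor2 a b x\<bar> \<le> M * Q"
  proof -
    have "\<bar>b + 3 * (a * x)\<bar> \<le> 2 * Q + 3 * (2 * Q * N)"
      using x(3) abs_mult_le[OF x(2,4)] by (intro abs_add_le) (auto simp: abs_mult ac_simps)
    then show ?thesis by (simp add: taylor2_def M_def algebra_simps)
  qed
  have t: "t > 0" using l by linarith
  have h2: "\<bar>h^2\<bar> \<le> l^2" using power_mono[OF h, of 2] by simp
  have h3: "\<bar>h^3\<bar> \<le> l^3" using power_mono[OF h, of 3] by (simp add: power_abs)
  have ll: "l^2 \<le> t * l" "l^3 \<le> t * l" "l^2 \<le> t"
  proof -
    show 1: "l^2 \<le> t * l" using l by (simp add: power2_eq_square)
    have "l * l^2 \<le> 1 * l^2" using l by (intro mult_right_mono) auto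
    then show "l^3 \<le> t * l" using 1 by (simp add: power2_eq_square power3_eq_cube)
    have "t * l \<le> t * 1" using l t by (intro mult_left_mono) auto
    then show "l^2 \<le> t" using 1 by simp
  qed
  show ?thesis
  proof (rule that[OF k])
    show "near_double (K + 12 * N + 10) Q t l (k * l) a b c d"
      unfolding near_double_def y taylor_add
    proof (intro conjI x(1))
      have "\<bar>taylor0 a b c d x + taylor1 a b c x * h + taylor2 a b x * h^2 + a * h^3\<bar> \<le> Q * t * l + K * Q * t * l + M * Q * l^2 + 2 * Q * l^3"
        by (intro abs_add_le abs_mult_le x h h2 h3 s2)
      also have "\<dots> \<le> Q * t * l + K * Q * t * l + M * Q * (t * l) + 2 * Q * (t * l)"
        using ll Q N K t by (intro add_mono mult_left_mono) (auto simp: M_def)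
      also have "\<dots> = (K + M + 3) * (Q * t * l)" by (simp add: algebra_simps)
      also have "\<dots> \<le> (K + 12 * N + 10) * (Q * t * l)" using N Q t l by (intro mult_right_mono) (auto simp: M_def)
      finally show "\<bar>taylor0 a b c d x + taylor1 a b c x * h + taylor2 a b x * h^2 + a * h^3\<bar> \<le> (K + 12 * N + 10) * Q * t * l" by (simp add: mult.assoc)
      have "\<bar>taylor1 a b c x + 2 * (taylor2 a b x * h) + 3 * (a * h^2)\<bar> \<le> K * Q * t + 2 * (M * Q * l) + 3 * (2 * Q * l^2)"
        using abs_mult_le[OF s2 h] abs_mult_le[OF x(2) h2] by (intro abs_add_le x) (auto simp: abs_mult ac_simps)
      also have "\<dots> \<le> K * Q * t + 2 * (M * Q * t) + 3 * (2 * Q * t)"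
        using ll l Q N K by (intro add_mono mult_left_mono) (auto simp: M_def)
      also have "\<dots> = (K + 2 * M + 6) * (Q * t)" by (simp add: algebra_simps)
      also have "\<dots> \<le> (K + 12 * N + 10) * (Q * t)" using N Q t l by (intro mult_right_mono) (auto simp: M_def)
      finally show "\<bar>taylor1 a b c x + 2 * taylor2 a b x * h + 3 * real_of_int a * h^2\<bar> \<le> (K + 12 * N + 10) * Q * t" by (simp add: mult.assoc)
      have "\<bar>taylor2 a b x + 3 * (a * h)\<bar> \<le> M * Q + 3 * (2 * Q * l)"
        using s2 abs_mult_le[OF x(2) h] by (intro abs_add_le) (auto simp: abs_mult ac_simps)
      also have "\<dots> \<le> M * Q + 3 * (2 * Q * 1)" using l Q N by (intro add_mono mult_left_mono) (auto simp: M_def)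
      also have "\<dots> \<le> (K + 12 * N + 10) * Q" using N Q K by (simp add: M_def algebra_simps)
      finally show "\<bar>taylor2 a b x + 3 * real_of_int a * h\<bar> \<le> (K + 12 * N + 10) * Q" by (simp add: mult.assoc)
      have "2 * Q \<le> (K + 12 * N + 10) * Q" using N K Q by (intro mult_right_mono) auto
      then show "\<bar>real_of_int a\<bar> \<le> (K + 12 * N + 10) * Q" using x(2) by simp
    qed
  qed
qed

lemma card_cells:
  fixes N l :: real
  assumes "N \<ge> 1" "0 < l" "l \<le> 1"
  defines "I \<equiv> {k::int. - N / l - 1 \<le> k \<and> k \<le> N / l}"
  shows "finite I" "real (card I) \<le> 4 * N / l"
proof -
  have "1 \<le> N / l" using assms by simp
  then have *: "- N / l - 1 \<le> N / l + 1" by simp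
  show "finite I" unfolding I_def by (rule card_int_interval(1)[OF *])
  show "real (card I) \<le> 4 * N / l" using card_int_interval(2)[OF *] \<open>1 \<le> N / l\<close> unfolding I_def by simp
qed

text \<open>Cubics are sorted by leading coefficient and cell, which makes about
  \<open>Q / t\<close> classes, and each class is bounded by \<open>cell_count\<close>.\<close>

lemma small_deriv_count_lattice:
  fixes N K Q t :: real
  assumes N: "N \<ge> 1" and K: "K \<ge> 1" and Q: "Q \<ge> 1" and t: "0 < t" "t \<le> 1"
  shows "real (card (small_deriv N K Q t t)) \<le> 4000000 * N * (K + 12 * N + 10)^4 * (Q / t * cell_bound Q t)"
proof -
  define K' where "K' = K + 12 * N + 10"
  define S where "S = small_deriv N K Q t t"
  define I where "I = {k::int. - N / t - 1 \<le> k \<and> k \<le> N / t}"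
  define J where "J = {n::int. - 2 * Q \<le> n \<and> n \<le> 2 * Q}"
  have "\<exists>k. k \<in> I \<and> near_double K' Q t t (k * t) a b c d" if "(a, b, c, d) \<in> S" for a b c d
    by (rule small_deriv_near_double[OF N K _ t(1) order_refl t(2) that[unfolded S_def]])
       (use Q in \<open>auto simp: K'_def I_def\<close>)
  then have "\<forall>x. \<exists>k. x \<in> S \<longrightarrow> k \<in> I \<and> (case x of (a, b, c, d) \<Rightarrow> near_double K' Q t t (k * t) a b c d)" by auto
  then obtain k where "\<forall>x. x \<in> S \<longrightarrow> k x \<in> I \<and> (case x of (a, b, c, d) \<Rightarrow> near_double K' Q t t (k x * t) a b c d)"
    by (rule choice[THEN exE])
  then have k: "k (a, b, c, d) \<in> I \<and> near_double K' Q t t (k (a, b, c, d) * t) a b c d" if "(a, b, c, d) \<in> S" for a b c d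
    using that by fastforce
  define g where "g = (\<lambda>(a::int, b::int, c::int, d::int). (a, k (a, b, c, d)))"
  have K': "K' \<ge> 1" using N K by (simp add: K'_def)
  have cb: "cell_bound Q t \<ge> 0" using Q t by (simp add: cell_bound_def)
  have m0: "0 \<le> 200000 * K'^4 * cell_bound Q t" using K' cb by simp
  have "real (card S) \<le> real (card (g ` S)) * (200000 * K'^4 * cell_bound Q t)"
  proof (rule card_le_fibres)
    show "finite S" unfolding S_def by (rule finite_small_deriv)
    fix z assume "z \<in> g ` S"
    obtain a i where z: "z = (a, i)" by (cases z)
    define T where "T = {(d, c, b). near_double K' Q t t (i * t) a b c d}"
    have T: "finite T" "real (card T) \<le> 200000 * K'^4 * cell_bound Q t"
      using cell_count[of Q t K' "i * t" a] Q t K' by (auto simp: T_def)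
    have "{x \<in> S. g x = z} \<subseteq> (\<lambda>(d, c, b). (a, b, c, d)) ` T"
    proof
      fix x assume "x \<in> {x \<in> S. g x = z}"
      moreover obtain a' b c d where "x = (a', b, c, d)" by (cases x) auto
      ultimately have "x = (a, b, c, d)" "(a, b, c, d) \<in> S" "k (a, b, c, d) = i" by (auto simp: g_def z)
      with k[of a b c d] show "x \<in> (\<lambda>(d, c, b). (a, b, c, d)) ` T"
        by (auto simp: T_def image_iff)
    qed
    then have "card {x \<in> S. g x = z} \<le> card T"
      using surj_card_le[OF T(1)] by blast
    then show "real (card {x \<in> S. g x = z}) \<le> 200000 * K'^4 * cell_bound Q t" using T(2) by linarith
  qed
  also have "\<dots> \<le> (5 * Q * (4 * N / t)) * (200000 * K'^4 * cell_bound Q t)"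
  proof (rule mult_right_mono[OF _ m0])
    have I: "finite I" "real (card I) \<le> 4 * N / t" using card_cells[OF N t] by (simp_all add: I_def)
    have *: "- 2 * Q \<le> 2 * Q + 1" using Q by simp
    have J: "finite J" "real (card J) \<le> 5 * Q"
      using card_int_interval[OF *] Q by (auto simp: J_def)
    have "g ` S \<subseteq> J \<times> I"
      using k by (fastforce simp: g_def J_def S_def small_deriv_def abs_le_iff)
    then have "card (g ` S) \<le> card (J \<times> I)" using I J by (intro card_mono) auto
    then have "real (card (g ` S)) \<le> real (card J) * real (card I)" by (metis card_cartesian_product of_nat_le_iff of_nat_mult)
    also have "\<dots> \<le> 5 * Q * (4 * N / t)" using I J by (intro mult_mono) (use Q in auto)
    finally show "real (card (g ` S)) \<le> 5 * Q * (4 * N / t)" .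
  qed
  finally show ?thesis unfolding S_def K'_def by (simp add: algebra_simps)
qed

text \<open>The mesh \<open>l\<close> may be finer than \<open>t\<close>: this pushes the resultant
  bound below 1 at the price of \<open>1 / l\<close> cells, and each cell then holds at most one
  cubic and its negative.\<close>

lemma small_deriv_count_resultant:
  fixes N K Q t l :: real
  assumes N: "N \<ge> 1" and K: "K \<ge> 1" and Q: "Q > 0" and l: "0 < l" "l \<le> t" "t \<le> 1"
    and small: "64 * (K + 12 * N + 10)^6 * Q^6 * t^3 * l < 1"
  shows "real (card (small_deriv N K Q t l)) \<le> 8 * N / l"
proof -
  define K' where "K' = K + 12 * N + 10"
  define S where "S = small_deriv N K Q t l"
  define I where "I = {k::int. - N / l - 1 \<le> k \<and> k \<le> N / l}"
  have "\<exists>k. k \<in> I \<and> near_double K' Q t l (k * l) a b c d" if "(a, b, c, d) \<in> S" for a b c d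
    by (rule small_deriv_near_double[OF N K Q l that[unfolded S_def]]) (auto simp: K'_def I_def)
  then have "\<forall>x. \<exists>k. x \<in> S \<longrightarrow> k \<in> I \<and> (case x of (a, b, c, d) \<Rightarrow> near_double K' Q t l (k * l) a b c d)" by auto
  then obtain k where "\<forall>x. x \<in> S \<longrightarrow> k x \<in> I \<and> (case x of (a, b, c, d) \<Rightarrow> near_double K' Q t l (k x * l) a b c d)"
    by (rule choice[THEN exE])
  then have k: "k (a, b, c, d) \<in> I \<and> near_double K' Q t l (k (a, b, c, d) * l) a b c d" if "(a, b, c, d) \<in> S" for a b c d
    using that by fastforce
  have K': "K' > 0" using N K by (simp add: K'_def)
  have I: "finite I" "real (card I) \<le> 4 * N / l" using card_cells[of N l] N l by (simp_all add: I_def)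
  have "real (card S) \<le> real (card (k ` S)) * 2"
  proof (rule card_le_fibres)
    show "finite S" unfolding S_def by (rule finite_small_deriv)
    fix i assume "i \<in> k ` S"
    then obtain a b c d where x: "(a, b, c, d) \<in> S" "k (a, b, c, d) = i" by auto
    have "{x \<in> S. k x = i} \<subseteq> {(a, b, c, d), (-a, -b, -c, -d)}"
    proof
      fix z assume z: "z \<in> {x \<in> S. k x = i}"
      obtain a' b' c' d' where z': "z = (a', b', c', d')" by (cases z) auto
      show "z \<in> {(a, b, c, d), (-a, -b, -c, -d)}"
      proof (rule ccontr)
        assume "z \<notin> {(a, b, c, d), (-a, -b, -c, -d)}"
        then have "1 \<le> 64 * K'^6 * Q^6 * t^3 * l"
          using k[OF x(1)] k[of a' b' c' d'] z x(2) unfolding z'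
          by (intro res33_lower_bound[OF Q l K', of "i * l" a b c d a' b' c' d']) auto
        with small show False by (simp add: K'_def)
      qed
    qed
    then have "card {x \<in> S. k x = i} \<le> card {(a, b, c, d), (-a, -b, -c, -d)}" by (intro card_mono) auto
    also have "\<dots> \<le> 2" by (simp add: card_insert_if)
    finally show "real (card {x \<in> S. k x = i}) \<le> 2" by simp
  qed
  also have "real (card (k ` S)) * 2 \<le> (4 * N / l) * 2"
  proof -
    have "card (k ` S) \<le> card I" using k I by (intro card_mono) auto
    then show ?thesis using I by linarith
  qed
  finally show ?thesis by (simp add: S_def)
qed

section \<open>Roots with a large derivative\<close>

text \<open>Each summand is at most \<open>2 * (sqrt k - sqrt (k - 1))\<close>, and these
  telescope.\<close>

lemma sum_inverse_sqrt: "(\<Sum>k=1..n. 1 / sqrt (real k)) \<le> 2 * sqrt (real n)"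
proof (induction n)
  case (Suc n)
  have pos: "sqrt (real (Suc n)) + sqrt (real n) > 0" by (simp add: add_pos_nonneg)
  have "(sqrt (real (Suc n)) + sqrt (real n)) * (sqrt (real (Suc n)) - sqrt (real n)) = 1"
    by (simp add: algebra_simps)
  then have "sqrt (real (Suc n)) - sqrt (real n) = 1 / (sqrt (real (Suc n)) + sqrt (real n))"
    using pos by (simp add: field_simps)
  also have "\<dots> \<ge> 1 / (2 * sqrt (real (Suc n)))"
    using pos by (intro divide_left_mono) (auto simp: mult_pos_pos)
  finally have "1 / sqrt (real (Suc n)) \<le> 2 * (sqrt (real (Suc n)) - sqrt (real n))" by simp
  then show ?case using Suc.IH by simp
qed simp

lemma sum_inverse_sqrt_int:
  fixes Q :: real
  assumes "Q \<ge> 0"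
  defines "A \<equiv> {a::int. a \<noteq> 0 \<and> coeff_le Q a}"
  shows "finite A" "(\<Sum>a\<in>A. 1 / sqrt \<bar>real_of_int a\<bar>) \<le> 6 * sqrt Q"
proof -
  define n where "n = nat \<lfloor>2 * Q\<rfloor>"
  have n: "real n \<le> 2 * Q" using assms(1) by (simp add: n_def)
  define P where "P = (\<lambda>k. int k) ` {1..n}"
  define R where "R = (\<lambda>k. - int k) ` {1..n}"
  have sub: "A \<subseteq> P \<union> R"
  proof
    fix a assume "a \<in> A"
    then have a: "a \<noteq> 0" "\<bar>a\<bar> \<le> \<lfloor>2 * Q\<rfloor>" by (auto simp: A_def le_floor_iff)
    then have m: "nat \<bar>a\<bar> \<in> {1..n}" by (auto simp: n_def)
    show "a \<in> P \<union> R"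
    proof (cases "a \<ge> 0")
      case True
      then have "a = int (nat \<bar>a\<bar>)" by simp
      then show ?thesis using m unfolding P_def by blast
    next
      case False
      then have "a = - int (nat \<bar>a\<bar>)" by simp
      then show ?thesis using m unfolding R_def by blast
    qed
  qed
  then show "finite A" by (rule finite_subset) (simp add: P_def R_def)
  have "(\<Sum>a\<in>A. 1 / sqrt \<bar>real_of_int a\<bar>) \<le> (\<Sum>a\<in>P \<union> R. 1 / sqrt \<bar>real_of_int a\<bar>)"
    by (rule sum_mono2[OF _ sub]) (auto simp: P_def R_def)
  also have "\<dots> = (\<Sum>a\<in>P. 1 / sqrt \<bar>real_of_int a\<bar>) + (\<Sum>a\<in>R. 1 / sqrt \<bar>real_of_int a\<bar>)"
    by (rule sum.union_disjoint) (auto simp: P_def R_def)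
  also have "(\<Sum>a\<in>P. 1 / sqrt \<bar>real_of_int a\<bar>) = (\<Sum>k=1..n. 1 / sqrt (real k))"
    unfolding P_def by (subst sum.reindex) (auto simp: inj_on_def)
  also have "(\<Sum>a\<in>R. 1 / sqrt \<bar>real_of_int a\<bar>) = (\<Sum>k=1..n. 1 / sqrt (real k))"
    unfolding R_def by (subst sum.reindex) (auto simp: inj_on_def)
  also have "(\<Sum>k=1..n. 1 / sqrt (real k)) + (\<Sum>k=1..n. 1 / sqrt (real k)) \<le> 4 * sqrt (real n)"
    using sum_inverse_sqrt[of n] by simp
  also have "\<dots> \<le> 4 * sqrt (2 * Q)" using n by simp
  also have "\<dots> \<le> 6 * sqrt Q"
  proof -
    have "sqrt (2 * Q) \<le> sqrt ((3/2)^2 * Q)" using assms(1) by (intro real_sqrt_le_mono) (simp add: power2_eq_square)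
    also have "\<dots> = 3/2 * sqrt Q" by (simp add: real_sqrt_mult)
    finally show ?thesis by simp
  qed
  finally show "(\<Sum>a\<in>A. 1 / sqrt \<bar>real_of_int a\<bar>) \<le> 6 * sqrt Q" .
qed

lemma card_Sigma_le:
  assumes "finite A" "\<And>x. x \<in> A \<Longrightarrow> finite (B x)" "\<And>x. x \<in> A \<Longrightarrow> real (card (B x)) \<le> f x"
  shows "real (card (Sigma A B)) \<le> (\<Sum>x\<in>A. f x)"
proof -
  have "real (card (Sigma A B)) = (\<Sum>x\<in>A. real (card (B x)))"
    using assms by (subst card_SigmaI) auto
  also have "\<dots> \<le> (\<Sum>x\<in>A. f x)" by (rule sum_mono) (rule assms(3))
  finally show ?thesis .
qed

lemma card_shifted:
  fixes r \<rho> :: real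
  assumes "\<rho> \<ge> 0"
  shows "finite {n::int. \<bar>n + r\<bar> \<le> \<rho>}" "real (card {n::int. \<bar>n + r\<bar> \<le> \<rho>}) \<le> 2 * \<rho> + 1"
proof -
  have *: "{n::int. \<bar>n + r\<bar> \<le> \<rho>} = {n::int. - \<rho> - r \<le> n \<and> n \<le> \<rho> - r}" by (auto simp: abs_le_iff)
  have "- \<rho> - r \<le> \<rho> - r + 1" using assms by simp
  from card_int_interval[OF this] show "finite {n::int. \<bar>n + r\<bar> \<le> \<rho>}" "real (card {n::int. \<bar>n + r\<bar> \<le> \<rho>}) \<le> 2 * \<rho> + 1"
    unfolding * by auto
qed

lemma norm_mult_le: "norm x \<le> X \<Longrightarrow> norm y \<le> Y \<Longrightarrow> norm (x * y) \<le> X * Y" for x y :: "'a::real_normed_field"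
  unfolding norm_mult by (rule mult_mono) (auto intro: order_trans[OF norm_ge_zero])

lemma norm_add_le: "norm x \<le> X \<Longrightarrow> norm y \<le> Y \<Longrightarrow> norm (x + y) \<le> X + Y" for x y :: "'a::real_normed_field"
  by (rule norm_triangle_mono)

text \<open>Stated over a normed field so as to serve both real points and complex roots; one crude
  constant covers all three coefficients.\<close>

lemma taylor_bounds:
  fixes M Q :: real and z :: "'a::real_normed_field"
  assumes "M \<ge> 1" "norm z \<le> M" "coeff_le Q a" "coeff_le Q b" "coeff_le Q c"
  shows "norm (taylor1 a b c z) \<le> 12 * M^2 * Q" "norm (taylor2 a b z) \<le> 12 * M^2 * Q" "norm (of_int a :: 'a) \<le> 12 * M^2 * Q"
proof -
  have Q: "Q \<ge> 0" using assms(3) by linarith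
  have M: "1 \<le> M^2" "M \<le> M^2" using assms(1) by (auto simp: power2_eq_square one_le_power) (metis mult_mono mult_1 zero_le_one order_trans)
  have MQ: "Q \<le> M^2 * Q" "M * Q \<le> M^2 * Q" using mult_right_mono[OF M(1) Q] mult_right_mono[OF M(2) Q] by auto
  have abc: "norm (of_int a :: 'a) \<le> 2 * Q" "norm (of_int b :: 'a) \<le> 2 * Q" "norm (of_int c :: 'a) \<le> 2 * Q"
    using assms by auto
  have z2: "norm (z^2) \<le> M^2" using assms(2) by (simp add: norm_power power_mono)
  have n: "norm (2::'a) \<le> 2" "norm (3::'a) \<le> 3" by auto
  have "norm (of_int c + 2 * (of_int b * z) + 3 * (of_int a * z^2)) \<le> 2 * Q + 2 * (2 * Q * M) + 3 * (2 * Q * M^2)"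
    by (intro norm_add_le norm_mult_le abc assms z2 n)
  also have "\<dots> = 2 * Q + 4 * (M * Q) + 6 * (M^2 * Q)" by simp
  also have "\<dots> \<le> 12 * (M^2 * Q)" using MQ by linarith
  finally show "norm (taylor1 a b c z) \<le> 12 * M^2 * Q" by (simp only: taylor1_def mult.assoc)
  have "norm (of_int b + 3 * (of_int a * z)) \<le> 2 * Q + 3 * (2 * Q * M)"
    by (intro norm_add_le norm_mult_le abc assms n)
  also have "\<dots> = 2 * Q + 6 * (M * Q)" by simp
  also have "\<dots> \<le> 12 * (M^2 * Q)" using MQ Q by linarith
  finally show "norm (taylor2 a b z) \<le> 12 * M^2 * Q" by (simp only: taylor2_def mult.assoc)
  show "norm (of_int a :: 'a) \<le> 12 * M^2 * Q" using MQ abc(1) Q by linarith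
qed

lemmas taylor_bounds_real = taylor_bounds[where 'a = real, unfolded real_norm_def]

text \<open>Only \<open>a\<close>, \<open>b\<close>, \<open>c\<close> occur, as derivatives do not
  see the constant coefficient. The second alternative is the cofactor of the squared derivative in
  the discriminant, taken at a point \<open>y\<close> near the root.\<close>

definition near_degenerate :: "real \<Rightarrow> real \<Rightarrow> real \<Rightarrow> real \<Rightarrow> (int \<times> int \<times> int) set" where
  "near_degenerate C Q T y = {(a, b, c). a \<noteq> 0 \<and> coeff_le Q a \<and> coeff_le Q b \<and> coeff_le Q c
     \<and> (\<bar>taylor1 a b c y\<bar> \<le> C * Q * T \<or> \<bar>(taylor2 a b y)^2 - 4 * real_of_int a * taylor1 a b c y\<bar> \<le> C * Q^2 * T)}"

text \<open>\<open>T\<close> is the proportion of surviving triples. A small derivative confines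
  \<open>c\<close> once \<open>a\<close> and \<open>b\<close> are chosen. In the second alternative
  the values |a| \<le> Q T are few enough by themselves; for larger \<open>a\<close> the number
  \<open>b + 3 * a * y\<close> is at most of order sqrt (Q |a|) and \<open>c\<close> lies in an
  interval of length about Q^2 T / |a|, so the sum of 1 / sqrt |a| decides. The condition
  \<open>1 \<le> Q * T\<close> absorbs rounding terms.\<close>

lemma card_near_degenerate:
  fixes C Q T M y :: real
  assumes M: "M \<ge> 1" "\<bar>y\<bar> \<le> M" and C: "C \<ge> 1" and T: "0 < T" "T \<le> 1" "1 \<le> Q * T"
  shows "finite (near_degenerate C Q T y)"
    "real (card (near_degenerate C Q T y)) \<le> (150 * C + 54 * C * (48 * M^2 + C)) * (Q^3 * T)"
proof -
  have Q: "Q \<ge> 1" using T mult_left_mono[of T 1 Q] by (smt (verit) mult_nonneg_nonneg mult_nonpos_nonneg)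
  define A where "A = {a::int. a \<noteq> 0 \<and> coeff_le Q a}"
  define J where "J = {a::int. \<bar>real_of_int a + 0\<bar> \<le> 2 * Q}"
  have J: "finite J" "real (card J) \<le> 5 * Q" using card_shifted[of "2 * Q" 0] Q by (auto simp: J_def)
  have AJ: "A \<subseteq> J" by (auto simp: A_def J_def)
  have finA: "finite A" using finite_subset[OF AJ J(1)] .
  \<comment> \<open>\<open>48 * M^2\<close> comes from 4 |a| |P'(y)| with |P'(y)| \<le> 12 M^2 Q,
    and \<open>C\<close> from the bound C Q^2 T on the cofactor, where Q T < |a|.\<close>
  define W where "W = 48 * M^2 + C"
  have W: "W \<ge> 1" using C zero_le_power2[of M] unfolding W_def by linarith
  define A0 where "A0 = {a \<in> A. \<bar>real_of_int a + 0\<bar> \<le> Q * T}"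
  define A1 where "A1 = {a \<in> A. \<not> \<bar>real_of_int a\<bar> \<le> Q * T}"
  define C1 where "C1 a b = {c::int. \<bar>c + (2 * b * y + 3 * a * y^2)\<bar> \<le> C * Q * T}" for a b :: int
  define B3 where "B3 a = {b::int. \<bar>b + 3 * a * y\<bar> \<le> sqrt (W * Q * \<bar>real_of_int a\<bar>)}" for a :: int
  define C3 where "C3 a b = {c::int. \<bar>c + (2 * b * y + 3 * a * y^2 - (taylor2 a b y)^2 / (4 * a))\<bar> \<le> C * Q^2 * T / (4 * \<bar>real_of_int a\<bar>)}" for a b :: int
  define G1 where "G1 = (SIGMA a:J. SIGMA b:J. C1 a b)"
  define G2 where "G2 = A0 \<times> J \<times> J"
  define G3 where "G3 = (SIGMA a:A1. SIGMA b:B3 a. C3 a b)"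
  have sub: "near_degenerate C Q T y \<subseteq> G1 \<union> G2 \<union> G3"
  proof
    fix z assume z: "z \<in> near_degenerate C Q T y"
    obtain a b c where zz: "z = (a, b, c)" by (cases z) auto
    have abc: "a \<in> A" "coeff_le Q a" "coeff_le Q b" "coeff_le Q c" "a \<noteq> 0"
      and or: "\<bar>taylor1 a b c y\<bar> \<le> C * Q * T \<or> \<bar>(taylor2 a b y)^2 - 4 * real_of_int a * taylor1 a b c y\<bar> \<le> C * Q^2 * T"
      using z by (auto simp: zz near_degenerate_def A_def)
    have J: "a \<in> J" "b \<in> J" "c \<in> J" using abc by (auto simp: J_def)
    show "z \<in> G1 \<union> G2 \<union> G3"
    proof (cases "\<bar>taylor1 a b c y\<bar> \<le> C * Q * T")
      case True
      then have "z \<in> G1" using J by (auto simp: zz G1_def C1_def taylor1_def add.assoc)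
      then show ?thesis by simp
    next
      case False
      with or have dd: "\<bar>(taylor2 a b y)^2 - 4 * real_of_int a * taylor1 a b c y\<bar> \<le> C * Q^2 * T" by simp
      show ?thesis
      proof (cases "\<bar>real_of_int a\<bar> \<le> Q * T")
        case True
        then have "z \<in> G2" using J abc by (auto simp: zz G2_def A0_def)
        then show ?thesis by simp
      next
        case False
        then have aA1: "a \<in> A1" using abc by (simp add: A1_def)
        have s1: "\<bar>taylor1 a b c y\<bar> \<le> 12 * M^2 * Q" by (rule taylor_bounds_real[OF M abc(2-4)])
        have "(taylor2 a b y)^2 \<le> C * Q^2 * T + 4 * (\<bar>real_of_int a\<bar> * \<bar>taylor1 a b c y\<bar>)"
          using dd abs_ge_self[of "real_of_int a * taylor1 a b c y"] by (simp add: abs_mult abs_le_iff)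
        also have "\<dots> \<le> C * Q * \<bar>real_of_int a\<bar> + 4 * (\<bar>real_of_int a\<bar> * (12 * M^2 * Q))"
        proof (intro add_mono mult_left_mono s1)
          have "C * Q * (Q * T) \<le> C * Q * \<bar>real_of_int a\<bar>" using False C Q by (intro mult_left_mono) auto
          then show "C * Q^2 * T \<le> C * Q * \<bar>real_of_int a\<bar>" by (simp add: power2_eq_square algebra_simps)
        qed auto
        also have "\<dots> = W * Q * \<bar>real_of_int a\<bar>" by (simp add: W_def algebra_simps)
        finally have "\<bar>taylor2 a b y\<bar> \<le> sqrt (W * Q * \<bar>real_of_int a\<bar>)" by (rule real_le_rsqrt[of "\<bar>taylor2 a b y\<bar>", simplified])
        then have b: "b \<in> B3 a" by (simp add: B3_def taylor2_def)
        have a0: "real_of_int a \<noteq> 0" using abc by simp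
        have "taylor1 a b c y - (taylor2 a b y)^2 / (4 * a) = - ((taylor2 a b y)^2 - 4 * real_of_int a * taylor1 a b c y) / (4 * a)"
          using a0 by (simp add: field_simps)
        then have "\<bar>taylor1 a b c y - (taylor2 a b y)^2 / (4 * a)\<bar> \<le> C * Q^2 * T / (4 * \<bar>real_of_int a\<bar>)"
          using dd by (simp add: abs_mult divide_right_mono)
        then have "c \<in> C3 a b" by (simp add: C3_def taylor1_def add_diff_eq add.assoc)
        then show ?thesis using aA1 b by (simp add: zz G3_def)
      qed
    qed
  qed
  have g1: "finite G1 \<and> real (card G1) \<le> 75 * C * (Q^3 * T)"
  proof -
    have CQT: "C * Q * T \<ge> 1" using mult_mono[of 1 C 1 "Q * T"] C T by (simp add: mult.assoc)
    have c1: "finite (C1 a b)" "real (card (C1 a b)) \<le> 3 * (C * Q * T)" for a b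
      using card_shifted[of "C * Q * T" "2 * b * y + 3 * a * y^2"] CQT unfolding C1_def by auto
    have c2: "finite (SIGMA b:J. C1 a b)" "real (card (SIGMA b:J. C1 a b)) \<le> 5 * Q * (3 * (C * Q * T))" for a
    proof -
      show "finite (SIGMA b:J. C1 a b)" using J c1 by auto
      have "real (card (SIGMA b:J. C1 a b)) \<le> (\<Sum>b\<in>J. 3 * (C * Q * T))" by (rule card_Sigma_le) (use J c1 in auto)
      also have "\<dots> = real (card J) * (3 * (C * Q * T))" by simp
      also have "\<dots> \<le> 5 * Q * (3 * (C * Q * T))" using J CQT by (intro mult_right_mono) auto
      finally show "real (card (SIGMA b:J. C1 a b)) \<le> 5 * Q * (3 * (C * Q * T))" .
    qed
    have "real (card G1) \<le> (\<Sum>a\<in>J. 5 * Q * (3 * (C * Q * T)))" unfolding G1_def by (rule card_Sigma_le) (use J c2 in auto)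
    also have "\<dots> = real (card J) * (5 * Q * (3 * (C * Q * T)))" by simp
    also have "\<dots> \<le> 5 * Q * (5 * Q * (3 * (C * Q * T)))" using J CQT Q by (intro mult_right_mono) auto
    finally show ?thesis using J c2 by (auto simp: G1_def power3_eq_cube algebra_simps)
  qed
  have g2: "finite G2 \<and> real (card G2) \<le> 75 * (Q^3 * T)"
  proof -
    have A0: "finite A0" "real (card A0) \<le> 3 * (Q * T)"
    proof -
      have p: "- (Q * T) \<le> Q * T + 1" using T by simp
      have r: "- (Q * T) \<le> real_of_int n \<and> real_of_int n \<le> Q * T" if "n \<in> A0" for n
        using that by (auto simp: A0_def)
      note c = card_int_subset_interval[OF p r]
      show "finite A0" by (rule c(1))
      show "real (card A0) \<le> 3 * (Q * T)" using c(2)[of A0] T by simp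
    qed
    have "real (card G2) = real (card A0) * (real (card J) * real (card J))"
      unfolding G2_def by (simp add: card_cartesian_product)
    also have "\<dots> \<le> 3 * (Q * T) * (5 * Q * (5 * Q))" using A0 J T Q by (intro mult_mono) auto
    finally show ?thesis using A0 J by (auto simp: G2_def power3_eq_cube algebra_simps)
  qed
  have g3: "finite G3 \<and> real (card G3) \<le> 54 * C * W * (Q^3 * T)"
  proof -
    have finA1: "finite A1" using finA by (simp add: A1_def)
    have a: "1 \<le> \<bar>real_of_int a\<bar>" "coeff_le Q a" if "a \<in> A1" for a using that by (auto simp: A1_def A_def)
    have c3: "finite (C3 a b) \<and> real (card (C3 a b)) \<le> 3 * C * (Q^2 * T) / \<bar>real_of_int a\<bar>" if "a \<in> A1" for a b
    proof -
      \<comment> \<open>The interval for \<open>c\<close> has length at least a constant, since |a|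
        \<le> 2 Q \<le> 2 Q^2 T; this is what absorbs the rounding term.\<close>
      have "2 * Q * 1 \<le> 2 * Q * (Q * T)" using T Q by (intro mult_left_mono) auto
      then have "\<bar>real_of_int a\<bar> \<le> 2 * (Q^2 * T)" using a(2)[OF that] by (simp add: power2_eq_square)
      also have "\<dots> \<le> 2 * C * (Q^2 * T)" using C T by (intro mult_right_mono) auto
      finally have "1 \<le> 2 * C * (Q^2 * T) / \<bar>real_of_int a\<bar>" using a[OF that] by (simp add: pos_le_divide_eq)
      moreover define X where "X = C * (Q^2 * T) / \<bar>real_of_int a\<bar>"
      ultimately have "1 \<le> 2 * X" "X \<ge> 0" using C T by (simp_all add: X_def)
      then have *: "2 * (X / 4) + 1 \<le> 3 * X" by linarith
      have e: "C * Q^2 * T / (4 * \<bar>real_of_int a\<bar>) = X / 4" "3 * C * (Q^2 * T) / \<bar>real_of_int a\<bar> = 3 * X"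
        by (simp_all add: X_def ac_simps)
      have X4: "X / 4 \<ge> 0" using \<open>X \<ge> 0\<close> by simp
      show ?thesis using card_shifted[OF X4, of "2 * b * y + 3 * a * y^2 - (taylor2 a b y)^2 / (4 * a)"] * unfolding C3_def e by linarith
    qed
    have b3: "finite (B3 a) \<and> real (card (B3 a)) \<le> 3 * sqrt (W * Q * \<bar>real_of_int a\<bar>)" if "a \<in> A1" for a
    proof -
      have "1 * 1 * 1 \<le> W * Q * \<bar>real_of_int a\<bar>" using W Q a[OF that] by (intro mult_mono) auto
      then have s1: "1 \<le> sqrt (W * Q * \<bar>real_of_int a\<bar>)" by simp
      then have s0: "0 \<le> sqrt (W * Q * \<bar>real_of_int a\<bar>)" by linarith
      have "real (card (B3 a)) \<le> 3 * sqrt (W * Q * \<bar>real_of_int a\<bar>)"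
        using card_shifted(2)[OF s0, of "3 * a * y"] s1 unfolding B3_def by linarith
      then show ?thesis using card_shifted(1)[OF s0, of "3 * a * y"] unfolding B3_def by blast
    qed
    have s: "finite (SIGMA b:B3 a. C3 a b) \<and> real (card (SIGMA b:B3 a. C3 a b)) \<le> 9 * C * sqrt (W * Q) * (Q^2 * T) * (1 / sqrt \<bar>real_of_int a\<bar>)" if aA: "a \<in> A1" for a
    proof -
      have "real (card (SIGMA b:B3 a. C3 a b)) \<le> (\<Sum>b\<in>B3 a. 3 * C * (Q^2 * T) / \<bar>real_of_int a\<bar>)"
        by (rule card_Sigma_le) (use b3[OF aA] c3[OF aA] in auto)
      also have "\<dots> = real (card (B3 a)) * (3 * C * (Q^2 * T) / \<bar>real_of_int a\<bar>)" by simp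
      also have "\<dots> \<le> 3 * sqrt (W * Q * \<bar>real_of_int a\<bar>) * (3 * C * (Q^2 * T) / \<bar>real_of_int a\<bar>)"
        using b3[OF aA] C T by (intro mult_right_mono) auto
      also have "\<dots> = 9 * C * sqrt (W * Q) * (Q^2 * T) * (sqrt \<bar>real_of_int a\<bar> / \<bar>real_of_int a\<bar>)"
        by (simp add: real_sqrt_mult)
      also have "sqrt \<bar>real_of_int a\<bar> / \<bar>real_of_int a\<bar> = 1 / sqrt \<bar>real_of_int a\<bar>"
        by (simp add: real_div_sqrt field_simps sqrt_divide_self_eq inverse_eq_divide)
      finally show ?thesis using b3[OF aA] c3[OF aA] by auto
    qed
    have "real (card G3) \<le> (\<Sum>a\<in>A1. 9 * C * sqrt (W * Q) * (Q^2 * T) * (1 / sqrt \<bar>real_of_int a\<bar>))"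
      unfolding G3_def by (rule card_Sigma_le) (use finA1 s in auto)
    also have "\<dots> = 9 * C * sqrt (W * Q) * (Q^2 * T) * (\<Sum>a\<in>A1. 1 / sqrt \<bar>real_of_int a\<bar>)"
      by (simp add: sum_distrib_left)
    also have "\<dots> \<le> 9 * C * sqrt (W * Q) * (Q^2 * T) * (6 * sqrt Q)"
    proof (intro mult_left_mono)
      have "(\<Sum>a\<in>A1. 1 / sqrt \<bar>real_of_int a\<bar>) \<le> (\<Sum>a\<in>A. 1 / sqrt \<bar>real_of_int a\<bar>)"
        by (rule sum_mono2[OF finA]) (auto simp: A1_def)
      also have "\<dots> \<le> 6 * sqrt Q" using sum_inverse_sqrt_int[of Q] Q by (simp add: A_def)
      finally show "(\<Sum>a\<in>A1. 1 / sqrt \<bar>real_of_int a\<bar>) \<le> 6 * sqrt Q" .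
    qed (use C W Q T in auto)
    also have "\<dots> = 54 * C * sqrt W * (Q^3 * T)"
    proof -
      have "sqrt Q * sqrt Q = Q" using Q by simp
      then show ?thesis by (simp add: real_sqrt_mult power2_eq_square power3_eq_cube algebra_simps)
    qed
    also have "\<dots> \<le> 54 * C * W * (Q^3 * T)"
    proof (intro mult_right_mono mult_left_mono)
      have "sqrt W \<le> sqrt (W * W)" using W by (intro real_sqrt_le_mono) auto
      then show "sqrt W \<le> W" using W by simp
    qed (use C Q T in auto)
    finally show ?thesis using finA1 s by (auto simp: G3_def)
  qed
  show "finite (near_degenerate C Q T y)" using g1 g2 g3 finite_subset[OF sub] by auto
  have "card (near_degenerate C Q T y) \<le> card (G1 \<union> G2 \<union> G3)" using g1 g2 g3 by (intro card_mono sub) auto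
  also have "\<dots> \<le> card G1 + card G2 + card G3"
    by (metis (no_types, lifting) add_right_mono card_Un_le order_trans)
  finally have "real (card (near_degenerate C Q T y)) \<le> 75 * C * (Q^3 * T) + 75 * (Q^3 * T) + 54 * C * W * (Q^3 * T)"
    using g1 g2 g3 by linarith
  also have "75 * (Q^3 * T) \<le> 75 * C * (Q^3 * T)" using C T Q by (intro mult_right_mono) auto
  finally show "real (card (near_degenerate C Q T y)) \<le> (150 * C + 54 * C * (48 * M^2 + C)) * (Q^3 * T)"
    by (simp add: W_def algebra_simps)
qed

section \<open>Double counting of isolated real roots\<close>

text \<open>The threshold is \<open>2 * L * sqrt Q\<close> with \<open>L = 12 * (M + 1)^2\<close>:
  from there on the linear Taylor term dominates within distance 1 / (4 |P'(\<alpha>)|) of the root.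
  The \<open>M + 1\<close> leaves room for points at distance at most 1 from \<alpha>.\<close>

definition simple_roots :: "real \<Rightarrow> real \<Rightarrow> real \<Rightarrow> real \<Rightarrow> (int \<times> int \<times> int \<times> int \<times> real) set" where
  "simple_roots \<kappa> M Q T = {(a, b, c, d, \<alpha>::real). a \<noteq> 0 \<and> coeff_le Q a \<and> coeff_le Q b
     \<and> coeff_le Q c \<and> coeff_le Q d \<and> \<bar>\<alpha>\<bar> \<le> M \<and> taylor0 a b c d \<alpha> = 0
     \<and> 24 * (M + 1)^2 * sqrt Q \<le> \<bar>taylor1 a b c \<alpha>\<bar> \<and> \<bar>real_of_int (disc3 a b c d)\<bar> \<le> \<kappa> * Q^4 * T^3}"

lemma finite_simple_roots: "finite (simple_roots \<kappa> M Q T)"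
proof -
  define J where "J = {n::int. coeff_le Q n}"
  have J: "finite J"
  proof (rule finite_subset)
    show "J \<subseteq> {-\<lfloor>2 * Q\<rfloor>..\<lfloor>2 * Q\<rfloor>}" by (auto simp: J_def le_floor_iff abs_le_iff) linarith
  qed simp
  have "finite {\<alpha>::real. taylor0 a b c d \<alpha> = 0}" if "a \<noteq> 0" for a b c d
  proof -
    have "finite {\<alpha>. poly [:real_of_int d, of_int c, of_int b, of_int a:] \<alpha> = 0}"
      using that by (intro poly_roots_finite) auto
    also have "{\<alpha>. poly [:real_of_int d, of_int c, of_int b, of_int a:] \<alpha> = 0} = {\<alpha>::real. taylor0 a b c d \<alpha> = 0}"
      by (simp add: taylor0_def power2_eq_square power3_eq_cube algebra_simps)
    finally show ?thesis .
  qed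
  then have "finite (SIGMA a:J - {0}. SIGMA b:J. SIGMA c:J. SIGMA d:J. {\<alpha>::real. taylor0 a b c d \<alpha> = 0})"
    using J by (intro finite_SigmaI) auto
  then show ?thesis
    by (rule rev_finite_subset) (auto simp: simple_roots_def J_def)
qed

context
  fixes M Q L :: real
  assumes M: "M \<ge> 1" and Q: "Q \<ge> 1" and L: "L = 12 * (M + 1)^2"
begin

lemma one_le_L: "L \<ge> 1"
  unfolding L using M one_le_power[of "M + 1" 2] by linarith

lemma step_bounds:
  assumes "2 * L * sqrt Q \<le> p"
  shows "p > 0" "1 / (4 * p) \<le> 1" "4 * (L * Q) \<le> p^2" "L * (1 / (8 * p)) \<le> 1 / (16 * sqrt Q)"
proof -
  have sQ: "sqrt Q \<ge> 1" using Q by simp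
  have "2 * 1 * 1 \<le> 2 * L * sqrt Q" using one_le_L sQ by (intro mult_mono) auto
  then have p2: "p \<ge> 2" using assms by linarith
  then show "p > 0" "1 / (4 * p) \<le> 1" by auto
  have "4 * (1 * (L * Q)) \<le> 4 * (L * (L * Q))" using one_le_L Q by (intro mult_left_mono mult_right_mono) auto
  also have "\<dots> = (2 * L * sqrt Q)^2" using Q by (simp add: power_mult_distrib power2_eq_square)
  also have "\<dots> \<le> p^2" using assms one_le_L sQ by (intro power_mono) auto
  finally show "4 * (L * Q) \<le> p^2" by simp
  show "L * (1 / (8 * p)) \<le> 1 / (16 * sqrt Q)" using assms p2 sQ by (simp add: field_simps)
qed

text \<open>A second root at distance |h| forces p \<le> 2 L Q |h| for p = |P'(\<alpha>)|, hence
  \<open>p^2 \<le> L * Q / 2\<close>, whereas the threshold gives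
  \<open>p^2 \<ge> 4 * (L * Q)\<close>.\<close>

lemma root_isolated:
  fixes \<alpha> \<alpha>' :: real
  assumes b: "coeff_le Q a" "coeff_le Q b" "coeff_le Q c" and \<alpha>: "\<bar>\<alpha>\<bar> \<le> M"
    and r: "taylor0 a b c d \<alpha> = 0" "taylor0 a b c d \<alpha>' = 0" and p: "2 * L * sqrt Q \<le> \<bar>taylor1 a b c \<alpha>\<bar>"
    and close: "\<bar>\<alpha>' - \<alpha>\<bar> \<le> 1 / (4 * \<bar>taylor1 a b c \<alpha>\<bar>)"
  shows "\<alpha>' = \<alpha>"
proof (rule ccontr)
  assume ne: "\<alpha>' \<noteq> \<alpha>"
  define h where "h = \<alpha>' - \<alpha>"
  define p where "p = \<bar>taylor1 a b c \<alpha>\<bar>"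
  note st = step_bounds[OF p[folded p_def]]
  have h: "h \<noteq> 0" "\<bar>h\<bar> \<le> 1 / (4 * p)" using ne close by (auto simp: h_def p_def)
  then have h1: "\<bar>h\<bar> \<le> 1" using st(2) by linarith
  have M1: "M + 1 \<ge> 1" "\<bar>\<alpha>\<bar> \<le> M + 1" using M \<alpha> by auto
  note bd = taylor_bounds_real[OF M1 b, folded L]
  have "\<alpha>' = \<alpha> + h" by (simp add: h_def)
  then have "taylor0 a b c d \<alpha> + taylor1 a b c \<alpha> * h + taylor2 a b \<alpha> * h^2 + a * h^3 = 0"
    using r(2) taylor_add(1) by metis
  then have "h * (taylor1 a b c \<alpha> + (taylor2 a b \<alpha> * h + a * (h * h))) = 0"
    using r(1) by (simp add: power2_eq_square power3_eq_cube algebra_simps)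
  then have "\<bar>taylor1 a b c \<alpha>\<bar> = \<bar>taylor2 a b \<alpha> * h + a * (h * h)\<bar>" using h(1) by (simp add: add_eq_0_iff)
  also have "\<dots> \<le> L * Q * \<bar>h\<bar> + L * Q * (\<bar>h\<bar> * 1)"
    using h1 by (intro abs_add_le abs_mult_le bd) auto
  also have "\<dots> = 2 * (L * Q) * \<bar>h\<bar>" by simp
  also have "\<dots> \<le> 2 * (L * Q) * (1 / (4 * p))" using h one_le_L Q by (intro mult_left_mono) auto
  finally have "p \<le> 2 * (L * Q) * (1 / (4 * p))" by (simp add: p_def)
  then have "p * p \<le> 2 * (L * Q) * (1 / (4 * p)) * p" using st(1) by (intro mult_right_mono) auto
  also have "\<dots> = L * Q / 2" using st(1) by simp
  finally have "p^2 \<le> L * Q / 2" by (simp add: power2_eq_square)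
  moreover have "L * Q > 0" using one_le_L Q by simp
  ultimately show False using st(3) by linarith
qed

text \<open>The bound 1 / 2 is made for comparing two cubics with equal \<open>a\<close>,
  \<open>b\<close>, \<open>c\<close> at a common point: their values there differ by the integer
  \<open>d - d'\<close>, which is therefore zero.\<close>

lemma value_near_root:
  fixes \<alpha> y :: real
  assumes b: "coeff_le Q a" "coeff_le Q b" "coeff_le Q c" and \<alpha>: "\<bar>\<alpha>\<bar> \<le> M"
    and r: "taylor0 a b c d \<alpha> = 0" and p: "2 * L * sqrt Q \<le> \<bar>taylor1 a b c \<alpha>\<bar>"
    and close: "\<bar>y - \<alpha>\<bar> \<le> 1 / (8 * \<bar>taylor1 a b c \<alpha>\<bar>)"
  shows "\<bar>taylor0 a b c d y\<bar> < 1 / 2"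
proof -
  define h where "h = y - \<alpha>"
  define p where "p = \<bar>taylor1 a b c \<alpha>\<bar>"
  note st = step_bounds[OF p[folded p_def]]
  have h: "\<bar>h\<bar> \<le> 1 / (8 * p)" using close by (auto simp: h_def p_def)
  have "1 / (8 * p) \<le> 1 / (4 * p)" using st(1) by (simp add: field_simps)
  then have h1: "\<bar>h\<bar> \<le> 1" using h st(2) by linarith
  have M1: "M + 1 \<ge> 1" "\<bar>\<alpha>\<bar> \<le> M + 1" using M \<alpha> by auto
  note bd = taylor_bounds_real[OF M1 b, folded L]
  have "y = \<alpha> + h" by (simp add: h_def)
  then have "taylor0 a b c d y = taylor1 a b c \<alpha> * h + (taylor2 a b \<alpha> * (h * h) + a * (h * h * h))"
    using r taylor_add(1)[of a b c d \<alpha> h] by (simp add: power2_eq_square power3_eq_cube)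
  also have "\<bar>\<dots>\<bar> \<le> p * (1 / (8 * p)) + (L * Q * (1 / (8 * p) * (1 / (8 * p))) + L * Q * (1 / (8 * p) * (1 / (8 * p)) * 1))"
    using h h1 bd by (intro abs_add_le abs_mult_le) (auto simp: p_def)
  also have "\<dots> = 1 / 8 + (L * Q) / (32 * p^2)" using st(1) by (simp add: power2_eq_square)
  also have "\<dots> \<le> 1 / 8 + 1 / 128"
  proof -
    have "(L * Q) / (32 * p^2) \<le> (p^2 / 4) / (32 * p^2)" using st by (intro divide_right_mono) auto
    also have "\<dots> = 1 / 128" using st(1) by simp
    finally show ?thesis by simp
  qed
  finally show ?thesis by simp
qed

text \<open>The discriminant factors only at the root. Passing to \<open>y\<close> changes the
  derivative by O(Q T) and the cofactor by O(Q^2 T), because L |y - \<alpha>| is at most 1 / (16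
  sqrt Q) and \<open>1 \<le> Q * T^2\<close>.\<close>

lemma degenerate_near_root:
  fixes \<alpha> y :: real
  assumes b: "a \<noteq> 0" "coeff_le Q a" "coeff_le Q b" "coeff_le Q c" and \<alpha>: "\<bar>\<alpha>\<bar> \<le> M"
    and r: "taylor0 a b c d \<alpha> = 0" and p: "2 * L * sqrt Q \<le> \<bar>taylor1 a b c \<alpha>\<bar>"
    and close: "\<bar>y - \<alpha>\<bar> \<le> 1 / (8 * \<bar>taylor1 a b c \<alpha>\<bar>)"
    and T: "0 < T" "1 \<le> Q * T^2" and \<kappa>: "\<kappa> > 0" and disc: "\<bar>real_of_int (disc3 a b c d)\<bar> \<le> \<kappa> * Q^4 * T^3"
  shows "(a, b, c) \<in> near_degenerate (\<kappa> + 3 * L + 2) Q T y"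
proof -
  define h where "h = y - \<alpha>"
  define p where "p = \<bar>taylor1 a b c \<alpha>\<bar>"
  note st = step_bounds[OF p[folded p_def]]
  have h: "\<bar>h\<bar> \<le> 1 / (8 * p)" using close by (auto simp: h_def p_def)
  have "1 / (8 * p) \<le> 1 / (4 * p)" using st(1) by (simp add: field_simps)
  then have h1: "\<bar>h\<bar> \<le> 1" using h st(2) by linarith
  have sQ: "sqrt Q \<ge> 1" using Q by simp
  have "L * \<bar>h\<bar> \<le> L * (1 / (8 * p))" using h one_le_L by (intro mult_left_mono) auto
  then have Lh: "L * \<bar>h\<bar> \<le> 1 / (16 * sqrt Q)" using st(4) by linarith
  have "sqrt 1 \<le> sqrt (Q * T^2)" using T by (intro real_sqrt_le_mono)
  then have sT: "1 \<le> sqrt Q * T" using T by (simp add: real_sqrt_mult)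
  then have sT': "1 / sqrt Q \<le> T" using sQ by (simp add: field_simps)
  have hT: "L * \<bar>h\<bar> \<le> T / 16" using Lh sT' by simp
  have M1: "M + 1 \<ge> 1" "\<bar>\<alpha>\<bar> \<le> M + 1" using M \<alpha> by auto
  note bd = taylor_bounds_real[OF M1 b(2-4), folded L]
  have yh: "y = \<alpha> + h" by (simp add: h_def)
  have "\<bar>2 * (taylor2 a b \<alpha> * h) + 3 * (a * (h * h))\<bar> \<le> 2 * (L * Q * \<bar>h\<bar>) + 3 * (L * Q * (\<bar>h\<bar> * 1))"
    using h1 by (intro abs_add_le abs_mult_le bd) auto
  also have "\<dots> = 5 * Q * (L * \<bar>h\<bar>)" by simp
  also have "taylor1 a b c \<alpha> + (2 * (taylor2 a b \<alpha> * h) + 3 * (a * (h * h))) = taylor1 a b c y"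
    unfolding yh taylor_add(2) by (simp add: power2_eq_square)
  then have "2 * (taylor2 a b \<alpha> * h) + 3 * (a * (h * h)) = taylor1 a b c y - taylor1 a b c \<alpha>" by simp
  finally have d1: "\<bar>taylor1 a b c y - taylor1 a b c \<alpha>\<bar> \<le> 5 * Q * (L * \<bar>h\<bar>)" .
  define C where "C = \<kappa> + 3 * L + 2"
  have "\<bar>taylor1 a b c y\<bar> \<le> C * Q * T \<or> \<bar>(taylor2 a b y)^2 - 4 * real_of_int a * taylor1 a b c y\<bar> \<le> C * Q^2 * T"
  proof (cases "p \<le> Q * T")
    case True
    have "5 * Q * (L * \<bar>h\<bar>) \<le> 5 * Q * (T / 16)" using hT Q by (intro mult_left_mono) auto
    also have "\<dots> = 5 / 16 * (Q * T)" by simp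
    also have "\<dots> \<le> Q * T" using Q T by simp
    finally have "\<bar>taylor1 a b c y\<bar> \<le> 2 * (Q * T)" using d1 True unfolding p_def by linarith
    also have "\<dots> \<le> C * (Q * T)" using \<kappa> one_le_L Q T by (intro mult_right_mono) (auto simp: C_def)
    finally show ?thesis by (simp add: mult.assoc)
  next
    case False
    define X where "X = (taylor2 a b \<alpha>)^2 - 4 * real_of_int a * taylor1 a b c \<alpha>"
    have "real_of_int (disc3 a b c d) = disc3 (real_of_int a) (of_int b) (of_int c) (of_int d)"
      by (simp add: disc3_def)
    also have "\<dots> = (taylor1 a b c \<alpha>)^2 * X"
      using disc3_at_root[of "real_of_int d" "real_of_int c" \<alpha> "real_of_int b" "real_of_int a"] r
      by (simp add: X_def taylor0_def taylor1_def taylor2_def)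
    finally have "p^2 * \<bar>X\<bar> \<le> \<kappa> * Q^4 * T^3" using disc by (simp add: abs_mult p_def)
    moreover have "(Q * T)^2 * \<bar>X\<bar> \<le> p^2 * \<bar>X\<bar>" using False Q T by (intro mult_right_mono power_mono) auto
    ultimately have "(Q * T)^2 * \<bar>X\<bar> \<le> (Q * T)^2 * (\<kappa> * Q^2 * T)" by (simp add: eval_nat_numeral algebra_simps)
    then have X: "\<bar>X\<bar> \<le> \<kappa> * Q^2 * T" using Q T by simp
    define Y where "Y = taylor1 a b c y - taylor1 a b c \<alpha>"
    have eq: "(taylor2 a b y)^2 - 4 * real_of_int a * taylor1 a b c y = X + (6 * (taylor2 a b \<alpha> * (a * h)) + 9 * (a * (a * (h * h))) - 4 * (a * Y))"
      unfolding X_def Y_def yh taylor_add(3) by (simp add: power2_eq_square algebra_simps)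
    have "\<bar>6 * (taylor2 a b \<alpha> * (a * h)) + 9 * (a * (a * (h * h))) - 4 * (a * Y)\<bar>
       \<le> 6 * (L * Q * (L * Q * \<bar>h\<bar>)) + 9 * (L * Q * (L * Q * (\<bar>h\<bar> * 1))) + 4 * (L * Q * (5 * Q * (L * \<bar>h\<bar>)))"
      using h1 d1 by (intro abs_add_le abs_diff_le abs_mult_le bd) (auto simp: Y_def)
    also have "\<dots> = 35 * L * Q^2 * (L * \<bar>h\<bar>)" by (simp add: power2_eq_square algebra_simps)
    also have "\<dots> \<le> 35 * L * Q^2 * (T / 16)" using hT one_le_L by (intro mult_left_mono) auto
    also have "\<dots> \<le> 3 * L * Q^2 * T" using one_le_L Q T by simp
    finally have "\<bar>(taylor2 a b y)^2 - 4 * real_of_int a * taylor1 a b c y\<bar> \<le> \<kappa> * Q^2 * T + 3 * L * Q^2 * T"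
      unfolding eq by (intro abs_add_le X)
    also have "\<dots> = (\<kappa> + 3 * L) * (Q^2 * T)" by (simp add: algebra_simps)
    also have "\<dots> \<le> C * (Q^2 * T)" using Q T by (intro mult_right_mono) (auto simp: C_def)
    finally show ?thesis by (simp add: mult.assoc)
  qed
  then show ?thesis using b by (auto simp: near_degenerate_def C_def)
qed

end

text \<open>The reciprocal derivative is four times the length of an interval around the root.
  Interchanging sum and integral reduces the claim to the number of intervals through one point, and
  there a root is determined by its triple \<open>(a, b, c)\<close>.\<close>

lemma sum_simple_roots:
  fixes M Q T \<kappa> :: real
  assumes M: "M \<ge> 1" and Q: "Q \<ge> 1" and T: "0 < T" "T \<le> 1" "1 \<le> Q * T^2" and \<kappa>: "\<kappa> > 0"
  defines "C \<equiv> \<kappa> + 36 * (M + 1)^2 + 2"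
  shows "(\<Sum>(a, b, c, d, \<alpha>)\<in>simple_roots \<kappa> M Q T. 1 / \<bar>taylor1 a b c \<alpha>\<bar>)
     \<le> 8 * (M + 1) * (150 * C + 54 * C * (48 * (M + 1)^2 + C)) * (Q^3 * T)"
proof -
  define L where "L = 12 * (M + 1)^2"
  define F where "F = simple_roots \<kappa> M Q T"
  define B where "B = (150 * C + 54 * C * (48 * (M + 1)^2 + C)) * (Q^3 * T)"
  have C: "C \<ge> 1" using \<kappa> by (simp add: C_def)
  have CL: "C = \<kappa> + 3 * L + 2" by (simp add: C_def L_def)
  have B0: "B \<ge> 0" unfolding B_def using C Q T by (intro mult_nonneg_nonneg add_nonneg_nonneg) auto
  have finF: "finite F" unfolding F_def by (rule finite_simple_roots)
  define p where "p = (\<lambda>(a::int, b::int, c::int, d::int, \<alpha>::real). \<bar>taylor1 a b c \<alpha>\<bar>)"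
  define I where "I i = (case i of (a::int, b::int, c::int, d::int, \<alpha>) \<Rightarrow> {\<alpha> - 1 / (8 * p i)..\<alpha> + 1 / (8 * p i)})" for i
  have F: "a \<noteq> 0" "coeff_le Q a" "coeff_le Q b" "coeff_le Q c" "\<bar>\<alpha>\<bar> \<le> M" "taylor0 a b c d \<alpha> = 0"
     "2 * L * sqrt Q \<le> \<bar>taylor1 a b c \<alpha>\<bar>" "\<bar>real_of_int (disc3 a b c d)\<bar> \<le> \<kappa> * Q^4 * T^3" if "(a, b, c, d, \<alpha>) \<in> F" for a b c d \<alpha>
    using that by (auto simp: F_def simple_roots_def L_def)
  have pos: "p i > 0 \<and> 1 / (8 * p i) \<le> 1" if "i \<in> F" for i
  proof -
    obtain a b c d \<alpha> where i: "i = (a, b, c, d, \<alpha>)" by (cases i) auto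
    note st = step_bounds[OF M Q L_def F(7)[OF that[unfolded i]]]
    have "1 / (8 * p i) \<le> 1 / (4 * p i)" using st(1) by (simp add: i p_def field_simps)
    then show ?thesis using st(1,2) by (simp add: i p_def)
  qed
  have I: "y \<in> I (a, b, c, d, \<alpha>) \<longleftrightarrow> \<bar>y - \<alpha>\<bar> \<le> 1 / (8 * \<bar>taylor1 a b c \<alpha>\<bar>)" for y a b c d \<alpha>
    by (auto simp: I_def p_def abs_le_iff)
  have meas: "measure lborel (I i) = 1 / (4 * p i)" if "i \<in> F" for i
  proof -
    obtain a b c d \<alpha> where i: "i = (a, b, c, d, \<alpha>)" by (cases i) auto
    show ?thesis using pos[OF that] by (auto simp: i I_def)
  qed
  have range: "\<bar>y\<bar> \<le> M + 1" if "i \<in> F" "y \<in> I i" for i y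
  proof -
    obtain a b c d \<alpha> where i: "i = (a, b, c, d, \<alpha>)" by (cases i) auto
    have "1 / (8 * \<bar>taylor1 a b c \<alpha>\<bar>) \<le> 1" using pos[OF that(1)] by (simp add: i p_def)
    then show ?thesis using F(5)[OF that(1)[unfolded i]] that(2)[unfolded i I] by linarith
  qed
  have cnt: "real (card {i \<in> F. y \<in> I i}) \<le> B" if "\<bar>y\<bar> \<le> M + 1" for y
  proof -
    define f where "f = (\<lambda>(a::int, b::int, c::int, d::int, \<alpha>::real). (a, b, c))"
    have inj: "inj_on f {i \<in> F. y \<in> I i}"
    proof (rule inj_onI)
      fix i j assume ij: "i \<in> {i \<in> F. y \<in> I i}" "j \<in> {i \<in> F. y \<in> I i}" "f i = f j"
      obtain a b c d \<alpha> where i: "i = (a, b, c, d, \<alpha>)" by (cases i) auto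
      obtain d' \<alpha>' where j: "j = (a, b, c, d', \<alpha>')" using ij(3) by (cases j) (auto simp: f_def i)
      have iF: "(a, b, c, d, \<alpha>) \<in> F" "(a, b, c, d', \<alpha>') \<in> F" using ij i j by auto
      have yI: "\<bar>y - \<alpha>\<bar> \<le> 1 / (8 * \<bar>taylor1 a b c \<alpha>\<bar>)" "\<bar>y - \<alpha>'\<bar> \<le> 1 / (8 * \<bar>taylor1 a b c \<alpha>'\<bar>)" using ij I by (auto simp: i j)
      note Fi = F[OF iF(1)] and Fj = F[OF iF(2)]
      have "\<bar>taylor0 a b c d y\<bar> < 1 / 2" by (rule value_near_root[OF M Q L_def Fi(2-7) yI(1)])
      moreover have "\<bar>taylor0 a b c d' y\<bar> < 1 / 2" by (rule value_near_root[OF M Q L_def Fj(2-7) yI(2)])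
      moreover have "taylor0 a b c d y - taylor0 a b c d' y = d - d'" by (simp add: taylor0_def)
      ultimately have "\<bar>real_of_int (d - d')\<bar> < 1" by linarith
      then have d: "d' = d" by linarith
      have r: "\<bar>\<alpha>' - \<alpha>\<bar> \<le> 1 / (8 * \<bar>taylor1 a b c \<alpha>\<bar>) + 1 / (8 * \<bar>taylor1 a b c \<alpha>'\<bar>)" using yI by linarith
      have pp: "\<bar>taylor1 a b c \<alpha>\<bar> > 0" "\<bar>taylor1 a b c \<alpha>'\<bar> > 0" using pos[of i] pos[of j] ij by (auto simp: i j p_def)
      \<comment> \<open>The root with the smaller derivative has the larger isolation radius 1 / (4
        |P'|), which is at least the sum of the two radii 1 / (8 |P'|).\<close>
      have "\<alpha>' = \<alpha>"
      proof (cases "\<bar>taylor1 a b c \<alpha>\<bar> \<le> \<bar>taylor1 a b c \<alpha>'\<bar>")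
        case True
        then have "1 / (8 * \<bar>taylor1 a b c \<alpha>'\<bar>) \<le> 1 / (8 * \<bar>taylor1 a b c \<alpha>\<bar>)" using pp by (intro divide_left_mono) auto
        with r have "\<bar>\<alpha>' - \<alpha>\<bar> \<le> 2 * (1 / (8 * \<bar>taylor1 a b c \<alpha>\<bar>))" by linarith
        also have "\<dots> = 1 / (4 * \<bar>taylor1 a b c \<alpha>\<bar>)" by simp
        finally show ?thesis by (rule root_isolated[OF M Q L_def Fi(2-6) Fj(6)[unfolded d] Fi(7)])
      next
        case False
        then have "1 / (8 * \<bar>taylor1 a b c \<alpha>\<bar>) \<le> 1 / (8 * \<bar>taylor1 a b c \<alpha>'\<bar>)" using pp by (intro divide_left_mono) auto
        with r have "\<bar>\<alpha> - \<alpha>'\<bar> \<le> 2 * (1 / (8 * \<bar>taylor1 a b c \<alpha>'\<bar>))" by linarith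
        also have "\<dots> = 1 / (4 * \<bar>taylor1 a b c \<alpha>'\<bar>)" by simp
        finally have "\<alpha> = \<alpha>'" by (rule root_isolated[OF M Q L_def Fj(2-5) Fj(6)[unfolded d] Fi(6) Fj(7)])
        then show ?thesis by simp
      qed
      then show "i = j" using d by (simp add: i j)
    qed
    have QT: "1 \<le> Q * T"
    proof -
      have "T^2 \<le> T" using T power_decreasing[of 1 2 T] by simp
      then have "Q * T^2 \<le> Q * T" using Q by (intro mult_left_mono) auto
      with T(3) show ?thesis by linarith
    qed
    have M1: "M + 1 \<ge> 1" using M by simp
    note nd = card_near_degenerate[OF M1 that C T(1,2) QT, folded B_def]
    have "f ` {i \<in> F. y \<in> I i} \<subseteq> near_degenerate C Q T y"
    proof
      fix z assume "z \<in> f ` {i \<in> F. y \<in> I i}"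
      then obtain a b c d \<alpha> where i: "(a, b, c, d, \<alpha>) \<in> F" "y \<in> I (a, b, c, d, \<alpha>)" "z = (a, b, c)" by (auto simp: f_def)
      show "z \<in> near_degenerate C Q T y"
        unfolding i(3) CL by (rule degenerate_near_root[OF M Q L_def F(1-7)[OF i(1)] i(2)[unfolded I] T(1,3) \<kappa> F(8)[OF i(1)]])
    qed
    then have "card (f ` {i \<in> F. y \<in> I i}) \<le> card (near_degenerate C Q T y)" using nd(1) by (intro card_mono)
    then show ?thesis using nd(2) card_image[OF inj] by linarith
  qed
  have icc: "integrable lborel (indicator {u..v} :: real \<Rightarrow> real)" for u v :: real
    by (rule integrable_real_indicator) (auto simp: emeasure_lborel_Icc_eq)
  have int: "integrable lborel (indicator (I i) :: real \<Rightarrow> real)" for i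
    by (cases i) (simp only: I_def prod.case icc)
  have "(\<Sum>i\<in>F. 1 / p i) = 4 * (\<Sum>i\<in>F. measure lborel (I i))"
    unfolding sum_distrib_left by (rule sum.cong) (use meas pos in \<open>auto simp: field_simps\<close>)
  also have "(\<Sum>i\<in>F. measure lborel (I i)) = (\<integral>y. (\<Sum>i\<in>F. indicator (I i) y) \<partial>lborel)"
    by (subst Bochner_Integration.integral_sum) (use int in auto)
  also have "\<dots> \<le> (\<integral>y. B * indicator {-(M+1)..M+1} y \<partial>lborel)"
  proof (rule integral_mono)
    show "integrable lborel (\<lambda>y. \<Sum>i\<in>F. indicator (I i) y :: real)" using int by (intro Bochner_Integration.integrable_sum) auto
    show "integrable lborel (\<lambda>y. B * indicator {-(M+1)..M+1} y)"
      by (intro integrable_mult_right icc)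
    fix y
    have "(\<Sum>i\<in>F. indicator (I i) y) = real (card {i \<in> F. y \<in> I i})"
      using finF by (simp add: indicator_def sum.If_cases Collect_conj_eq Int_commute)
    also have "\<dots> \<le> B * indicator {-(M+1)..M+1} y"
    proof (cases "\<bar>y\<bar> \<le> M + 1")
      case True
      then show ?thesis using cnt[OF True] by (simp add: indicator_def abs_le_iff)
    next
      case False
      then have e: "{i \<in> F. y \<in> I i} = {}" using range by blast
      show ?thesis unfolding e using B0 by simp
    qed
    finally show "(\<Sum>i\<in>F. indicator (I i) y) \<le> B * indicator {-(M+1)..M+1} y" .
  qed
  also have "\<dots> = B * (2 * (M + 1))" using M by simp
  finally have "(\<Sum>i\<in>F. 1 / p i) \<le> 8 * (M + 1) * B" by (simp add: algebra_simps)
  then show ?thesis by (simp add: F_def p_def B_def mult.assoc case_prod_unfold)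
qed

section \<open>Covers of a dyadic block\<close>

text \<open>Radii are multiples \<open>s\<close> of a unit \<open>r\<close> because
  \<open>g (s * r) \<le> s * g r\<close> for \<open>s \<ge> 1\<close>: the total of the multiples,
  times \<open>g r\<close>, then bounds the g-sum of the cover. The cap \<open>m\<close> keeps all
  radii small.\<close>

definition coverable :: "real \<Rightarrow> real \<Rightarrow> real \<Rightarrow> real set \<Rightarrow> bool" where
  "coverable r m w X \<longleftrightarrow> (\<exists>F. finite F \<and> (\<forall>(c, s)\<in>F. 1 \<le> s \<and> s \<le> m) \<and> X \<subseteq> (\<Union>(c, s)\<in>F. ball c (s * r))
     \<and> (\<Sum>(c, s)\<in>F. s) \<le> w)"

lemma coverable_mono:
  assumes "coverable r m w X" "Y \<subseteq> X" "w \<le> w'"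
  shows "coverable r m w' Y"
  using assms unfolding coverable_def by (meson order_trans)

lemma coverable_empty: "coverable r m 0 {}"
  unfolding coverable_def by (intro exI[of _ "{}"]) simp

lemma coverable_ball:
  assumes "1 \<le> s" "s \<le> m"
  shows "coverable r m s (ball c (s * r))"
  unfolding coverable_def by (intro exI[of _ "{(c, s)}"]) (use assms in simp)

lemma coverable_Un:
  assumes "coverable r m w X" "coverable r m w' Y"
  shows "coverable r m (w + w') (X \<union> Y)"
proof -
  obtain F where F: "finite F" "\<forall>(c, s)\<in>F. 1 \<le> s \<and> s \<le> m" "X \<subseteq> (\<Union>(c, s)\<in>F. ball c (s * r))" "(\<Sum>(c, s)\<in>F. s) \<le> w"
    using assms(1) unfolding coverable_def by blast
  obtain G where G: "finite G" "\<forall>(c, s)\<in>G. 1 \<le> s \<and> s \<le> m" "Y \<subseteq> (\<Union>(c, s)\<in>G. ball c (s * r))" "(\<Sum>(c, s)\<in>G. s) \<le> w'"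
    using assms(2) unfolding coverable_def by blast
  have "(\<Sum>(c, s)\<in>F \<union> G. s) \<le> (\<Sum>(c, s)\<in>F. s) + (\<Sum>(c, s)\<in>G. s)"
  proof -
    have "(\<Sum>(c, s)\<in>F \<inter> G. s) \<ge> 0" using F(2) by (intro sum_nonneg) auto
    then show ?thesis using sum.union_inter[OF F(1) G(1), of "\<lambda>(c, s). s"] by linarith
  qed
  then have "(\<Sum>(c, s)\<in>F \<union> G. s) \<le> w + w'" using F(4) G(4) by linarith
  then show ?thesis
    unfolding coverable_def using F G by (intro exI[of _ "F \<union> G"]) auto
qed

lemma coverable_UN:
  assumes "finite I" "\<And>i. i \<in> I \<Longrightarrow> coverable r m (w i) (X i)"
  shows "coverable r m (\<Sum>i\<in>I. w i) (\<Union>i\<in>I. X i)"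
  using assms
proof (induction I rule: finite_induct)
  case empty then show ?case by (simp add: coverable_empty)
next
  case (insert i I)
  then have "coverable r m (w i + (\<Sum>i\<in>I. w i)) (X i \<union> (\<Union>i\<in>I. X i))" by (intro coverable_Un) auto
  then show ?case using insert by simp
qed

lemma coverable_UN_const:
  assumes "finite I" "\<And>i. i \<in> I \<Longrightarrow> coverable r m w (X i)"
  shows "coverable r m (real (card I) * w) (\<Union>i\<in>I. X i)"
  using coverable_UN[of I r m "\<lambda>_. w" X] assms by simp

section \<open>Distance from a point to the nearest root\<close>

lemma taylor_of_real:
  "taylor0 a b c d (of_real x :: complex) = of_real (taylor0 a b c d x)"
  "taylor1 a b c (of_real x :: complex) = of_real (taylor1 a b c x)"
  by (simp_all add: taylor0_def taylor1_def)

text \<open>|P'(y1)| = |a| |y1 - y2| |y1 - y3|, and the distance from the nearest root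
  \<open>y1\<close> to another root is at most twice the distance from \<open>x\<close> to that
  root; this gives the factor 4.\<close>

lemma nearest_root_aux:
  fixes x :: real and y1 y2 y3 :: complex
  assumes a: "a \<noteq> 0" and r: "of_int b = - of_int a * (y1 + y2 + y3)" "of_int c = of_int a * (y1 * y2 + y2 * y3 + y3 * y1)"
    "of_int d = - of_int a * (y1 * y2 * y3)" and x: "\<bar>taylor0 a b c d x\<bar> < 1"
    and near: "cmod (x - y1) \<le> cmod (x - y2)" "cmod (x - y1) \<le> cmod (x - y3)"
  shows "cmod (x - y1) \<le> 1" "cmod (taylor1 a b c y1) * cmod (x - y1) \<le> 4 * \<bar>taylor0 a b c d x\<bar>"
proof -
  have "complex_of_real (taylor0 a b c d x) = of_int a * ((x - y1) * (x - y2) * (x - y3))"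
    unfolding taylor_of_real[symmetric] unfolding taylor0_def r by Groebner_Basis.algebra
  then have "\<bar>taylor0 a b c d x\<bar> = \<bar>real_of_int a\<bar> * (cmod (x - y1) * cmod (x - y2) * cmod (x - y3))"
    by (metis norm_mult norm_of_int norm_of_real)
  note v = this
  have a1: "1 \<le> \<bar>real_of_int a\<bar>" using a by linarith
  have "cmod (x - y1) ^ 3 \<le> 1 * (cmod (x - y1) * cmod (x - y2) * cmod (x - y3))"
    unfolding power3_eq_cube mult_1 by (intro mult_mono near) auto
  also have "\<dots> \<le> \<bar>taylor0 a b c d x\<bar>" unfolding v using a1 by (intro mult_right_mono) auto
  finally have "cmod (x - y1) ^ 3 < 1 ^ 3" using x by simp
  then show "cmod (x - y1) \<le> 1" by (meson less_imp_le power_less_imp_less_base zero_le_one)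
  have "taylor1 a b c y1 = of_int a * ((y1 - y2) * (y1 - y3))"
    unfolding taylor1_def r by Groebner_Basis.algebra
  then have "cmod (taylor1 a b c y1) = \<bar>real_of_int a\<bar> * (cmod (y1 - y2) * cmod (y1 - y3))"
    by (simp add: norm_mult)
  also have "\<dots> \<le> \<bar>real_of_int a\<bar> * ((2 * cmod (x - y2)) * (2 * cmod (x - y3)))"
  proof -
    have *: "cmod (y1 - y) \<le> 2 * cmod (x - y)" if "cmod (x - y1) \<le> cmod (x - y)" for y :: complex
      using that norm_triangle_ineq4[of "x - y" "x - y1"] by simp
    show ?thesis by (intro mult_left_mono mult_mono *[OF near(1)] *[OF near(2)]) auto
  qed
  finally have "cmod (taylor1 a b c y1) * cmod (x - y1) \<le> \<bar>real_of_int a\<bar> * ((2 * cmod (x - y2)) * (2 * cmod (x - y3))) * cmod (x - y1)"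
    by (intro mult_right_mono) auto
  then show "cmod (taylor1 a b c y1) * cmod (x - y1) \<le> 4 * \<bar>taylor0 a b c d x\<bar>" unfolding v by (simp add: algebra_simps)
qed

lemma nearest_root:
  fixes x :: real
  assumes "irr3 a b c d" "\<bar>taylor0 a b c d x\<bar> < 1"
  obtains \<alpha> :: complex where "taylor0 a b c d \<alpha> = 0" "cmod (x - \<alpha>) \<le> 1" "cmod (taylor1 a b c \<alpha>) * cmod (x - \<alpha>) \<le> 4 * \<bar>taylor0 a b c d x\<bar>"
proof -
  have a: "a \<noteq> 0" using assms(1) by (simp add: irr3_def)
  obtain y1 y2 y3 :: complex where r: "of_int b = - of_int a * (y1 + y2 + y3)" "of_int c = of_int a * (y1 * y2 + y2 * y3 + y3 * y1)"
    "of_int d = - of_int a * (y1 * y2 * y3)"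
    and z: "\<And>t. t \<in> {y1, y2, y3} \<Longrightarrow> of_int d + of_int c * t + of_int b * t^2 + of_int a * t^3 = 0"
    using irr3_roots[OF assms(1)] by blast
  consider "cmod (x - y1) \<le> cmod (x - y2)" "cmod (x - y1) \<le> cmod (x - y3)" | "cmod (x - y2) \<le> cmod (x - y1)" "cmod (x - y2) \<le> cmod (x - y3)"
    | "cmod (x - y3) \<le> cmod (x - y1)" "cmod (x - y3) \<le> cmod (x - y2)" by linarith
  then show ?thesis
  proof cases
    case 1
    from that[of y1] nearest_root_aux[OF a r assms(2) 1] z[of y1] show ?thesis by (simp add: taylor0_def)
  next
    case 2
    have r': "of_int b = - of_int a * (y2 + y1 + y3)" "of_int c = of_int a * (y2 * y1 + y1 * y3 + y3 * y2)"
      "of_int d = - of_int a * (y2 * y1 * y3)" unfolding r by (simp_all add: algebra_simps)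
    from that[of y2] nearest_root_aux[OF a r' assms(2) 2] z[of y2] show ?thesis by (simp add: taylor0_def)
  next
    case 3
    have r': "of_int b = - of_int a * (y3 + y1 + y2)" "of_int c = of_int a * (y3 * y1 + y1 * y2 + y2 * y3)"
      "of_int d = - of_int a * (y3 * y1 * y2)" unfolding r by (simp_all add: algebra_simps)
    from that[of y3] nearest_root_aux[OF a r' assms(2) 3] z[of y3] show ?thesis by (simp add: taylor0_def)
  qed
qed

text \<open>The discriminant is a nonzero integer and equals P'(\<alpha>)^2 times a factor of norm
  at most 5 B^2, where \<open>B = 12 * M^2 * Q\<close>; the 3 is sqrt 5 rounded up.\<close>

lemma derivative_lower_bound:
  fixes \<alpha> :: complex
  assumes irr: "irr3 a b c d" and r: "taylor0 a b c d \<alpha> = 0" and M: "M \<ge> 1" "norm \<alpha> \<le> M" and Q: "Q > 0"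
    and b: "coeff_le Q a" "coeff_le Q b" "coeff_le Q c"
  shows "1 \<le> 3 * (12 * M^2 * Q) * norm (taylor1 a b c \<alpha>)"
proof -
  define B where "B = 12 * M^2 * Q"
  note bd = taylor_bounds[OF M b, folded B_def]
  define p where "p = norm (taylor1 a b c \<alpha>)"
  have B0: "B \<ge> 0" using Q by (simp add: B_def)
  have "1 \<le> \<bar>real_of_int (disc3 a b c d)\<bar>" using disc3_nonzero[OF irr] by linarith
  also have "\<dots> = norm (of_int (disc3 a b c d) :: complex)" by simp
  also have "of_int (disc3 a b c d) = disc3 (of_int a) (of_int b) (of_int c) (of_int d :: complex)"
    by (simp add: disc3_def)
  also have "\<dots> = taylor1 a b c \<alpha> ^ 2 * (taylor2 a b \<alpha> ^ 2 - 4 * of_int a * taylor1 a b c \<alpha>)"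
    using disc3_at_root[of "of_int d" "of_int c" \<alpha> "of_int b" "of_int a :: complex"] r by (simp add: taylor0_def taylor1_def taylor2_def)
  also have "norm \<dots> = p^2 * norm (taylor2 a b \<alpha> * taylor2 a b \<alpha> + (- 4) * (of_int a * taylor1 a b c \<alpha>))"
    by (simp add: norm_mult norm_power p_def power2_eq_square mult.assoc)
  also have "\<dots> \<le> p^2 * (B * B + 4 * (B * B))"
    by (intro mult_left_mono norm_add_le norm_mult_le bd) auto
  also have "\<dots> \<le> (3 * B * p)^2" using B0 by (simp add: power2_eq_square algebra_simps)
  finally have "1^2 \<le> (3 * B * p)^2" by simp
  then have "1 \<le> 3 * B * p" by (rule power2_le_imp_le) (use B0 in \<open>simp add: p_def\<close>)
  then show ?thesis by (simp add: B_def p_def)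
qed

text \<open>If \<alpha> is not real, its conjugate is another root at distance at most
  \<open>2 * \<epsilon>\<close>, and a second root that close forces a small derivative.\<close>

lemma large_derivative_real_root:
  assumes r: "taylor0 a b c d \<alpha> = 0" and M: "M \<ge> 1" "norm \<alpha> \<le> M" and Q: "Q > 0"
    and b: "coeff_le Q a" "coeff_le Q b" "coeff_le Q c"
    and im: "\<bar>Im \<alpha>\<bar> \<le> \<epsilon>" "\<epsilon> \<le> 1" and p: "norm (taylor1 a b c \<alpha>) > 6 * (12 * M^2 * Q) * \<epsilon>"
  shows "Im \<alpha> = 0"
proof (rule ccontr)
  assume ne: "Im \<alpha> \<noteq> 0"
  define B where "B = 12 * M^2 * Q"
  note bd = taylor_bounds[OF M b, folded B_def]
  have B0: "B \<ge> 0" using Q by (simp add: B_def)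
  define h where "h = cnj \<alpha> - \<alpha>"
  have h0: "h \<noteq> 0" using ne by (auto simp: h_def complex_eq_iff)
  have hn: "norm h \<le> 2 * \<epsilon>"
  proof -
    have "h = - (2 * of_real (Im \<alpha>) * \<i>)" by (simp add: h_def complex_eq_iff)
    then have "norm h = 2 * \<bar>Im \<alpha>\<bar>" by (simp add: norm_mult)
    then show ?thesis using im by simp
  qed
  have "taylor0 a b c d (cnj \<alpha>) = cnj (taylor0 a b c d \<alpha>)" by (simp add: taylor0_def)
  then have "taylor0 a b c d (\<alpha> + h) = 0" using r by (simp add: h_def)
  then have "h * (taylor1 a b c \<alpha> + (taylor2 a b \<alpha> * h + of_int a * (h * h))) = 0"
    using r unfolding taylor_add by (simp add: power2_eq_square power3_eq_cube algebra_simps)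
  then have "norm (taylor1 a b c \<alpha>) = norm (taylor2 a b \<alpha> * h + of_int a * (h * h))"
    using h0 by (simp add: add_eq_0_iff)
  also have "\<dots> \<le> B * (2 * \<epsilon>) + B * (2 * \<epsilon> * 2)"
    by (intro norm_add_le norm_mult_le bd hn order_trans[OF hn]) (use im in auto)
  finally show False using p by (simp add: B_def ac_simps)
qed

text \<open>The roots may be complex here. Balls are centred at the real parts of the three roots,
  since a real \<open>x\<close> is no farther from the real part than from the root.\<close>

lemma root_family_cover:
  fixes \<delta> \<theta> s r m :: real
  assumes fin: "finite B" and irr: "\<And>a b c d. (a, b, c, d) \<in> B \<Longrightarrow> irr3 a b c d"
    and \<theta>: "\<theta> > 0" "\<delta> > 0" and s: "1 \<le> s" "s \<le> m" "4 * \<delta> / \<theta> < s * r"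
  shows "coverable r m (real (card B) * (3 * s)) {x. \<exists>a b c d (\<alpha>::complex). (a, b, c, d) \<in> B \<and> taylor0 a b c d \<alpha> = 0 \<and>
     \<theta> \<le> cmod (taylor1 a b c \<alpha>) \<and> cmod (taylor1 a b c \<alpha>) * cmod (complex_of_real x - \<alpha>) \<le> 4 * \<delta>}"
proof -
  define X where "X = (\<lambda>(a, b, c, d). {x. \<exists>\<alpha>::complex. taylor0 a b c d \<alpha> = 0 \<and>
     \<theta> \<le> cmod (taylor1 a b c \<alpha>) \<and> cmod (taylor1 a b c \<alpha>) * cmod (complex_of_real x - \<alpha>) \<le> 4 * \<delta>})"
  have "coverable r m (real (card B) * (3 * s)) (\<Union>i\<in>B. X i)"
  proof (rule coverable_UN_const[OF fin])
    fix i assume "i \<in> B"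
    moreover obtain a b c d where i: "i = (a, b, c, d)" by (cases i) auto
    ultimately have ir: "irr3 a b c d" using irr by simp
    obtain y1 y2 y3 :: complex where rr: "of_int b = - of_int a * (y1 + y2 + y3)" "of_int c = of_int a * (y1 * y2 + y2 * y3 + y3 * y1)"
      "of_int d = - of_int a * (y1 * y2 * y3)"
      using irr3_roots[OF ir] by blast
    have "coverable r m (s + s + s) (ball (Re y1) (s * r) \<union> ball (Re y2) (s * r) \<union> ball (Re y3) (s * r))"
      by (intro coverable_Un coverable_ball s)
    then show "coverable r m (3 * s) (X i)"
    proof (rule coverable_mono)
      show "X i \<subseteq> ball (Re y1) (s * r) \<union> ball (Re y2) (s * r) \<union> ball (Re y3) (s * r)"
      proof
        fix x assume "x \<in> X i"
        then obtain \<alpha> where \<alpha>: "taylor0 a b c d \<alpha> = 0" "\<theta> \<le> cmod (taylor1 a b c \<alpha>)" "cmod (taylor1 a b c \<alpha>) * cmod (complex_of_real x - \<alpha>) \<le> 4 * \<delta>"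
          by (auto simp: X_def i)
        have "taylor0 a b c d \<alpha> = of_int a * ((\<alpha> - y1) * (\<alpha> - y2) * (\<alpha> - y3))"
          unfolding taylor0_def rr by Groebner_Basis.algebra
        then have "\<alpha> = y1 \<or> \<alpha> = y2 \<or> \<alpha> = y3" using \<alpha>(1) ir by (auto simp: irr3_def)
        moreover have "dist (Re \<alpha>) x < s * r"
        proof -
          have "\<bar>Re (complex_of_real x - \<alpha>)\<bar> \<le> cmod (complex_of_real x - \<alpha>)" by (rule abs_Re_le_cmod)
          moreover have "\<theta> * cmod (complex_of_real x - \<alpha>) \<le> 4 * \<delta>"
            using \<alpha>(2,3) mult_right_mono[OF \<alpha>(2), of "cmod (complex_of_real x - \<alpha>)"] by simp
          then have "cmod (complex_of_real x - \<alpha>) \<le> 4 * \<delta> / \<theta>" using \<theta>(1) by (simp add: pos_le_divide_eq mult.commute)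
          ultimately show ?thesis using s(3) by (simp add: dist_real_def)
        qed
        ultimately show "x \<in> ball (Re y1) (s * r) \<union> ball (Re y2) (s * r) \<union> ball (Re y3) (s * r)" by auto
      qed
    qed simp
  qed
  then show ?thesis
  proof (rule coverable_mono)
    show "{x. \<exists>a b c d (\<alpha>::complex). (a, b, c, d) \<in> B \<and> taylor0 a b c d \<alpha> = 0 \<and>
     \<theta> \<le> cmod (taylor1 a b c \<alpha>) \<and> cmod (taylor1 a b c \<alpha>) * cmod (complex_of_real x - \<alpha>) \<le> 4 * \<delta>} \<subseteq> (\<Union>i\<in>B. X i)"
    proof
      fix x assume "x \<in> {x. \<exists>a b c d (\<alpha>::complex). (a, b, c, d) \<in> B \<and> taylor0 a b c d \<alpha> = 0 \<and>
     \<theta> \<le> cmod (taylor1 a b c \<alpha>) \<and> cmod (taylor1 a b c \<alpha>) * cmod (complex_of_real x - \<alpha>) \<le> 4 * \<delta>}"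
      then obtain a b c d \<alpha> where "(a, b, c, d) \<in> B" "taylor0 a b c d \<alpha> = 0 \<and>
        \<theta> \<le> cmod (taylor1 a b c \<alpha>) \<and> cmod (taylor1 a b c \<alpha>) * cmod (complex_of_real x - \<alpha>) \<le> 4 * \<delta>" by blast
      then show "x \<in> (\<Union>i\<in>B. X i)" by (intro UN_I[of "(a, b, c, d)"]) (auto simp: X_def)
    qed
  qed simp
qed

lemma simple_roots_cover:
  fixes \<kappa> M Q T \<delta> m :: real
  assumes M: "M \<ge> 1" and Q: "Q \<ge> 1" and \<delta>: "\<delta> > 0" and L: "L = 12 * (M + 1)^2" and m: "5 * Q \<le> m"
  shows "coverable (\<delta> / Q) m (5 * L * Q * (\<Sum>(a, b, c, d, \<alpha>)\<in>simple_roots \<kappa> M Q T. 1 / \<bar>taylor1 a b c \<alpha>\<bar>))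
    {x::real. \<exists>a b c d \<alpha>. (a, b, c, d, \<alpha>) \<in> simple_roots \<kappa> M Q T \<and> \<bar>taylor1 a b c \<alpha>\<bar> * \<bar>x - \<alpha>\<bar> \<le> 4 * \<delta>}"
proof -
  define S where "S = simple_roots \<kappa> M Q T"
  define p where "p = (\<lambda>(a::int, b::int, c::int, d::int, \<alpha>::real). \<bar>taylor1 a b c \<alpha>\<bar>)"
  define c where "c = (\<lambda>(a::int, b::int, c::int, d::int, \<alpha>::real). \<alpha>)"
  \<comment> \<open>The factor \<open>5 * L\<close> in place of 4 makes the containment in open
    balls strict and, as \<open>p i \<le> L * Q\<close>, keeps the multiples at least 1.\<close>
  have "coverable (\<delta> / Q) m (\<Sum>i\<in>S. 5 * L * Q / p i) (\<Union>i\<in>S. ball (c i) (5 * L * Q / p i * (\<delta> / Q)))"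
  proof (rule coverable_UN)
    show "finite S" unfolding S_def by (rule finite_simple_roots)
    fix i assume "i \<in> S"
    moreover obtain a b c' d \<alpha> where i: "i = (a, b, c', d, \<alpha>)" by (cases i) auto
    ultimately have b: "coeff_le Q a" "coeff_le Q b" "coeff_le Q c'" "\<bar>\<alpha>\<bar> \<le> M + 1"
      and p: "2 * L * sqrt Q \<le> p i" by (auto simp: S_def simple_roots_def L p_def)
    have "M + 1 \<ge> 1" using M by simp
    from taylor_bounds_real(1)[OF this b(4,1-3)] have pL: "p i \<le> L * Q" by (simp add: i p_def L)
    have Lg: "L \<ge> 1" using one_le_L[OF M Q L] .
    have sQ: "sqrt Q \<ge> 1" using Q by simp
    have "L * 1 \<le> L * sqrt Q" using Lg sQ by (intro mult_left_mono) auto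
    moreover have "2 * L * sqrt Q = 2 * (L * sqrt Q)" by simp
    ultimately have pl: "L \<le> p i" using p Lg by linarith
    have "1 \<le> 5 * L * Q / p i" using pL pl Lg Q by (simp add: pos_le_divide_eq)
    moreover have "5 * L * Q / p i \<le> 5 * Q" using pl Lg Q by (simp add: pos_divide_le_eq)
    ultimately show "coverable (\<delta> / Q) m (5 * L * Q / p i) (ball (c i) (5 * L * Q / p i * (\<delta> / Q)))"
      using m by (intro coverable_ball) auto
  qed
  then show ?thesis
  proof (rule coverable_mono)
    show "{x::real. \<exists>a b c d \<alpha>. (a, b, c, d, \<alpha>) \<in> simple_roots \<kappa> M Q T \<and> \<bar>taylor1 a b c \<alpha>\<bar> * \<bar>x - \<alpha>\<bar> \<le> 4 * \<delta>}
       \<subseteq> (\<Union>i\<in>S. ball (c i) (5 * L * Q / p i * (\<delta> / Q)))"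
    proof
      fix x assume "x \<in> {x::real. \<exists>a b c d \<alpha>. (a, b, c, d, \<alpha>) \<in> simple_roots \<kappa> M Q T \<and> \<bar>taylor1 a b c \<alpha>\<bar> * \<bar>x - \<alpha>\<bar> \<le> 4 * \<delta>}"
      then obtain a b c' d \<alpha> where i: "(a, b, c', d, \<alpha>) \<in> S" and x: "\<bar>taylor1 a b c' \<alpha>\<bar> * \<bar>x - \<alpha>\<bar> \<le> 4 * \<delta>"
        unfolding S_def by blast
      then have p: "2 * L * sqrt Q \<le> \<bar>taylor1 a b c' \<alpha>\<bar>" by (auto simp: S_def simple_roots_def L)
      have Lg: "L \<ge> 1" using one_le_L[OF M Q L] .
      have "0 < 2 * L * sqrt Q" using Lg Q by simp
      then have p0: "0 < \<bar>taylor1 a b c' \<alpha>\<bar>" using p by linarith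
      then have "\<bar>x - \<alpha>\<bar> \<le> 4 * \<delta> / \<bar>taylor1 a b c' \<alpha>\<bar>" using x by (simp only: pos_le_divide_eq mult.commute)
      also have "\<dots> < 5 * L * \<delta> / \<bar>taylor1 a b c' \<alpha>\<bar>"
      proof (rule divide_strict_right_mono[OF _ p0])
        have "4 * \<delta> < 5 * 1 * \<delta>" using \<delta> by simp
        also have "\<dots> \<le> 5 * L * \<delta>" using Lg \<delta> by (intro mult_right_mono) auto
        finally show "4 * \<delta> < 5 * L * \<delta>" .
      qed
      also have "\<dots> = 5 * L * Q / \<bar>taylor1 a b c' \<alpha>\<bar> * (\<delta> / Q)" using Q by simp
      finally show "x \<in> (\<Union>i\<in>S. ball (c i) (5 * L * Q / p i * (\<delta> / Q)))"
        by (intro UN_I[OF i]) (simp add: c_def p_def dist_real_def abs_minus_commute)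
    qed
    show "(\<Sum>i\<in>S. 5 * L * Q / p i) \<le> 5 * L * Q * (\<Sum>(a, b, c, d, \<alpha>)\<in>simple_roots \<kappa> M Q T. 1 / \<bar>taylor1 a b c \<alpha>\<bar>)"
      unfolding S_def sum_distrib_left by (rule sum_mono) (auto simp: p_def)
  qed
qed

section \<open>Linear and quadratic polynomials\<close>

lemma linear_cover:
  fixes Q \<delta> m :: real
  assumes Q: "Q \<ge> 1" and \<delta>: "\<delta> > 0" and m: "2 * Q \<le> m"
  shows "coverable (\<delta> / Q) m (50 * Q^3) {x::real. \<exists>c d::int. c \<noteq> 0 \<and> coeff_le Q c \<and> coeff_le Q d \<and> \<bar>c * x + d\<bar> \<le> \<delta>}"
proof -
  define J where "J = {n::int. \<bar>n + 0\<bar> \<le> 2 * Q}"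
  have J: "finite J" "real (card J) \<le> 5 * Q" using card_shifted[of "2 * Q" 0] Q by (auto simp: J_def)
  define X where "X = (\<lambda>(c::int, d::int). ball (- d / c) (2 * Q * (\<delta> / Q)))"
  have "coverable (\<delta> / Q) m (real (card (J \<times> J)) * (2 * Q)) (\<Union>i\<in>J \<times> J. X i)"
  proof (rule coverable_UN_const)
    show "finite (J \<times> J)" using J by simp
    show "coverable (\<delta> / Q) m (2 * Q) (X i)" if "i \<in> J \<times> J" for i
      unfolding X_def by (cases i) (simp only: prod.case, rule coverable_ball, use Q m in auto)
  qed
  then show ?thesis
  proof (rule coverable_mono)
    have "real (card (J \<times> J)) = real (card J) * real (card J)" by (simp add: card_cartesian_product)
    also have "\<dots> \<le> 5 * Q * (5 * Q)" using J Q by (intro mult_mono) auto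
    finally have "real (card (J \<times> J)) * (2 * Q) \<le> 5 * Q * (5 * Q) * (2 * Q)" using Q by (intro mult_right_mono) auto
    then show "real (card (J \<times> J)) * (2 * Q) \<le> 50 * Q^3" by (simp add: power3_eq_cube)
    show "{x::real. \<exists>c d::int. c \<noteq> 0 \<and> coeff_le Q c \<and> coeff_le Q d \<and> \<bar>c * x + d\<bar> \<le> \<delta>} \<subseteq> (\<Union>i\<in>J \<times> J. X i)"
    proof
      fix x assume "x \<in> {x::real. \<exists>c d::int. c \<noteq> 0 \<and> coeff_le Q c \<and> coeff_le Q d \<and> \<bar>c * x + d\<bar> \<le> \<delta>}"
      then obtain c d :: int where cd: "c \<noteq> 0" "coeff_le Q c" "coeff_le Q d" "\<bar>c * x + d\<bar> \<le> \<delta>" by blast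
      have c1: "1 \<le> \<bar>real_of_int c\<bar>" using cd(1) by linarith
      have "1 * \<bar>x - (- d / c)\<bar> \<le> \<bar>real_of_int c\<bar> * \<bar>x - (- d / c)\<bar>" using c1 by (intro mult_right_mono) auto
      also have "\<dots> = \<bar>c * x + d\<bar>" using cd(1) by (simp add: abs_mult[symmetric] field_simps)
      also have "\<dots> < 2 * \<delta>" using cd \<delta> by simp
      finally have "x \<in> X (c, d)" using Q by (simp add: X_def dist_real_def abs_minus_commute)
      moreover have "(c, d) \<in> J \<times> J" using cd by (auto simp: J_def)
      ultimately show "x \<in> (\<Union>i\<in>J \<times> J. X i)" by blast
    qed
  qed
qed

text \<open>Completing the square: \<open>w = 2 * b * x + c\<close> satisfies w^2 - D = 4 b P(x),
  which is below 1 in absolute value, so the nonzero integer \<open>D\<close> is not negative. With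
  \<sigma> the sign of \<open>w\<close>, the factor |w + \<sigma> sqrt D| is at least sqrt
  D.\<close>

lemma quadratic_near_root:
  fixes b c d :: int and x \<delta> :: real
  assumes b: "b \<noteq> 0" and D: "c^2 - 4 * b * d \<noteq> 0" and \<delta>: "4 * \<bar>real_of_int b\<bar> * \<delta> < 1" and x: "\<bar>b * x^2 + c * x + d\<bar> \<le> \<delta>"
  defines "D \<equiv> real_of_int (c^2 - 4 * b * d)"
  shows "D \<ge> 1" "\<exists>\<sigma>\<in>{-1, 1}. \<bar>x - (- c + \<sigma> * sqrt D) / (2 * b)\<bar> * sqrt D \<le> 2 * \<delta>"
proof -
  define w where "w = 2 * b * x + c"
  have eq: "w^2 - D = 4 * b * (b * x^2 + c * x + d)"
    by (simp add: w_def D_def power2_eq_square algebra_simps)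
  then have wD: "\<bar>w^2 - D\<bar> \<le> 4 * \<bar>real_of_int b\<bar> * \<delta>" using x by (simp add: abs_mult mult_left_mono)
  show D1: "D \<ge> 1"
  proof (rule ccontr)
    assume "\<not> D \<ge> 1"
    then have "c^2 - 4 * b * d \<le> - 1" using assms(2) unfolding D_def by linarith
    then have "D \<le> - 1" unfolding D_def by linarith
    moreover have "w^2 \<ge> 0" by simp
    ultimately show False using wD \<delta> by linarith
  qed
  define e where "e = sqrt D"
  have e: "e > 0" "e^2 = D" using D1 by (auto simp: e_def)
  have b0: "real_of_int b \<noteq> 0" using b by simp
  have fac: "\<bar>w - e\<bar> * \<bar>w + e\<bar> \<le> 4 * \<bar>real_of_int b\<bar> * \<delta>"
  proof -
    have "(w - e) * (w + e) = w^2 - D" using e by (simp add: power2_eq_square algebra_simps)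
    then show ?thesis using wD by (simp add: abs_mult[symmetric])
  qed
  have conv: "\<bar>x - (- c + \<sigma> * e) / (2 * b)\<bar> = \<bar>w - \<sigma> * e\<bar> / (2 * \<bar>real_of_int b\<bar>)" for \<sigma>
  proof -
    have "x - (- c + \<sigma> * e) / (2 * b) = (w - \<sigma> * e) / (2 * b)" using b0 by (simp add: w_def field_simps)
    then show ?thesis by (simp add: abs_mult)
  qed
  have fin: "\<bar>w - \<sigma> * e\<bar> / (2 * \<bar>real_of_int b\<bar>) * e \<le> 2 * \<delta>" if "\<bar>w - \<sigma> * e\<bar> * e \<le> 4 * \<bar>real_of_int b\<bar> * \<delta>" for \<sigma>
    using that b0 by (simp add: field_simps)
  show "\<exists>\<sigma>\<in>{-1, 1}. \<bar>x - (- c + \<sigma> * sqrt D) / (2 * b)\<bar> * sqrt D \<le> 2 * \<delta>"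
  proof (cases "w \<ge> 0")
    case True
    then have "e \<le> \<bar>w + e\<bar>" using e by simp
    then have "\<bar>w - e\<bar> * e \<le> \<bar>w - e\<bar> * \<bar>w + e\<bar>" by (intro mult_left_mono) auto
    then have "\<bar>w - 1 * e\<bar> * e \<le> 4 * \<bar>real_of_int b\<bar> * \<delta>" using fac by simp
    from fin[OF this] show ?thesis unfolding e_def[symmetric] conv[symmetric] by blast
  next
    case False
    then have "e \<le> \<bar>w - e\<bar>" using e by simp
    then have "\<bar>w + e\<bar> * e \<le> \<bar>w + e\<bar> * \<bar>w - e\<bar>" by (intro mult_left_mono) auto
    then have "\<bar>w - (-1) * e\<bar> * e \<le> 4 * \<bar>real_of_int b\<bar> * \<delta>" using fac by (simp add: mult.commute)
    from fin[OF this] show ?thesis unfolding e_def[symmetric] conv[symmetric] by blast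
  qed
qed

text \<open>The distance to a root is about \<delta> / sqrt D. Triples with sqrt D \<le> R are few,
  as D \<le> R^2 leaves O(R^2) values of \<open>d\<close> for given \<open>b\<close> and
  \<open>c\<close>, and they may have balls of weight of order \<open>Q\<close>; all the others get
  weight of order \<open>Q / R\<close>.\<close>

lemma quadratic_cover:
  fixes Q R \<delta> m :: real
  assumes Q: "Q \<ge> 1" and R: "1 \<le> R" "R \<le> Q" and \<delta>: "\<delta> > 0" "8 * Q * \<delta> < 1" and m: "4 * Q \<le> m"
  shows "coverable (\<delta> / Q) m (600 * Q^3 * R^2 + 1000 * Q^4 / R)
     {x::real. \<exists>b c d::int. b \<noteq> 0 \<and> coeff_le Q b \<and> coeff_le Q c \<and> coeff_le Q d
        \<and> c^2 - 4 * b * d \<noteq> 0 \<and> \<bar>b * x^2 + c * x + d\<bar> \<le> \<delta>}"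
proof -
  define J where "J = {n::int. \<bar>n + 0\<bar> \<le> 2 * Q}"
  have J: "finite J" "real (card J) \<le> 5 * Q" using card_shifted[of "2 * Q" 0] Q by (auto simp: J_def)
  define D where "D = (\<lambda>(b::int, c::int, d::int). real_of_int (c^2 - 4 * b * d))"
  define C where "C b c = {d::int. \<bar>d + (-1) * (real_of_int c ^ 2 / (4 * real_of_int b))\<bar> \<le> R^2}" for b c :: int
  define S where "S = (SIGMA b:J. SIGMA c:J. C b c)"
  define Y where "Y s = (\<lambda>(b::int, c::int, d::int). ball ((- c + (- 1) * sqrt (D (b, c, d))) / (2 * b)) (s * (\<delta> / Q)) \<union>
     ball ((- c + 1 * sqrt (D (b, c, d))) / (2 * b)) (s * (\<delta> / Q)))" for s
  have R2: "R^2 \<ge> 1" using R by (simp add: one_le_power)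
  have c1: "finite (C b c)" "real (card (C b c)) \<le> 3 * R^2" for b c
    using card_shifted[of "R^2" "(-1) * (real_of_int c ^ 2 / (4 * real_of_int b))"] R2 unfolding C_def by auto
  have c2: "finite (SIGMA c:J. C b c)" "real (card (SIGMA c:J. C b c)) \<le> 5 * Q * (3 * R^2)" for b
  proof -
    show "finite (SIGMA c:J. C b c)" using J c1 by auto
    have "real (card (SIGMA c:J. C b c)) \<le> (\<Sum>c\<in>J. 3 * R^2)" by (rule card_Sigma_le) (use J c1 in auto)
    also have "\<dots> = real (card J) * (3 * R^2)" by simp
    also have "\<dots> \<le> 5 * Q * (3 * R^2)" using J by (intro mult_right_mono) auto
    finally show "real (card (SIGMA c:J. C b c)) \<le> 5 * Q * (3 * R^2)" .
  qed
  have finS: "finite S" using J c2 by (auto simp: S_def)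
  have cS: "real (card S) \<le> 75 * Q^2 * R^2"
  proof -
    have "real (card S) \<le> (\<Sum>b\<in>J. 5 * Q * (3 * R^2))" unfolding S_def by (rule card_Sigma_le) (use J c2 in auto)
    also have "\<dots> = real (card J) * (5 * Q * (3 * R^2))" by simp
    also have "\<dots> \<le> 5 * Q * (5 * Q * (3 * R^2))" using J Q by (intro mult_right_mono) auto
    finally show ?thesis by (simp add: power2_eq_square)
  qed
  have Y: "coverable (\<delta> / Q) m (s + s) (Y s i)" if "1 \<le> s" "s \<le> m" for s i
    unfolding Y_def by (cases i) (simp only: prod.case, intro coverable_Un coverable_ball that)
  have c3: "coverable (\<delta> / Q) m (real (card S) * (4 * Q + 4 * Q)) (\<Union>i\<in>S. Y (4 * Q) i)"
    by (rule coverable_UN_const[OF finS]) (use Y[of "4 * Q"] Q m in simp)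
  have QR: "1 \<le> Q / R" "Q / R \<le> Q" using R Q by (auto simp: field_simps)
  have c4: "coverable (\<delta> / Q) m (real (card (J \<times> J \<times> J)) * (4 * (Q / R) + 4 * (Q / R))) (\<Union>i\<in>J \<times> J \<times> J. Y (4 * (Q / R)) i)"
    by (rule coverable_UN_const) (use J Y[of "4 * (Q / R)"] QR m in simp_all)
  have cJ: "real (card (J \<times> J \<times> J)) \<le> 125 * Q^3"
  proof -
    have "real (card (J \<times> J \<times> J)) = real (card J) * (real (card J) * real (card J))" by (simp add: card_cartesian_product)
    also have "\<dots> \<le> 5 * Q * (5 * Q * (5 * Q))" using J Q by (intro mult_mono) auto
    finally show ?thesis by (simp add: power3_eq_cube)
  qed
  from coverable_Un[OF c3 c4] show ?thesis
  proof (rule coverable_mono)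
    have "real (card S) * (4 * Q + 4 * Q) \<le> 75 * Q^2 * R^2 * (4 * Q + 4 * Q)" using cS Q by (intro mult_right_mono) auto
    moreover have "real (card (J \<times> J \<times> J)) * (4 * (Q / R) + 4 * (Q / R)) \<le> 125 * Q^3 * (4 * (Q / R) + 4 * (Q / R))"
      using cJ QR by (intro mult_right_mono) auto
    moreover have "75 * Q^2 * R^2 * (4 * Q + 4 * Q) = 600 * Q^3 * R^2" "125 * Q^3 * (4 * (Q / R) + 4 * (Q / R)) = 1000 * Q^4 / R"
      by (simp_all add: eval_nat_numeral)
    ultimately show "real (card S) * (4 * Q + 4 * Q) + real (card (J \<times> J \<times> J)) * (4 * (Q / R) + 4 * (Q / R)) \<le> 600 * Q^3 * R^2 + 1000 * Q^4 / R"
      by linarith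
    show "{x::real. \<exists>b c d::int. b \<noteq> 0 \<and> coeff_le Q b \<and> coeff_le Q c \<and> coeff_le Q d
        \<and> c^2 - 4 * b * d \<noteq> 0 \<and> \<bar>b * x^2 + c * x + d\<bar> \<le> \<delta>} \<subseteq> (\<Union>i\<in>S. Y (4 * Q) i) \<union> (\<Union>i\<in>J \<times> J \<times> J. Y (4 * (Q / R)) i)"
    proof
      fix x assume "x \<in> {x::real. \<exists>b c d::int. b \<noteq> 0 \<and> coeff_le Q b \<and> coeff_le Q c \<and> coeff_le Q d
        \<and> c^2 - 4 * b * d \<noteq> 0 \<and> \<bar>b * x^2 + c * x + d\<bar> \<le> \<delta>}"
      then obtain b c d :: int where bcd: "b \<noteq> 0" "coeff_le Q b" "coeff_le Q c" "coeff_le Q d"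
        "c^2 - 4 * b * d \<noteq> 0" "\<bar>b * x^2 + c * x + d\<bar> \<le> \<delta>" by blast
      have "4 * \<bar>real_of_int b\<bar> * \<delta> \<le> 4 * (2 * Q) * \<delta>" using bcd(2) \<delta> by (intro mult_right_mono mult_left_mono) auto
      also have "\<dots> = 8 * Q * \<delta>" by simp
      finally have "4 * \<bar>real_of_int b\<bar> * \<delta> < 1" using \<delta>(2) by linarith
      note q = quadratic_near_root[OF bcd(1,5) this bcd(6)]
      define e where "e = sqrt (D (b, c, d))"
      have D1: "D (b, c, d) \<ge> 1" using q(1) by (simp add: D_def)
      have e1: "e \<ge> 1" using D1 by (simp add: e_def)
      obtain \<sigma> where \<sigma>: "\<sigma> \<in> {-1, 1}" "\<bar>x - (- c + \<sigma> * e) / (2 * b)\<bar> * e \<le> 2 * \<delta>" using q(2) unfolding e_def D_def prod.case by blast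
      have inY: "x \<in> Y s (b, c, d)" if "2 * \<delta> / e < s * (\<delta> / Q)" for s
      proof -
        have "\<bar>x - (- c + \<sigma> * e) / (2 * b)\<bar> \<le> 2 * \<delta> / e" using \<sigma>(2) e1 by (simp add: pos_le_divide_eq)
        then have "dist ((- c + \<sigma> * e) / (2 * b)) x < s * (\<delta> / Q)" using that by (simp add: dist_real_def abs_minus_commute)
        then show ?thesis using \<sigma>(1) unfolding Y_def e_def prod.case Un_iff mem_ball by blast
      qed
      have J3: "b \<in> J" "c \<in> J" "d \<in> J" using bcd by (auto simp: J_def)
      show "x \<in> (\<Union>i\<in>S. Y (4 * Q) i) \<union> (\<Union>i\<in>J \<times> J \<times> J. Y (4 * (Q / R)) i)"
      proof (cases "e \<le> R")
        case True
        then have "e^2 \<le> R^2" using e1 by (intro power_mono) auto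
        then have DR: "D (b, c, d) \<le> R^2" using D1 by (simp add: e_def)
        have b1: "1 \<le> \<bar>real_of_int b\<bar>" using bcd(1) by linarith
        have "real_of_int d + (-1) * (real_of_int c ^ 2 / (4 * real_of_int b)) = - D (b, c, d) / (4 * b)" using bcd(1) by (simp add: D_def field_simps)
        then have "\<bar>real_of_int d + (-1) * (real_of_int c ^ 2 / (4 * real_of_int b))\<bar> = D (b, c, d) / (4 * \<bar>real_of_int b\<bar>)" using D1 by (simp add: abs_mult)
        also have "\<dots> \<le> D (b, c, d) / 1" using b1 D1 by (intro divide_left_mono) auto
        finally have "d \<in> C b c" using DR by (simp add: C_def)
        then have "(b, c, d) \<in> S" using J3 by (simp add: S_def)
        moreover have "x \<in> Y (4 * Q) (b, c, d)"
        proof (rule inY)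
          have "2 * \<delta> / e \<le> 2 * \<delta> / 1" using e1 \<delta> by (intro divide_left_mono) auto
          also have "\<dots> < 4 * Q * (\<delta> / Q)" using Q \<delta> by simp
          finally show "2 * \<delta> / e < 4 * Q * (\<delta> / Q)" .
        qed
        ultimately show ?thesis by blast
      next
        case False
        have "x \<in> Y (4 * (Q / R)) (b, c, d)"
        proof (rule inY)
          have "2 * \<delta> / e \<le> 2 * \<delta> / R" using False R \<delta> by (intro divide_left_mono) auto
          also have "\<dots> < 4 * \<delta> / R" using R \<delta> by (intro divide_strict_right_mono) auto
          also have "\<dots> = 4 * (Q / R) * (\<delta> / Q)" using Q by simp
          finally show "2 * \<delta> / e < 4 * (Q / R) * (\<delta> / Q)" .
        qed
        then show ?thesis using J3 by blast
      qed
    qed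
  qed
qed

section \<open>Strips of small derivative\<close>

text \<open>Moves the derivative bound from the complex root to the real point \<open>x\<close>. The
  displacement is at most \<open>4 * \<delta> / \<theta>\<close>, so a lower bound on the derivative
  at the root enters as well.\<close>

lemma near_root_small_deriv:
  fixes N Q t l \<delta> \<theta> K x :: real
  assumes irr: "irr3 a b c d" and N: "N \<ge> 1" and Q: "Q \<ge> 1"
    and b: "coeff_le Q a" "coeff_le Q b" "coeff_le Q c" "coeff_le Q d"
    and x: "\<bar>x\<bar> \<le> N" "\<bar>taylor0 a b c d x\<bar> \<le> \<delta>" and \<alpha>: "cmod (complex_of_real x - \<alpha>) \<le> 1" "cmod (taylor1 a b c \<alpha>) * cmod (complex_of_real x - \<alpha>) \<le> 4 * \<delta>"
    and \<theta>: "\<theta> > 0" "\<theta> \<le> cmod (taylor1 a b c \<alpha>)" and p: "cmod (taylor1 a b c \<alpha>) \<le> 2 * L * (Q * t)" and L: "L = 12 * (N + 2)^2"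
    and \<delta>: "\<delta> \<le> Q * t * l" "20 * L * Q * \<delta> / \<theta> \<le> K * (Q * t)"
  shows "(a, b, c, d) \<in> small_deriv N (2 * L + K) Q t l"
proof -
  define h where "h = complex_of_real x - \<alpha>"
  have h1: "norm h \<le> 1" using \<alpha>(1) by (simp add: h_def)
  have "\<theta> * norm h \<le> 4 * \<delta>" using \<alpha>(2) \<theta>(2) mult_right_mono[OF \<theta>(2), of "norm h"] by (simp add: h_def)
  then have h: "norm h \<le> 4 * \<delta> / \<theta>" using \<theta>(1) by (simp add: pos_le_divide_eq mult.commute)
  have M: "N + 2 \<ge> 1" "norm \<alpha> \<le> N + 2"
    using N x(1) \<alpha>(1) norm_triangle_ineq4[of "complex_of_real x" "complex_of_real x - \<alpha>"] by auto
  note bd = taylor_bounds[OF M b(1-3), folded L]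
  have LQ: "L * Q \<ge> 0" using bd(3) norm_ge_zero[of "of_int a :: complex"] by linarith
  have "complex_of_real (taylor1 a b c x) = taylor1 a b c (\<alpha> + h)" by (simp add: taylor_of_real h_def)
  also have "\<dots> = taylor1 a b c \<alpha> + 2 * (taylor2 a b \<alpha> * h) + 3 * (of_int a * (h * h))"
    unfolding taylor_add by (simp add: power2_eq_square)
  finally have "\<bar>taylor1 a b c x\<bar> = norm (taylor1 a b c \<alpha> + 2 * (taylor2 a b \<alpha> * h) + 3 * (of_int a * (h * h)))"
    by (metis norm_of_real)
  also have "\<dots> \<le> 2 * L * (Q * t) + 2 * (L * Q * norm h) + 3 * (L * Q * (norm h * 1))"
    by (intro norm_add_le norm_mult_le p bd h1) auto
  also have "\<dots> = 2 * L * (Q * t) + 5 * (L * Q) * norm h" by simp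
  also have "\<dots> \<le> 2 * L * (Q * t) + 5 * (L * Q) * (4 * \<delta> / \<theta>)" using h LQ by (intro add_left_mono mult_left_mono) auto
  also have "\<dots> = 2 * L * (Q * t) + 20 * L * Q * \<delta> / \<theta>" by simp
  also have "\<dots> \<le> 2 * L * (Q * t) + K * (Q * t)" using \<delta>(2) by linarith
  also have "\<dots> = (2 * L + K) * Q * t" by (simp add: algebra_simps)
  finally have "\<bar>taylor1 a b c x\<bar> \<le> (2 * L + K) * Q * t" .
  moreover have "\<bar>taylor0 a b c d x\<bar> \<le> Q * t * l" using x(2) \<delta>(1) by linarith
  ultimately show ?thesis unfolding small_deriv_def using irr b x(1) by auto
qed

text \<open>A strip of derivative sizes: \<open>\<eta>\<close> governs the number of cubics,
  \<open>\<theta>\<close> the radius of the balls.\<close>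

definition near_root_set :: "real \<Rightarrow> real \<Rightarrow> real \<Rightarrow> real \<Rightarrow> real \<Rightarrow> real set" where
  "near_root_set N Q \<delta> \<theta> \<eta> = {x. \<bar>x\<bar> \<le> N \<and> (\<exists>a b c d (\<alpha>::complex). irr3 a b c d \<and> coeff_le Q a \<and> coeff_le Q b
     \<and> coeff_le Q c \<and> coeff_le Q d \<and> \<bar>taylor0 a b c d x\<bar> \<le> \<delta> \<and> taylor0 a b c d \<alpha> = 0
     \<and> cmod (complex_of_real x - \<alpha>) \<le> 1 \<and> cmod (taylor1 a b c \<alpha>) * cmod (complex_of_real x - \<alpha>) \<le> 4 * \<delta>
     \<and> \<theta> \<le> cmod (taylor1 a b c \<alpha>) \<and> cmod (taylor1 a b c \<alpha>) \<le> \<eta>)}"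

text \<open>\<open>\<tau>\<close> and \<open>\<tau>'\<close> delimit a strip by powers of
  \<open>Q\<close>. The cubics are counted for the largest derivative in the strip while the weight
  \<open>Q powr \<tau>'\<close> of a ball belongs to the smallest; this loss is why several strips
  are needed.\<close>

lemma near_root_set_cover:
  fixes N Q \<delta> L \<tau> \<tau>' l :: real
  assumes N: "N \<ge> 1" and Q: "Q \<ge> 1" and \<delta>: "0 < \<delta>" "\<delta> \<le> Q powr (- 27 / 10)" and L: "L = 12 * (N + 2)^2"
    and \<tau>: "0 \<le> \<tau>'" "\<tau>' \<le> 2" "\<tau> + \<tau>' \<le> 37 / 10" and l: "\<delta> \<le> Q * Q powr (- \<tau>) * l"
  shows "coverable (\<delta> / Q) (15 * L * Q^2) (real (card (small_deriv N (2 * L + 60 * L^2) Q (Q powr (- \<tau>)) l)) * (45 * L * Q powr \<tau>'))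
    (near_root_set N Q \<delta> (Q powr (1 - \<tau>') / (3 * L)) (2 * L * Q powr (1 - \<tau>)))"
proof -
  have L1: "L \<ge> 1" unfolding L using N one_le_power[of "N + 2" 2] by linarith
  define \<theta> where "\<theta> = Q powr (1 - \<tau>') / (3 * L)"
  have \<theta>: "\<theta> > 0" using L1 Q by (simp add: \<theta>_def)
  \<comment> \<open>\<open>4 * \<delta> / \<theta>\<close> is \<open>12 * L * Q powr \<tau>'\<close>
    times the unit radius; 15 makes the inequality strict.\<close>
  define s where "s = 15 * L * Q powr \<tau>'"
  have q1: "1 \<le> Q powr \<tau>'" using Q \<tau> by (simp add: ge_one_powr_ge_zero)
  have "1 * 1 \<le> 15 * L * Q powr \<tau>'" using q1 L1 by (intro mult_mono) auto
  then have s1: "1 \<le> s" by (simp add: s_def)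
  have "Q powr \<tau>' \<le> Q powr 2" using Q \<tau> by (intro powr_mono) auto
  then have s2: "s \<le> 15 * L * Q^2" unfolding s_def using Q L1 by (intro mult_left_mono) (auto simp: powr_numeral)
  have QQ: "Q powr (1 - \<tau>') * Q powr \<tau>' = Q" using Q by (simp flip: powr_add)
  have \<theta>inv: "1 / \<theta> = 3 * L * Q powr \<tau>' / Q"
    using Q L1 QQ by (simp add: \<theta>_def field_simps)
  have s3: "4 * \<delta> / \<theta> < s * (\<delta> / Q)"
  proof -
    have "4 * \<delta> / \<theta> = 4 * \<delta> * (1 / \<theta>)" by simp
    also have "\<dots> = 12 * (L * Q powr \<tau>' * (\<delta> / Q))" unfolding \<theta>inv by simp
    also have "\<dots> < 15 * (L * Q powr \<tau>' * (\<delta> / Q))" using L1 Q \<delta> q1 by (intro mult_strict_right_mono mult_pos_pos) auto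
    finally show ?thesis by (simp add: s_def)
  qed
  have small: "20 * L * Q * \<delta> / \<theta> \<le> 60 * L^2 * (Q * Q powr (- \<tau>))"
  proof -
    have "20 * L * Q * \<delta> / \<theta> = 20 * L * Q * \<delta> * (1 / \<theta>)" by simp
    also have "\<dots> = 60 * L^2 * (\<delta> * Q powr \<tau>')" unfolding \<theta>inv using Q by (simp add: power2_eq_square)
    also have "\<delta> * Q powr \<tau>' \<le> Q powr (- 27 / 10) * Q powr \<tau>'" using \<delta> by (intro mult_right_mono) auto
    also have "\<dots> = Q powr (\<tau>' - 27 / 10)" by (simp flip: powr_add)
    also have "\<dots> \<le> Q powr (1 - \<tau>)" using Q \<tau> by (intro powr_mono) auto
    also have "\<dots> = Q * Q powr (- \<tau>)" using powr_add[of Q 1 "- \<tau>"] Q by simp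
    finally show ?thesis using Q L1 by simp
  qed
  have Qt: "Q powr (1 - \<tau>) = Q * Q powr (- \<tau>)" using powr_add[of Q 1 "- \<tau>"] Q by simp
  define B where "B = small_deriv N (2 * L + 60 * L^2) Q (Q powr (- \<tau>)) l"
  have "coverable (\<delta> / Q) (15 * L * Q^2) (real (card B) * (3 * s)) {x. \<exists>a b c d (\<alpha>::complex). (a, b, c, d) \<in> B \<and> taylor0 a b c d \<alpha> = 0 \<and>
     \<theta> \<le> cmod (taylor1 a b c \<alpha>) \<and> cmod (taylor1 a b c \<alpha>) * cmod (complex_of_real x - \<alpha>) \<le> 4 * \<delta>}"
    by (rule root_family_cover[OF _ _ \<theta> \<delta>(1) s1 s2 s3]) (auto simp: B_def finite_small_deriv, auto simp: small_deriv_def)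
  then show ?thesis
  proof (rule coverable_mono)
    show "near_root_set N Q \<delta> (Q powr (1 - \<tau>') / (3 * L)) (2 * L * Q powr (1 - \<tau>)) \<subseteq> {x. \<exists>a b c d (\<alpha>::complex). (a, b, c, d) \<in> B \<and> taylor0 a b c d \<alpha> = 0 \<and>
     \<theta> \<le> cmod (taylor1 a b c \<alpha>) \<and> cmod (taylor1 a b c \<alpha>) * cmod (complex_of_real x - \<alpha>) \<le> 4 * \<delta>}"
    proof
      fix x assume "x \<in> near_root_set N Q \<delta> (Q powr (1 - \<tau>') / (3 * L)) (2 * L * Q powr (1 - \<tau>))"
      then obtain a b c d \<alpha> where x: "\<bar>x\<bar> \<le> N" "irr3 a b c d" "coeff_le Q a" "coeff_le Q b"
         "coeff_le Q c" "coeff_le Q d" "\<bar>taylor0 a b c d x\<bar> \<le> \<delta>" "taylor0 a b c d \<alpha> = 0"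
         "cmod (complex_of_real x - \<alpha>) \<le> 1" "cmod (taylor1 a b c \<alpha>) * cmod (complex_of_real x - \<alpha>) \<le> 4 * \<delta>"
         "\<theta> \<le> cmod (taylor1 a b c \<alpha>)" "cmod (taylor1 a b c \<alpha>) \<le> 2 * L * Q powr (1 - \<tau>)"
        unfolding near_root_set_def \<theta>_def[symmetric] by blast
      have "(a, b, c, d) \<in> B" unfolding B_def
        by (rule near_root_small_deriv[OF x(2) N Q x(3-6) x(1) x(7) x(9,10) \<theta> x(11) x(12)[unfolded Qt] L l small])
      then show "x \<in> {x. \<exists>a b c d (\<alpha>::complex). (a, b, c, d) \<in> B \<and> taylor0 a b c d \<alpha> = 0 \<and>
         \<theta> \<le> cmod (taylor1 a b c \<alpha>) \<and> cmod (taylor1 a b c \<alpha>) * cmod (complex_of_real x - \<alpha>) \<le> 4 * \<delta>}"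
        using x(8,10,11) by blast
    qed
    show "real (card B) * (3 * s) \<le> real (card (small_deriv N (2 * L + 60 * L^2) Q (Q powr (- \<tau>)) l)) * (45 * L * Q powr \<tau>')"
      by (simp add: B_def s_def)
  qed
qed

lemma powr_mult_powr_le:
  fixes Q :: real
  assumes "Q \<ge> 1" "u + v \<le> w"
  shows "Q powr u * Q powr v \<le> Q powr w"
  using assms powr_mono[of "u + v" w Q] by (simp add: powr_add)

text \<open>Apart from the range of \<tau>, the hypotheses are the exponents of
  \<open>Q / t * cell_bound Q t * Q powr \<tau>'\<close>, one for each summand of
  \<open>cell_bound\<close>, after taking out a factor \<open>Q\<close>; hence 27 / 10 = 37 / 10 -
  1.\<close>

lemma near_root_set_cover_lattice:
  fixes N L :: real
  assumes N: "N \<ge> 1" and L: "L = 12 * (N + 2)^2"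
    and \<tau>: "0 \<le> \<tau>" "\<tau> \<le> 3 / 2" "0 \<le> \<tau>'" "\<tau>' \<le> 2" "\<tau> + \<tau>' \<le> 27 / 10"
    and e: "(5 - 4 * \<tau>) / 3 + \<tau> + \<tau>' \<le> 27 / 10" "2 - \<tau> + \<tau>' \<le> 27 / 10" "(8 - 7 * \<tau>) / 3 + \<tau> + \<tau>' \<le> 27 / 10" "3 - 2 * \<tau> + \<tau>' \<le> 27 / 10"
  obtains C where "C > 0" "\<And>Q \<delta>. Q \<ge> 1 \<Longrightarrow> 0 < \<delta> \<Longrightarrow> \<delta> \<le> Q powr (- 27 / 10) \<Longrightarrow>
    coverable (\<delta> / Q) (15 * L * Q^2) (C * Q powr (37 / 10)) (near_root_set N Q \<delta> (Q powr (1 - \<tau>') / (3 * L)) (2 * L * Q powr (1 - \<tau>)))"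
proof -
  have L1: "L \<ge> 1" unfolding L using N one_le_power[of "N + 2" 2] by linarith
  define K where "K = 2 * L + 60 * L^2"
  have K1: "K \<ge> 1" using L1 zero_le_power2[of L] unfolding K_def by linarith
  define C where "C = 4000000 * N * (K + 12 * N + 10)^4 * 5 * (45 * L)"
  show ?thesis
  proof (rule that[of C])
    have "K + 12 * N + 10 > 0" using K1 N by linarith
    then show "C > 0" using N L1 by (simp add: C_def)
    fix Q \<delta> :: real assume Q: "Q \<ge> 1" and \<delta>: "0 < \<delta>" "\<delta> \<le> Q powr (- 27 / 10)"
    define t where "t = Q powr (- \<tau>)"
    have t: "0 < t" "t \<le> 1" using Q \<tau>(1) powr_mono[of "- \<tau>" 0 Q] by (auto simp: t_def)
    have "\<delta> \<le> Q powr (1 + - \<tau> + - \<tau>)" using \<delta>(2) powr_mono[of "- 27 / 10" "1 + - \<tau> + - \<tau>" Q] Q \<tau> by linarith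
    also have "\<dots> = Q * t * t" using Q unfolding t_def powr_add by simp
    finally have l: "\<delta> \<le> Q * Q powr (- \<tau>) * t" by (simp add: t_def)
    have tn: "t ^ n = Q powr (- \<tau> * real n)" for n using Q unfolding t_def by (simp add: powr_powr powr_realpow[symmetric] del: powr_minus)
    have Qn: "Q ^ n = Q powr (real n)" for n using Q by (simp add: powr_realpow)
    have cb: "cell_bound Q t = 1 + Q powr ((5 - 4 * \<tau>) / 3) + Q powr (2 - 2 * \<tau>) + Q powr ((8 - 7 * \<tau>) / 3) + Q powr (3 - 3 * \<tau>)"
    proof -
      have qt: "Q ^ m * t ^ n = Q powr (real m - \<tau> * real n)" for m n
        unfolding tn Qn by (simp flip: powr_add)
      have "(Q ^ 5 * t ^ 4) powr (1 / 3) = Q powr ((5 - 4 * \<tau>) / 3)" "(Q ^ 8 * t ^ 7) powr (1 / 3) = Q powr ((8 - 7 * \<tau>) / 3)"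
        unfolding qt powr_powr by (simp_all add: mult.commute)
      moreover have "Q^2 * t^2 = Q powr (2 - 2 * \<tau>)" "Q^3 * t^3 = Q powr (3 - 3 * \<tau>)"
        unfolding qt by (simp_all add: mult.commute)
      ultimately show ?thesis by (simp only: cell_bound_def)
    qed
    have "Q / t = Q powr (1 + \<tau>)" using Q by (simp add: t_def powr_add powr_minus field_simps)
    then have "Q / t * cell_bound Q t * Q powr \<tau>' = Q powr (1 + \<tau> + \<tau>') * cell_bound Q t" by (simp add: powr_add)
    also have "\<dots> = Q powr (1 + \<tau> + \<tau>') * Q powr 0 + Q powr (1 + \<tau> + \<tau>') * Q powr ((5 - 4 * \<tau>) / 3) + Q powr (1 + \<tau> + \<tau>') * Q powr (2 - 2 * \<tau>)
       + Q powr (1 + \<tau> + \<tau>') * Q powr ((8 - 7 * \<tau>) / 3) + Q powr (1 + \<tau> + \<tau>') * Q powr (3 - 3 * \<tau>)"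
      unfolding cb using Q by (simp add: distrib_left)
    also have "\<dots> \<le> Q powr (37 / 10) + Q powr (37 / 10) + Q powr (37 / 10) + Q powr (37 / 10) + Q powr (37 / 10)"
      by (intro add_mono powr_mult_powr_le Q) (use \<tau> e in auto)
    finally have main: "Q / t * cell_bound Q t * Q powr \<tau>' \<le> 5 * Q powr (37 / 10)" by simp
    have cov: "coverable (\<delta> / Q) (15 * L * Q^2) (real (card (small_deriv N K Q t t)) * (45 * L * Q powr \<tau>'))
      (near_root_set N Q \<delta> (Q powr (1 - \<tau>') / (3 * L)) (2 * L * Q powr (1 - \<tau>)))"
      unfolding K_def t_def by (rule near_root_set_cover[OF N Q \<delta> L]) (use \<tau> l in \<open>auto simp: t_def\<close>)
    then show "coverable (\<delta> / Q) (15 * L * Q^2) (C * Q powr (37 / 10)) (near_root_set N Q \<delta> (Q powr (1 - \<tau>') / (3 * L)) (2 * L * Q powr (1 - \<tau>)))"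
    proof (rule coverable_mono[OF _ order_refl])
      have "real (card (small_deriv N K Q t t)) * (45 * L * Q powr \<tau>') \<le> 4000000 * N * (K + 12 * N + 10)^4 * (Q / t * cell_bound Q t) * (45 * L * Q powr \<tau>')"
        using small_deriv_count_lattice[OF N K1 Q t] L1 by (intro mult_right_mono) auto
      also have "\<dots> = 4000000 * N * (K + 12 * N + 10)^4 * (45 * L) * (Q / t * cell_bound Q t * Q powr \<tau>')" by simp
      also have "\<dots> \<le> 4000000 * N * (K + 12 * N + 10)^4 * (45 * L) * (5 * Q powr (37 / 10))"
        using main N L1 K1 by (intro mult_left_mono mult_nonneg_nonneg) auto
      also have "\<dots> = C * Q powr (37 / 10)" by (simp add: C_def)
      finally show "real (card (small_deriv N K Q t t)) * (45 * L * Q powr \<tau>') \<le> C * Q powr (37 / 10)" .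
    qed
  qed
qed

text \<open>The mesh is, up to the constant \<open>W\<close>, the largest for which the resultant
  bound Q^6 t^3 l falls below 1. It must not exceed \<open>t\<close>, which is the condition
  \<open>\<tau> \<le> 3 / 2\<close>.\<close>

lemma near_root_set_cover_resultant:
  fixes N L :: real
  assumes N: "N \<ge> 1" and L: "L = 12 * (N + 2)^2"
    and \<tau>: "13 / 10 \<le> \<tau>" "\<tau> \<le> 3 / 2" "0 \<le> \<tau>'" "\<tau>' \<le> 2" "6 - 3 * \<tau> + \<tau>' \<le> 37 / 10"
  obtains C Q0 where "C > 0" "\<And>Q \<delta>. Q \<ge> 1 \<Longrightarrow> Q \<ge> Q0 \<Longrightarrow> 0 < \<delta> \<Longrightarrow> \<delta> \<le> Q powr (- 27 / 10) \<Longrightarrow>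
    coverable (\<delta> / Q) (15 * L * Q^2) (C * Q powr (37 / 10)) (near_root_set N Q \<delta> (Q powr (1 - \<tau>') / (3 * L)) (2 * L * Q powr (1 - \<tau>)))"
proof -
  have L1: "L \<ge> 1" unfolding L using N one_le_power[of "N + 2" 2] by linarith
  define K where "K = 2 * L + 60 * L^2"
  have K1: "K \<ge> 1" using L1 zero_le_power2[of L] unfolding K_def by linarith
  define W where "W = 65 * (K + 12 * N + 10)^6"
  have "(K + 12 * N + 10)^6 \<ge> 1" using K1 N by (intro one_le_power) auto
  then have W: "W \<ge> 1" "64 * (K + 12 * N + 10)^6 < W" by (auto simp: W_def)
  define C where "C = 8 * N * W * (45 * L)"
  show ?thesis
  proof (rule that[of C "W powr (10 / 3)"])
    show "C > 0" using N L1 W by (simp add: C_def)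
    fix Q \<delta> :: real assume Q: "Q \<ge> 1" "Q \<ge> W powr (10 / 3)" and \<delta>: "0 < \<delta>" "\<delta> \<le> Q powr (- 27 / 10)"
    have "W = (W powr (10 / 3)) powr (3 / 10)" using W by (simp add: powr_powr)
    also have "\<dots> \<le> Q powr (3 / 10)" using Q W by (intro powr_mono2) auto
    finally have WQ: "W \<le> Q powr (3 / 10)" .
    define t where "t = Q powr (- \<tau>)"
    define l where "l = Q powr (3 * \<tau> - 6) / W"
    have t: "0 < t" "t \<le> 1" using Q \<tau>(1) powr_mono[of "- \<tau>" 0 Q] by (auto simp: t_def)
    have l0: "0 < l" using Q W by (simp add: l_def)
    have "l \<le> Q powr (3 * \<tau> - 6) / 1" unfolding l_def using W Q by (intro divide_left_mono) auto
    also have "\<dots> \<le> t" unfolding t_def using Q \<tau> by (simp add: powr_mono)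
    finally have lt: "l \<le> t" .
    have "Q^6 * t^3 * Q powr (3 * \<tau> - 6) = Q powr 6 * ((Q powr (- \<tau>)) powr 3) * Q powr (3 * \<tau> - 6)"
    proof -
      have "t powr 3 = t^3" "Q powr 6 = Q^6" using t Q by (simp_all add: powr_numeral)
      then show ?thesis by (simp only: t_def)
    qed
    also have "\<dots> = Q powr (6 + (- \<tau> * 3) + (3 * \<tau> - 6))" by (simp only: powr_powr powr_add)
    also have "\<dots> = 1" using Q by simp
    finally have one: "Q^6 * t^3 * Q powr (3 * \<tau> - 6) = 1" .
    have small: "64 * (K + 12 * N + 10)^6 * Q^6 * t^3 * l < 1"
    proof -
      have "64 * (K + 12 * N + 10)^6 * Q^6 * t^3 * l = 64 * (K + 12 * N + 10)^6 * (Q^6 * t^3 * Q powr (3 * \<tau> - 6)) / W"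
        by (simp add: l_def)
      also have "\<dots> < 1" unfolding one using W by simp
      finally show ?thesis .
    qed
    have dl: "\<delta> \<le> Q * Q powr (- \<tau>) * l"
    proof -
      \<comment> \<open>The power 3 / 10 pays for the constant \<open>W\<close>. The exponents meet
        at \<tau> = 13 / 10, where - 27 / 10 + 3 / 10 = 2 \<tau> - 5; this is the lower end of the
        method.\<close>
      have "\<delta> * W \<le> Q powr (- 27 / 10) * Q powr (3 / 10)" using \<delta> WQ W by (intro mult_mono) auto
      also have "\<dots> \<le> Q powr (1 + - \<tau> + (3 * \<tau> - 6))" using Q \<tau> by (intro powr_mult_powr_le) auto
      also have "\<dots> = Q * Q powr (- \<tau>) * Q powr (3 * \<tau> - 6)" using Q by (simp only: powr_add powr_one)
      finally show ?thesis using W by (simp add: l_def pos_le_divide_eq)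
    qed
    have cov: "coverable (\<delta> / Q) (15 * L * Q^2) (real (card (small_deriv N K Q t l)) * (45 * L * Q powr \<tau>'))
      (near_root_set N Q \<delta> (Q powr (1 - \<tau>') / (3 * L)) (2 * L * Q powr (1 - \<tau>)))"
      unfolding K_def t_def by (rule near_root_set_cover[OF N Q(1) \<delta> L]) (use \<tau> dl in auto)
    then show "coverable (\<delta> / Q) (15 * L * Q^2) (C * Q powr (37 / 10)) (near_root_set N Q \<delta> (Q powr (1 - \<tau>') / (3 * L)) (2 * L * Q powr (1 - \<tau>)))"
    proof (rule coverable_mono[OF _ order_refl])
      have Q0: "Q > 0" using Q by simp
      have inv: "1 / l = W * Q powr (6 - 3 * \<tau>)" unfolding l_def using W powr_minus_divide[of Q "3 * \<tau> - 6"] by simp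
      have "real (card (small_deriv N K Q t l)) * (45 * L * Q powr \<tau>') \<le> 8 * N * (1 / l) * (45 * L * Q powr \<tau>')"
        using small_deriv_count_resultant[OF N K1 Q0 l0 lt t(2) small] L1 by (intro mult_right_mono) auto
      also have "\<dots> = C * (Q powr (6 - 3 * \<tau>) * Q powr \<tau>')" unfolding inv by (simp add: C_def)
      also have "\<dots> \<le> C * Q powr (37 / 10)" using Q \<tau> \<open>C > 0\<close> by (intro mult_left_mono powr_mult_powr_le) auto
      finally show "real (card (small_deriv N K Q t l)) * (45 * L * Q powr \<tau>') \<le> C * Q powr (37 / 10)" .
    qed
  qed
qed

section \<open>Assembly of one dyadic block\<close>

lemma int_poly_cubic_form:
  fixes P :: "int poly"
  assumes "degree P \<le> 3"
  shows "P = [:coeff P 0, coeff P 1, coeff P 2, coeff P 3:]"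
proof (rule poly_eqI)
  fix n :: nat
  consider "n = 0" | "n = 1" | "n = 2" | "n = 3" | "n > 3" by linarith
  then show "coeff P n = coeff [:coeff P 0, coeff P 1, coeff P 2, coeff P 3:] n"
    using assms by cases (auto simp: coeff_pCons coeff_eq_0 numeral_eq_Suc split: nat.split)
qed

lemma coeff_le_height: "\<bar>coeff P i\<bar> \<le> poly_height P"
proof (cases "i \<le> degree P")
  case True
  then show ?thesis unfolding poly_height_def by (intro Max_ge) auto
next
  case False
  have "\<bar>coeff P 0\<bar> \<le> poly_height P" unfolding poly_height_def by (intro Max_ge) auto
  then show ?thesis using False by (simp add: coeff_eq_0)
qed

lemma poly_eq_taylor0: "poly (of_int_poly [:d, c, b, a:]) x = taylor0 a b c d x"
  by (simp add: of_int_hom.map_poly_pCons_hom taylor0_def power2_eq_square power3_eq_cube algebra_simps)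

text \<open>Otherwise the derivative would share the double root - c / (2 b) with an irreducible
  polynomial of larger degree.\<close>

lemma quadratic_disc_nonzero:
  assumes "Factorial_Ring.irreducible [:d, c, b:]" "b \<noteq> (0::int)"
  shows "c^2 - 4 * b * d \<noteq> 0"
proof
  assume D: "c^2 - 4 * b * d = 0"
  define z :: complex where "z = - of_int c / (2 * of_int b)"
  have b: "(of_int b :: complex) \<noteq> 0" using assms(2) by simp
  have z: "2 * of_int b * z = - of_int c" using b by (simp add: z_def)
  have "(of_int c :: complex)^2 - 4 * of_int b * of_int d = of_int (c^2 - 4 * b * d)" by simp
  then have D': "(of_int c :: complex)^2 - 4 * of_int b * of_int d = 0" using D by simp
  have "4 * of_int b * (of_int d + of_int c * z + of_int b * z^2) = 0" using z D' by Groebner_Basis.algebra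
  then have "of_int d + of_int c * z + of_int b * z^2 = 0" using b by simp
  then have "poly (of_int_poly [:d, c, b:]) z = 0"
    by (simp add: of_int_hom.map_poly_pCons_hom power2_eq_square algebra_simps)
  then have "poly (of_int_poly [:c, 2 * b:]) z \<noteq> 0"
    by (intro irreducible_no_common_root[OF assms(1)]) (use assms(2) in auto)
  then show False using z by (simp add: of_int_hom.map_poly_pCons_hom algebra_simps)
qed

text \<open>
  The exponents 1/2, 7/10, 24/25, 13/10, 3/2, 2 are chosen so that the roots whose derivative lies between two
  successive values of \<open>Q powr (1 - \<tau>)\<close> contribute at most \<open>Q powr (37 / 10)\<close>, which is
  at most \<open>Q powr (4 - 2 * lam / 3)\<close> because \<open>lam \<le> 9 / 20\<close>.
\<close>

lemma block_cover:
  fixes \<kappa> lam N :: real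
  assumes lam: "0 \<le> lam" "lam \<le> 9 / 20" and \<kappa>: "\<kappa> > 0" and N: "N \<ge> 1"
  obtains C m Q0 where "C > 0" "m > 0" "\<And>Q \<delta>. Q \<ge> 1 \<Longrightarrow> Q \<ge> Q0 \<Longrightarrow> 0 < \<delta> \<Longrightarrow> \<delta> \<le> Q powr (- 27 / 10) \<Longrightarrow>
    coverable (\<delta> / Q) (m * Q^2) (C * Q powr (4 - 2 * lam / 3))
      {x. \<bar>x\<bar> \<le> N \<and> (\<exists>P\<in>P3_star \<kappa> lam. Q \<le> real_of_int (poly_height P) \<and> real_of_int (poly_height P) < 2 * Q
         \<and> \<bar>poly (of_int_poly P) x\<bar> \<le> \<delta>)}"
proof -
  define L where "L = 12 * (N + 2)^2"
  have L1: "L \<ge> 1" unfolding L_def using N one_le_power[of "N + 2" 2] by linarith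
  define Y where "Y Q \<delta> \<tau> \<tau>' = near_root_set N Q \<delta> (Q powr (1 - \<tau>') / (3 * L)) (2 * L * Q powr (1 - \<tau>))" for Q \<delta> \<tau> \<tau>'
  \<comment> \<open>At \<tau> = 1 / 2 both (8 - 7 \<tau>) / 3 + \<tau> + \<tau>' and 3 - 2 \<tau> +
    \<tau>' reach 27 / 10 for \<tau>' = 7 / 10, so the first strip cannot be longer. The ends 24 /
    25 and 13 / 10 of the next two are slightly inside the limit set by the former
    expression.\<close>
  obtain C1 where C1: "C1 > 0" "\<And>Q \<delta>. Q \<ge> 1 \<Longrightarrow> 0 < \<delta> \<Longrightarrow> \<delta> \<le> Q powr (- 27 / 10) \<Longrightarrow>
    coverable (\<delta> / Q) (15 * L * Q^2) (C1 * Q powr (37 / 10)) (Y Q \<delta> (1/2) (7/10))"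
    unfolding Y_def by (rule near_root_set_cover_lattice[OF N L_def, of "1/2" "7/10"]) auto
  obtain C2 where C2: "C2 > 0" "\<And>Q \<delta>. Q \<ge> 1 \<Longrightarrow> 0 < \<delta> \<Longrightarrow> \<delta> \<le> Q powr (- 27 / 10) \<Longrightarrow>
    coverable (\<delta> / Q) (15 * L * Q^2) (C2 * Q powr (37 / 10)) (Y Q \<delta> (7/10) (24/25))"
    unfolding Y_def by (rule near_root_set_cover_lattice[OF N L_def, of "7/10" "24/25"]) auto
  obtain C3 where C3: "C3 > 0" "\<And>Q \<delta>. Q \<ge> 1 \<Longrightarrow> 0 < \<delta> \<Longrightarrow> \<delta> \<le> Q powr (- 27 / 10) \<Longrightarrow>
    coverable (\<delta> / Q) (15 * L * Q^2) (C3 * Q powr (37 / 10)) (Y Q \<delta> (24/25) (13/10))"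
    unfolding Y_def by (rule near_root_set_cover_lattice[OF N L_def, of "24/25" "13/10"]) auto
  \<comment> \<open>From 13 / 10 on the resultant method applies. Its strips end at 3 / 2, the
    largest \<tau> it admits, and at 2, where the discriminant stops the derivative.\<close>
  obtain C4 Q4 where C4: "C4 > 0" "\<And>Q \<delta>. Q \<ge> 1 \<Longrightarrow> Q \<ge> Q4 \<Longrightarrow> 0 < \<delta> \<Longrightarrow> \<delta> \<le> Q powr (- 27 / 10) \<Longrightarrow>
    coverable (\<delta> / Q) (15 * L * Q^2) (C4 * Q powr (37 / 10)) (Y Q \<delta> (13/10) (3/2))"
    unfolding Y_def by (rule near_root_set_cover_resultant[OF N L_def, of "13/10" "3/2"]) auto
  obtain C5 Q5 where C5: "C5 > 0" "\<And>Q \<delta>. Q \<ge> 1 \<Longrightarrow> Q \<ge> Q5 \<Longrightarrow> 0 < \<delta> \<Longrightarrow> \<delta> \<le> Q powr (- 27 / 10) \<Longrightarrow>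
    coverable (\<delta> / Q) (15 * L * Q^2) (C5 * Q powr (37 / 10)) (Y Q \<delta> (3/2) 2)"
    unfolding Y_def by (rule near_root_set_cover_resultant[OF N L_def, of "3/2" 2]) auto
  define M where "M = N + 1"
  have M: "M \<ge> 1" using N by (simp add: M_def)
  have LM: "L = 12 * (M + 1)^2" by (simp add: L_def M_def algebra_simps)
  define B where "B = 16 * \<kappa> + 36 * (M + 1)^2 + 2"
  define C6 where "C6 = 5 * L * (8 * (M + 1) * (150 * B + 54 * B * (48 * (M + 1)^2 + B)))"
  have B: "B > 0" using \<kappa> zero_le_power2[of "M + 1"] unfolding B_def by linarith
  have C6: "C6 > 0" unfolding C6_def using L1 M B by (intro mult_pos_pos add_pos_pos) (auto simp: add_nonneg_pos)
  define C where "C = 50 + (600 + 1000) + C6 + (C1 + C2 + C3 + C4 + C5)"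
  show ?thesis
  \<comment> \<open>\<open>Q \<ge> 9\<close> yields \<open>8 * Q * \<delta> < 1\<close> and
    \<open>72 * \<delta> < 1\<close>: the former serves the quadratics, the latter the distance to
    the nearest root and the exclusion of prime constants.\<close>
  proof (rule that[of C "15 * L" "max 9 (max Q4 Q5)"])
    show "C > 0" using C1 C2 C3 C4 C5 C6 by (simp add: C_def)
    show "15 * L > 0" using L1 by simp
    fix Q \<delta> :: real assume Q1: "Q \<ge> 1" and "Q \<ge> max 9 (max Q4 Q5)" and \<delta>: "0 < \<delta>" "\<delta> \<le> Q powr (- 27 / 10)"
    then have Q: "Q \<ge> 9" "Q \<ge> Q4" "Q \<ge> Q5" by auto
    define T where "T = Q powr (- 2 * lam / 3)"
    define W where "W = Q powr (4 - 2 * lam / 3)"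
    \<comment> \<open>Every exponent from 3 / 10 to 7 / 20 keeps both \<open>Q^3 * R^2\<close> and
      \<open>Q^4 / R\<close> at most \<open>Q powr (37 / 10)\<close>.\<close>
    define R where "R = Q powr (3 / 10)"
    define X1 where "X1 = {x::real. \<exists>c d::int. c \<noteq> 0 \<and> coeff_le Q c \<and> coeff_le Q d \<and> \<bar>c * x + d\<bar> \<le> \<delta>}"
    define X2 where "X2 = {x::real. \<exists>b c d::int. b \<noteq> 0 \<and> coeff_le Q b \<and> coeff_le Q c \<and> coeff_le Q d
        \<and> c^2 - 4 * b * d \<noteq> 0 \<and> \<bar>b * x^2 + c * x + d\<bar> \<le> \<delta>}"
    define X3 where "X3 = {x::real. \<exists>a b c d \<alpha>. (a, b, c, d, \<alpha>) \<in> simple_roots (16 * \<kappa>) M Q T \<and> \<bar>taylor1 a b c \<alpha>\<bar> * \<bar>x - \<alpha>\<bar> \<le> 4 * \<delta>}"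
    have LQ: "Q \<le> L * Q^2"
    proof -
      have "Q * 1 \<le> Q * (L * Q)" using L1 Q1 mult_mono[of 1 L 1 Q] by (intro mult_left_mono) auto
      then show ?thesis by (simp add: power2_eq_square ac_simps)
    qed
    have d2: "\<delta> \<le> 1 / Q^2"
    proof -
      have "Q powr (- 27 / 10) \<le> Q powr (- 2)" using Q1 by (intro powr_mono) auto
      also have "\<dots> = 1 / Q^2" using Q1 by (simp add: powr_minus_divide powr_numeral)
      finally show ?thesis using \<delta>(2) by linarith
    qed
    have dQ: "8 * Q * \<delta> < 1"
    proof -
      have "8 * Q * \<delta> \<le> 8 * Q * (1 / Q^2)" using d2 Q1 by (intro mult_left_mono) auto
      also have "\<dots> = 8 / Q" using Q1 by (simp add: power2_eq_square)
      also have "\<dots> < 1" using Q by simp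
      finally show ?thesis .
    qed
    have d72: "72 * \<delta> < 1"
    proof -
      have "8 * 9 * \<delta> \<le> 8 * Q * \<delta>" using Q \<delta> by (intro mult_right_mono) auto
      then show ?thesis using dQ by simp
    qed
    have T: "0 < T" "T \<le> 1" "1 \<le> Q * T^2"
    proof -
      show "0 < T" using Q1 by (simp add: T_def)
      have "T \<le> Q powr 0" unfolding T_def using Q1 lam by (intro powr_mono) auto
      then show "T \<le> 1" using Q1 by simp
      have "Q powr 0 \<le> Q powr (1 + - 2 * lam / 3 + - 2 * lam / 3)" using Q1 lam by (intro powr_mono) auto
      also have "\<dots> = Q * T^2" unfolding T_def powr_add using Q1 by (simp add: power2_eq_square)
      finally show "1 \<le> Q * T^2" using Q1 by simp
    qed
    have Q4T: "Q^4 * T = W"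
    proof -
      have "W = Q powr (4 + - 2 * lam / 3)" by (simp add: W_def)
      also have "\<dots> = Q^4 * T" unfolding powr_add T_def using Q1 by (simp add: powr_numeral)
      finally show ?thesis by simp
    qed
    have W37: "Q powr (37 / 10) \<le> W" unfolding W_def using Q1 lam by (intro powr_mono) auto
    have c1: "coverable (\<delta> / Q) (15 * L * Q^2) (50 * W) X1"
    proof (rule coverable_mono[OF _ order_refl])
      show "coverable (\<delta> / Q) (15 * L * Q^2) (50 * Q^3) X1" unfolding X1_def using LQ Q1 \<delta> by (intro linear_cover) auto
      have "Q^3 = Q powr 3" using Q1 by (simp add: powr_numeral)
      also have "\<dots> \<le> W" unfolding W_def using Q1 lam by (intro powr_mono) auto
      finally show "50 * Q^3 \<le> 50 * W" by simp
    qed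
    have R: "1 \<le> R" "R \<le> Q"
      using Q1 powr_mono[of "3/10" 1 Q] by (simp_all add: R_def ge_one_powr_ge_zero)
    have c2: "coverable (\<delta> / Q) (15 * L * Q^2) ((600 + 1000) * W) X2"
    proof (rule coverable_mono[OF _ order_refl])
      show "coverable (\<delta> / Q) (15 * L * Q^2) (600 * Q^3 * R^2 + 1000 * Q^4 / R) X2"
        unfolding X2_def using LQ Q1 \<delta> R dQ by (intro quadratic_cover) auto
      have "Q^3 * R^2 = Q powr (3 + 3/10 + 3/10)" unfolding R_def powr_add using Q1 by (simp add: powr_numeral power2_eq_square)
      also have "\<dots> \<le> W" unfolding W_def using Q1 lam by (intro powr_mono) auto
      finally have 1: "Q^3 * R^2 \<le> W" .
      have "Q^4 / R = Q powr (4 - 3/10)" unfolding R_def powr_diff using Q1 by (simp add: powr_numeral)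
      also have "\<dots> \<le> W" unfolding W_def using Q1 lam by (intro powr_mono) auto
      finally have "Q^4 / R \<le> W" .
      with 1 show "600 * Q^3 * R^2 + 1000 * Q^4 / R \<le> (600 + 1000) * W" by simp
    qed
    have c3: "coverable (\<delta> / Q) (15 * L * Q^2) (C6 * W) X3"
    proof (rule coverable_mono[OF _ order_refl])
      show "coverable (\<delta> / Q) (15 * L * Q^2) (5 * L * Q * (\<Sum>(a, b, c, d, \<alpha>)\<in>simple_roots (16 * \<kappa>) M Q T. 1 / \<bar>taylor1 a b c \<alpha>\<bar>)) X3"
        unfolding X3_def using LQ Q1 by (intro simple_roots_cover[OF M Q1 \<delta>(1) LM]) auto
      have "5 * L * Q * (\<Sum>(a, b, c, d, \<alpha>)\<in>simple_roots (16 * \<kappa>) M Q T. 1 / \<bar>taylor1 a b c \<alpha>\<bar>)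
         \<le> 5 * L * Q * (8 * (M + 1) * (150 * B + 54 * B * (48 * (M + 1)^2 + B)) * (Q^3 * T))"
        using sum_simple_roots[OF M Q1 T, of "16 * \<kappa>"] \<kappa> L1 Q1 unfolding B_def by (intro mult_left_mono) auto
      also have "\<dots> = C6 * (Q^4 * T)" by (simp add: C6_def eval_nat_numeral)
      finally show "5 * L * Q * (\<Sum>(a, b, c, d, \<alpha>)\<in>simple_roots (16 * \<kappa>) M Q T. 1 / \<bar>taylor1 a b c \<alpha>\<bar>) \<le> C6 * W"
        unfolding Q4T .
    qed
    have up: "coverable (\<delta> / Q) (15 * L * Q^2) (C' * W) Z" if "coverable (\<delta> / Q) (15 * L * Q^2) (C' * Q powr (37 / 10)) Z" "C' > 0" for C' Z
      using that W37 by (intro coverable_mono[OF that(1)]) auto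
    define ZZ where "ZZ = X1 \<union> X2 \<union> X3 \<union> (Y Q \<delta> (1/2) (7/10) \<union> Y Q \<delta> (7/10) (24/25) \<union> Y Q \<delta> (24/25) (13/10) \<union> Y Q \<delta> (13/10) (3/2) \<union> Y Q \<delta> (3/2) 2)"
    have "coverable (\<delta> / Q) (15 * L * Q^2) (50 * W + (600 + 1000) * W + C6 * W + (C1 * W + C2 * W + C3 * W + C4 * W + C5 * W)) ZZ"
      unfolding ZZ_def
      by (intro coverable_Un c1 c2 c3 up[OF C1(2) C1(1)] up[OF C2(2) C2(1)] up[OF C3(2) C3(1)] up[OF C4(2) C4(1)] up[OF C5(2) C5(1)] Q1 Q \<delta>)
    also have "50 * W + (600 + 1000) * W + C6 * W + (C1 * W + C2 * W + C3 * W + C4 * W + C5 * W) = C * W"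
      by (simp add: C_def algebra_simps)
    finally have cov: "coverable (\<delta> / Q) (15 * L * Q^2) (C * Q powr (4 - 2 * lam / 3)) ZZ" by (simp add: W_def)
    have sqrtQ: "2 * L * sqrt Q = 2 * L * Q powr (1 - 1/2)" using Q1 by (simp add: powr_half_sqrt)
    have cubic: "x \<in> ZZ" if x: "\<bar>x\<bar> \<le> N" and irr: "irr3 a b c d" and b: "coeff_le Q a" "coeff_le Q b"
         "coeff_le Q c" "coeff_le Q d" and v: "\<bar>taylor0 a b c d x\<bar> \<le> \<delta>"
         and D: "\<bar>real_of_int (disc3 a b c d)\<bar> \<le> 16 * \<kappa> * Q^4 * T^3" for x a b c d
    proof -
      have "\<bar>taylor0 a b c d x\<bar> < 1" using v d72 \<delta> by linarith
      then obtain \<alpha> :: complex where \<alpha>: "taylor0 a b c d \<alpha> = 0" "cmod (x - \<alpha>) \<le> 1" "cmod (taylor1 a b c \<alpha>) * cmod (x - \<alpha>) \<le> 4 * \<bar>taylor0 a b c d x\<bar>"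
        by (rule nearest_root[OF irr])
      define p where "p = cmod (taylor1 a b c \<alpha>)"
      have p4: "p * cmod (x - \<alpha>) \<le> 4 * \<delta>" using \<alpha>(3) v by (simp add: p_def)
      have nM: "norm \<alpha> \<le> N + 1"
        using x \<alpha>(2) norm_triangle_ineq4[of "complex_of_real x" "complex_of_real x - \<alpha>"] by simp
      have N2: "N + 2 \<ge> 1" "norm \<alpha> \<le> N + 2" using N nM by auto
      have Q0: "Q > 0" using Q1 by simp
      show ?thesis
      \<comment> \<open>Above the threshold the nearest root is real and hence belongs to
        \<open>simple_roots\<close>; below it the point falls into one of the five strips.\<close>
      proof (cases "p \<ge> 2 * L * sqrt Q")
        case True
        have sQ: "sqrt Q \<ge> 1" using Q1 by simp
        have "2 * 1 * 1 \<le> 2 * L * sqrt Q" using L1 sQ by (intro mult_mono) auto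
        then have p2: "p \<ge> 2" using True by linarith
        have pp: "4 * (L * Q) \<le> p * p"
        proof -
          have "4 * (1 * (L * Q)) \<le> 4 * (L * (L * Q))" using L1 Q1 by (intro mult_left_mono mult_right_mono) auto
          also have "\<dots> = (2 * L * sqrt Q) * (2 * L * sqrt Q)" using Q1 by simp
          also have "\<dots> \<le> p * p" using True L1 sQ p2 by (intro mult_mono) auto
          finally show ?thesis by simp
        qed
        define \<epsilon> where "\<epsilon> = 4 * \<delta> / p"
        have e1: "\<epsilon> \<le> 1" using p2 d72 by (simp add: \<epsilon>_def pos_divide_le_eq)
        have "cmod (x - \<alpha>) \<le> \<epsilon>" using p4 p2 by (simp add: \<epsilon>_def pos_le_divide_eq mult.commute)
        moreover have "\<bar>Im (complex_of_real x - \<alpha>)\<bar> \<le> cmod (x - \<alpha>)" by (rule abs_Im_le_cmod)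
        ultimately have im: "\<bar>Im \<alpha>\<bar> \<le> \<epsilon>" by simp
        have "6 * (L * Q) * \<epsilon> < p"
        proof -
          have "6 * (L * Q) * \<epsilon> * p = 24 * (L * Q) * \<delta>" using p2 by (simp add: \<epsilon>_def)
          also have "\<dots> = (L * Q) * (24 * \<delta>)" by simp
          also have "\<dots> < (L * Q) * 4" using d72 L1 Q1 by (intro mult_strict_left_mono) auto
          also have "\<dots> \<le> p * p" using pp by simp
          finally show ?thesis using p2 by simp
        qed
        then have "Im \<alpha> = 0"
          using large_derivative_real_root[OF \<alpha>(1) N2 Q0 b(1-3) im e1] by (simp add: p_def L_def)
        then obtain r where r: "\<alpha> = complex_of_real r" by (metis complex_is_Real_iff Reals_cases)
        have s: "taylor0 a b c d r = 0" using \<alpha>(1) by (simp add: r taylor_of_real)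
        have ps: "p = \<bar>taylor1 a b c r\<bar>" by (simp add: p_def r taylor_of_real)
        have "(a, b, c, d, r) \<in> simple_roots (16 * \<kappa>) M Q T"
          using b D s nM True irr by (auto simp: simple_roots_def ps r M_def irr3_def L_def algebra_simps)
        moreover have "\<bar>taylor1 a b c r\<bar> * \<bar>x - r\<bar> \<le> 4 * \<delta>"
          using p4 unfolding ps r by (metis norm_of_real of_real_diff real_norm_def)
        ultimately show ?thesis unfolding ZZ_def X3_def by blast
      next
        case False
        then have pl: "p \<le> 2 * L * Q powr (1 - 1/2)" using sqrtQ by linarith
        have inY: "x \<in> Y Q \<delta> \<tau> \<tau>'" if "Q powr (1 - \<tau>') / (3 * L) \<le> p" "p \<le> 2 * L * Q powr (1 - \<tau>)" for \<tau> \<tau>'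
          unfolding Y_def near_root_set_def using x irr b v \<alpha>(1,2) p4 that unfolding p_def by blast
        \<comment> \<open>Consecutive strips overlap: a derivative below the lower end of one strip
          is below the upper end of the next, since \<open>1 / (3 * L) \<le> 2 * L\<close>.\<close>
        have step: "p \<le> 2 * L * Q powr (1 - \<tau>)" if "\<not> Q powr (1 - \<tau>) / (3 * L) \<le> p" for \<tau>
        proof -
          have "Q powr (1 - \<tau>) / (3 * L) \<le> Q powr (1 - \<tau>) / 1" using L1 by (intro divide_left_mono) auto
          also have "\<dots> = 1 * Q powr (1 - \<tau>)" by simp
          also have "\<dots> \<le> 2 * L * Q powr (1 - \<tau>)" using L1 by (intro mult_right_mono) auto
          finally show ?thesis using that by simp
        qed
        have last: "Q powr (1 - 2) / (3 * L) \<le> p"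
        proof -
          have "1 \<le> 3 * (L * Q) * p" using derivative_lower_bound[OF irr \<alpha>(1) N2 Q0 b(1-3)] by (simp add: p_def L_def)
          then have "1 / Q / (3 * L) \<le> p" using L1 Q1 by (simp add: field_simps)
          moreover have "Q powr (1 - 2) = 1 / Q" using Q1 powr_minus_divide[of Q 1] by simp
          ultimately show ?thesis by simp
        qed
        consider "Q powr (1 - 7/10) / (3 * L) \<le> p" | "\<not> Q powr (1 - 7/10) / (3 * L) \<le> p" "Q powr (1 - 24/25) / (3 * L) \<le> p"
          | "\<not> Q powr (1 - 24/25) / (3 * L) \<le> p" "Q powr (1 - 13/10) / (3 * L) \<le> p"
          | "\<not> Q powr (1 - 13/10) / (3 * L) \<le> p" "Q powr (1 - 3/2) / (3 * L) \<le> p" | "\<not> Q powr (1 - 3/2) / (3 * L) \<le> p" by blast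
        then show ?thesis
        proof cases
          case 1 show ?thesis using inY[OF 1 pl] unfolding ZZ_def by blast
        next
          case 2 show ?thesis using inY[OF 2(2) step[OF 2(1)]] unfolding ZZ_def by blast
        next
          case 3 show ?thesis using inY[OF 3(2) step[OF 3(1)]] unfolding ZZ_def by blast
        next
          case 4 show ?thesis using inY[OF 4(2) step[OF 4(1)]] unfolding ZZ_def by blast
        next
          case 5 show ?thesis using inY[OF last step[OF 5]] unfolding ZZ_def by blast
        qed
      qed
    qed
    show "coverable (\<delta> / Q) (15 * L * Q^2) (C * Q powr (4 - 2 * lam / 3))
      {x. \<bar>x\<bar> \<le> N \<and> (\<exists>P\<in>P3_star \<kappa> lam. Q \<le> real_of_int (poly_height P) \<and> real_of_int (poly_height P) < 2 * Q
         \<and> \<bar>poly (of_int_poly P) x\<bar> \<le> \<delta>)}"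
    proof (rule coverable_mono[OF cov _ order_refl], rule subsetI)
      fix x assume "x \<in> {x. \<bar>x\<bar> \<le> N \<and> (\<exists>P\<in>P3_star \<kappa> lam. Q \<le> real_of_int (poly_height P) \<and> real_of_int (poly_height P) < 2 * Q
         \<and> \<bar>poly (of_int_poly P) x\<bar> \<le> \<delta>)}"
      then obtain P where x: "\<bar>x\<bar> \<le> N" and P: "P \<in> P3_star \<kappa> lam" "Q \<le> real_of_int (poly_height P)" "real_of_int (poly_height P) < 2 * Q"
         "\<bar>poly (of_int_poly P) x\<bar> \<le> \<delta>" by blast
      define a b c d where abcd: "a = coeff P 3" "b = coeff P 2" "c = coeff P 1" "d = coeff P 0"
      have irrP: "Factorial_Ring.irreducible P" "degree P \<le> 3"
        and disc: "real_of_int \<bar>poly_discriminant P\<bar> \<le> \<kappa> * real_of_int (poly_height P) powr (2 * (2 - lam))"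
        using P(1) by (auto simp: P3_star_def)
      have Pf: "P = [:d, c, b, a:]" using int_poly_cubic_form[OF irrP(2)] by (simp add: abcd)
      have cb: "\<bar>real_of_int (coeff P i)\<bar> \<le> 2 * Q" for i
        using coeff_le_height[of P i] P(3) by linarith
      have b: "coeff_le Q a" "coeff_le Q b" "coeff_le Q c" "coeff_le Q d"
        using cb by (simp_all add: abcd)
      have v: "\<bar>taylor0 a b c d x\<bar> \<le> \<delta>" using P(4) unfolding Pf poly_eq_taylor0 .
      show "x \<in> ZZ"
      proof (cases "a = 0")
        case False
        then have irr: "irr3 a b c d" using irrP by (simp add: irr3_def Pf)
        have "poly_discriminant P = disc3 a b c d" using poly_discriminant_cubic[OF False] by (simp add: Pf disc3_def)
        then have "\<bar>real_of_int (disc3 a b c d)\<bar> \<le> \<kappa> * real_of_int (poly_height P) powr (2 * (2 - lam))" using disc by simp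
        \<comment> \<open>Heights in the block are below \<open>2 * Q\<close>; this costs a factor
          of at most \<open>2 powr 4\<close> and explains the constant
          \<open>16 * \<kappa>\<close>.\<close>
        also have "\<dots> \<le> \<kappa> * (2 * Q) powr (2 * (2 - lam))" using \<kappa> P Q1 lam by (intro mult_left_mono powr_mono2) auto
        also have "(2 * Q) powr (2 * (2 - lam)) = 2 powr (2 * (2 - lam)) * Q powr (2 * (2 - lam))" using Q1 by (simp add: powr_mult)
        also have "\<kappa> * \<dots> \<le> \<kappa> * (2 powr 4 * Q powr (2 * (2 - lam)))"
          using \<kappa> lam by (intro mult_left_mono mult_right_mono powr_mono) auto
        also have "Q powr (2 * (2 - lam)) = Q powr (4 + - 2 * lam / 3 + - 2 * lam / 3 + - 2 * lam / 3)" by simp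
        also have "\<dots> = Q^4 * T^3" unfolding powr_add T_def using Q1 by (simp add: powr_numeral power3_eq_cube)
        finally have "\<bar>real_of_int (disc3 a b c d)\<bar> \<le> 16 * \<kappa> * Q^4 * T^3" by simp
        then show ?thesis by (rule cubic[OF x irr b v])
      next
        case a: True
        show ?thesis
        proof (cases "b = 0")
          case False
          have "Factorial_Ring.irreducible [:d, c, b:]" using irrP(1) by (simp add: Pf a)
          then have "c^2 - 4 * b * d \<noteq> 0" by (rule quadratic_disc_nonzero) (rule False)
          moreover have "\<bar>b * x^2 + c * x + d\<bar> \<le> \<delta>" using v by (simp add: taylor0_def a algebra_simps)
          ultimately have "x \<in> X2" unfolding X2_def using False b by blast
          then show ?thesis by (simp add: ZZ_def)
        next
          case b0: True
          show ?thesis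
          proof (cases "c = 0")
            case False
            have "\<bar>c * x + d\<bar> \<le> \<delta>" using v by (simp add: taylor0_def a b0 algebra_simps)
            then have "x \<in> X1" unfolding X1_def using False b by blast
            then show ?thesis by (simp add: ZZ_def)
          next
            case True
            \<comment> \<open>\<open>P\<close> is constant here, and an irreducible constant is
              nonzero, so it cannot be smaller than 1 in absolute value.\<close>
            have "\<bar>real_of_int d\<bar> < 1" using v d72 \<delta> by (simp add: taylor0_def a b0 True)
            then have "d = 0" by linarith
            then show ?thesis using irrP(1) by (simp add: Pf a b0 True)
          qed
        qed
      qed
    qed
  qed
qed

section \<open>Hausdorff measure of the limsup set\<close>

text \<open>The g-sum is bounded on finite subfamilies, which avoids questions of summability; as
  the balls form a set, a repeated ball counts once.\<close>

definition thin_balls :: "(real \<Rightarrow> real) \<Rightarrow> real \<Rightarrow> real \<Rightarrow> (real \<times> real) set \<Rightarrow> bool" where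
  "thin_balls g \<rho> e S \<longleftrightarrow> countable S \<and> (\<forall>(c, r)\<in>S. 0 < r \<and> r \<le> \<rho>) \<and> (\<forall>T\<subseteq>S. finite T \<longrightarrow> (\<Sum>(c, r)\<in>T. g r) \<le> e)"

lemma sum_UN_le:
  fixes f :: "'a \<Rightarrow> real" and m :: nat
  assumes "\<And>n. n < m \<Longrightarrow> finite (A n)" "\<And>x n. n < m \<Longrightarrow> x \<in> A n \<Longrightarrow> f x \<ge> 0"
  shows "sum f (\<Union>n<m. A n) \<le> (\<Sum>n<m. sum f (A n))"
  using assms
proof (induction m)
  case (Suc m)
  have "sum f ((\<Union>n<m. A n) \<inter> A m) \<ge> 0" using Suc.prems by (intro sum_nonneg) auto
  moreover have "sum f ((\<Union>n<m. A n) \<union> A m) + sum f ((\<Union>n<m. A n) \<inter> A m) = sum f (\<Union>n<m. A n) + sum f (A m)"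
    using Suc.prems by (intro sum.union_inter) auto
  moreover have "sum f (\<Union>n<m. A n) \<le> (\<Sum>n<m. sum f (A n))" 
  proof (rule Suc.IH)
    fix n assume "n < m"
    then show "finite (A n)" by (intro Suc.prems(1)) simp
    fix x assume "x \<in> A n"
    with \<open>n < m\<close> show "f x \<ge> 0" by (intro Suc.prems(2)[of n]) simp_all
  qed
  moreover have "(\<Union>n<Suc m. A n) = (\<Union>n<m. A n) \<union> A m" by (auto simp: less_Suc_eq)
  ultimately show ?case by simp
qed simp

text \<open>A finite subfamily of the union already lies in the union of finitely many of the
  families.\<close>

lemma thin_balls_UN:
  assumes S: "\<And>n::nat. thin_balls g \<rho> (e n) (S n)" and E: "\<And>m. (\<Sum>n<m. e n) \<le> E" and g: "\<And>r. r > 0 \<Longrightarrow> g r \<ge> 0"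
  shows "thin_balls g \<rho> E (\<Union>n. S n)"
  unfolding thin_balls_def
proof (intro conjI allI impI)
  show "countable (\<Union>n. S n)" using S by (auto simp: thin_balls_def)
  show "\<forall>(c, r)\<in>(\<Union>n. S n). 0 < r \<and> r \<le> \<rho>" using S unfolding thin_balls_def by blast
  fix T assume T: "T \<subseteq> (\<Union>n. S n)" "finite T"
  then have "\<forall>x\<in>T. \<exists>n. x \<in> S n" by blast
  then obtain f where f: "\<forall>x\<in>T. x \<in> S (f x)" by (rule bchoice[THEN exE])
  define m where "m = Suc (Max (insert 0 (f ` T)))"
  have fm: "f x < m" if "x \<in> T" for x
    unfolding m_def using T(2) that by (intro le_imp_less_Suc Max_ge) auto
  have "T = (\<Union>n<m. T \<inter> S n)" using f fm by blast
  then have "(\<Sum>(c, r)\<in>T. g r) = (\<Sum>(c, r)\<in>(\<Union>n<m. T \<inter> S n). g r)" by simp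
  also have "\<dots> \<le> (\<Sum>n<m. (\<Sum>(c, r)\<in>T \<inter> S n. g r))"
  proof (rule sum_UN_le)
    show "finite (T \<inter> S n)" for n using T by simp
    fix x n assume "x \<in> T \<inter> S n"
    with S[of n] g show "0 \<le> (case x of (c, r) \<Rightarrow> g r)" by (auto simp: thin_balls_def)
  qed
  also have "\<dots> \<le> (\<Sum>n<m. e n)"
    using S T(2) by (intro sum_mono) (auto simp: thin_balls_def)
  also have "\<dots> \<le> E" by (rule E)
  finally show "(\<Sum>(c, r)\<in>T. g r) \<le> E" .
qed

text \<open>\<open>to_nat_on\<close> reindexes the balls by a set of natural numbers, the form of
  covers in the premeasure.\<close>

lemma hausdorff_premeasure_le:
  assumes S: "thin_balls g \<rho> e S" and X: "X \<subseteq> (\<Union>(c, r)\<in>S. ball c r)" and g: "\<And>r. r > 0 \<Longrightarrow> g r \<ge> 0"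
  shows "hausdorff_premeasure g \<rho> X \<le> ennreal e"
proof -
  have cnt: "countable S" using S by (simp add: thin_balls_def)
  define I where "I = to_nat_on S ` S"
  define c where "c i = fst (from_nat_into S i)" for i
  define r where "r i = snd (from_nat_into S i)" for i
  have inv: "from_nat_into S (to_nat_on S x) = x" if "x \<in> S" for x using cnt that by simp
  have IS: "from_nat_into S i \<in> S" if "i \<in> I" for i using that inv by (auto simp: I_def)
  have "0 < r i \<and> r i \<le> \<rho>" if "i \<in> I" for i
    using IS[OF that] S unfolding thin_balls_def r_def by (cases "from_nat_into S i") auto
  moreover have "X \<subseteq> (\<Union>i\<in>I. ball (c i) (r i))"
  proof
    fix x assume "x \<in> X"
    then have "x \<in> (\<Union>(c, r)\<in>S. ball c r)" using X by blast
    then obtain p where "p \<in> S" "x \<in> ball (fst p) (snd p)" by auto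
    then show "x \<in> (\<Union>i\<in>I. ball (c i) (r i))" unfolding I_def c_def r_def using inv by (intro UN_I[of "to_nat_on S p"]) auto
  qed
  ultimately have "hausdorff_premeasure g \<rho> X \<le> (\<Sum>\<^sub>\<infinity>i\<in>I. ennreal (g (r i)))"
    unfolding hausdorff_premeasure_def by (intro Inf_lower) blast
  also have "\<dots> \<le> ennreal e"
  proof (rule infsum_le_finite_sums)
    show "(\<lambda>i. ennreal (g (r i))) summable_on I" by (rule nonneg_summable_on_complete) simp
    fix F assume F: "finite F" "F \<subseteq> I"
    have inj: "inj_on (from_nat_into S) F"
      using F(2) inv by (intro inj_on_inverseI[where g = "to_nat_on S"]) (auto simp: I_def)
    have "(\<Sum>i\<in>F. ennreal (g (r i))) = ennreal (\<Sum>i\<in>F. g (r i))"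
      by (rule sum_ennreal) (use F \<open>\<And>i. i \<in> I \<Longrightarrow> 0 < r i \<and> r i \<le> \<rho>\<close> g in blast)
    also have "(\<Sum>i\<in>F. g (r i)) = (\<Sum>(c, r)\<in>from_nat_into S ` F. g r)"
      using inj by (simp add: sum.reindex r_def case_prod_unfold)
    also have "ennreal \<dots> \<le> ennreal e"
    proof (rule ennreal_leI)
      have "from_nat_into S ` F \<subseteq> S" using F IS by auto
      with F(1) show "(\<Sum>(c, r)\<in>from_nat_into S ` F. g r) \<le> e" using S by (simp add: thin_balls_def)
    qed
    finally show "(\<Sum>i\<in>F. ennreal (g (r i))) \<le> ennreal e" .
  qed
  finally show ?thesis .
qed

text \<open>Countable subadditivity at each scale \<rho>, with the share e / 2^(n + 1) for
  \<open>A n\<close>. It allows a limsup set on the line to be cut into bounded pieces, for which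
  the constants of a block depend only on the piece.\<close>

lemma hausdorff_measure_null:
  assumes g: "\<And>r. r > 0 \<Longrightarrow> g r \<ge> 0"
    and thin: "\<And>n e \<rho>. e > 0 \<Longrightarrow> \<rho> > 0 \<Longrightarrow> \<exists>S. thin_balls g \<rho> e S \<and> A n \<subseteq> (\<Union>(c, r)\<in>S. ball c r)"
    and X: "X \<subseteq> (\<Union>n::nat. A n)"
  shows "hausdorff_measure g X = 0"
proof -
  have "hausdorff_premeasure g \<rho> X \<le> 0" if \<rho>: "\<rho> > 0" for \<rho>
  proof (rule ennreal_le_epsilon)
    fix e :: real assume e: "0 < e"
    have "\<exists>S. thin_balls g \<rho> (e * (1 / 2) ^ Suc n) S \<and> A n \<subseteq> (\<Union>(c, r)\<in>S. ball c r)" for n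
      by (rule thin) (use e \<rho> in auto)
    then have "\<forall>n. \<exists>S. thin_balls g \<rho> (e * (1 / 2) ^ Suc n) S \<and> A n \<subseteq> (\<Union>(c, r)\<in>S. ball c r)" by blast
    then obtain S where "\<forall>n. thin_balls g \<rho> (e * (1 / 2) ^ Suc n) (S n) \<and> A n \<subseteq> (\<Union>(c, r)\<in>S n. ball c r)"
      by (rule choice[THEN exE])
    then have S: "thin_balls g \<rho> (e * (1 / 2) ^ Suc n) (S n)" "A n \<subseteq> (\<Union>(c, r)\<in>S n. ball c r)" for n by blast+
    have "(\<Sum>n<m. e * (1 / 2) ^ Suc n) \<le> e" for m
    proof -
      have "(\<Sum>n<m. e * (1 / 2) ^ Suc n) = e * (1 - (1 / 2) ^ m)"
        by (induction m) (simp_all add: algebra_simps)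
      also have "\<dots> \<le> e" using e by (simp add: algebra_simps)
      finally show ?thesis .
    qed
    then have "thin_balls g \<rho> e (\<Union>n. S n)" by (intro thin_balls_UN[OF S(1) _ g]) auto
    moreover have "X \<subseteq> (\<Union>(c, r)\<in>(\<Union>n. S n). ball c r)"
    proof
      fix x assume "x \<in> X"
      then obtain n where "x \<in> A n" using X by blast
      then have "x \<in> (\<Union>(c, r)\<in>S n. ball c r)" using S(2) by blast
      then show "x \<in> (\<Union>(c, r)\<in>(\<Union>n. S n). ball c r)" by blast
    qed
    ultimately show "hausdorff_premeasure g \<rho> X \<le> 0 + ennreal e"
      using hausdorff_premeasure_le g by simp
  qed
  then have "(SUP \<rho>\<in>{0<..}. hausdorff_premeasure g \<rho> X) \<le> 0" by (intro SUP_least) simp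
  then show ?thesis unfolding hausdorff_measure_eq_SUP by simp
qed

lemma coverable_imp_thin_balls:
  assumes cov: "coverable r m w X" and r: "r > 0" "m * r \<le> \<rho>"
    and g: "\<And>r. r > 0 \<Longrightarrow> g r \<ge> 0" "\<And>s. s \<ge> 1 \<Longrightarrow> g (s * r) \<le> s * g r"
  obtains S where "thin_balls g \<rho> (w * g r) S" "X \<subseteq> (\<Union>(c, r)\<in>S. ball c r)"
proof -
  obtain F where F: "finite F" "\<forall>(c, s)\<in>F. 1 \<le> s \<and> s \<le> m" "X \<subseteq> (\<Union>(c, s)\<in>F. ball c (s * r))" "(\<Sum>(c, s)\<in>F. s) \<le> w"
    using cov unfolding coverable_def by blast
  define f where "f = (\<lambda>(c::real, s). (c, s * r))"
  have inj: "inj_on f F" using r(1) by (auto simp: f_def inj_on_def)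
  show ?thesis
  proof (rule that[of "f ` F"])
    show "thin_balls g \<rho> (w * g r) (f ` F)"
      unfolding thin_balls_def
    proof (intro conjI allI impI)
      show "countable (f ` F)" using F(1) by (simp add: countable_finite)
      show pr: "\<forall>(c, u)\<in>f ` F. 0 < u \<and> u \<le> \<rho>"
      proof
        fix z assume "z \<in> f ` F"
        then obtain c s where s: "(c, s) \<in> F" "z = (c, s * r)" by (auto simp: f_def)
        then have "1 \<le> s" "s \<le> m" using F(2) by auto
        then have "s * r \<le> m * r" "0 < s * r" using r by (auto intro: mult_right_mono)
        then show "case z of (c, u) \<Rightarrow> 0 < u \<and> u \<le> \<rho>" unfolding s(2) prod.case using r(2) by linarith
      qed
      fix T assume T: "T \<subseteq> f ` F" "finite T"
      have "(\<Sum>(c, u)\<in>T. g u) \<le> (\<Sum>(c, u)\<in>f ` F. g u)"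
        by (rule sum_mono2) (use F T pr g(1) in auto)
      also have "\<dots> = (\<Sum>(c, s)\<in>F. g (s * r))"
        unfolding sum.reindex[OF inj] by (rule sum.cong) (auto simp: f_def)
      also have "\<dots> \<le> (\<Sum>(c, s)\<in>F. s * g r)"
        by (rule sum_mono) (use F(2) g(2) in auto)
      also have "\<dots> = (\<Sum>(c, s)\<in>F. s) * g r" by (simp add: sum_distrib_right case_prod_unfold)
      also have "\<dots> \<le> w * g r" using F(4) g(1) r(1) by (intro mult_right_mono) auto
      finally show "(\<Sum>(c, u)\<in>T. g u) \<le> w * g r" .
    qed
    show "X \<subseteq> (\<Union>(c, r)\<in>f ` F. ball c r)"
      using F(3) by (simp add: f_def case_prod_unfold image_image)
  qed
qed

section \<open>Condensation and dyadic heights\<close>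

text \<open>Cauchy condensation with a weight: for q in (2^k, 2^(k + 1)] a term is at least
  \<open>f (2 ^ Suc k) * (2 ^ k) powr p\<close>, and there are 2^k such q, whence the exponent
  \<open>p + 1\<close>.\<close>

lemma summable_condensed:
  fixes f v :: "nat \<Rightarrow> real" and p :: real
  assumes f: "\<And>q. q \<ge> 1 \<Longrightarrow> f q \<ge> 0" "\<And>q q'. 1 \<le> q \<Longrightarrow> q \<le> q' \<Longrightarrow> f q' \<le> f q" and p: "p \<ge> 0"
    and sum: "(\<lambda>q. f q * real q powr p) summable_on {1..}"
  shows "summable (\<lambda>k. (2 ^ k) powr (p + 1) * f (2 ^ k))"
proof -
  define w where "w q = f q * real q powr p" for q
  have w0: "w q \<ge> 0" if "q \<ge> 1" for q using f(1)[OF that] by (simp add: w_def)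
  have block: "(2 ^ Suc k) powr (p + 1) * f (2 ^ Suc k) \<le> 2 powr (p + 1) * sum w {2 ^ k<..2 ^ Suc k}" for k
  proof -
    have "(\<Sum>q\<in>{2 ^ k<..2 ^ Suc k :: nat}. f (2 ^ Suc k) * (2 ^ k) powr p) \<le> sum w {2 ^ k<..2 ^ Suc k}"
    proof (rule sum_mono)
      fix q :: nat assume q: "q \<in> {2 ^ k<..2 ^ Suc k}"
      have k1: "1 \<le> (2::nat) ^ k" by simp
      have "2 ^ k < q" using q by simp
      then have q1: "1 \<le> q" using k1 by linarith
      have "real (2 ^ k) \<le> real q" using q by (intro of_nat_mono) simp
      then have "(2 ^ k) powr p \<le> real q powr p" using p by (intro powr_mono2) auto
      moreover have "f (2 ^ Suc k) \<le> f q" using q q1 by (intro f(2)) auto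
      moreover have "0 \<le> f (2 ^ Suc k)" by (rule f(1)) simp
      ultimately show "f (2 ^ Suc k) * (2 ^ k) powr p \<le> w q" unfolding w_def by (intro mult_mono) (auto intro: f(1) q1)
    qed
    also have "(\<Sum>q\<in>{2 ^ k<..2 ^ Suc k :: nat}. f (2 ^ Suc k) * (2 ^ k) powr p) = 2 ^ k * (f (2 ^ Suc k) * (2 ^ k) powr p)"
      by simp
    finally have 1: "2 ^ k * (f (2 ^ Suc k) * (2 ^ k) powr p) \<le> sum w {2 ^ k<..2 ^ Suc k}" .
    have "(2 ^ Suc k :: real) powr (p + 1) = 2 powr (p + 1) * (2 ^ k) powr (p + 1)" by (simp add: powr_mult)
    also have "(2 ^ k :: real) powr (p + 1) = (2 ^ k) powr p * 2 ^ k" by (simp add: powr_add)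
    finally have "(2 ^ Suc k) powr (p + 1) * f (2 ^ Suc k) = 2 powr (p + 1) * (2 ^ k * (f (2 ^ Suc k) * (2 ^ k) powr p))" by simp
    also have "\<dots> \<le> 2 powr (p + 1) * sum w {2 ^ k<..2 ^ Suc k}" using 1 by (intro mult_left_mono) auto
    finally show ?thesis .
  qed
  have blocks: "(\<Sum>k<m. sum w {2 ^ k<..2 ^ Suc k}) = sum w {1<..2 ^ m}" for m
  proof (induction m)
    case (Suc m)
    have "{1<..2 ^ Suc m} = {1<..2 ^ m} \<union> {2 ^ m<..2 ^ Suc m :: nat}"
      by (subst ivl_disj_un) auto
    moreover have "sum w ({1<..2 ^ m} \<union> {2 ^ m<..2 ^ Suc m}) = sum w {1<..2 ^ m} + sum w {2 ^ m<..2 ^ Suc m}"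
      by (rule sum.union_disjoint) auto
    ultimately show ?case using Suc by simp
  qed simp
  have fin: "sum w {1<..2 ^ m} \<le> infsum w {1..}" for m
  proof (rule finite_sum_le_infsum)
    show "w summable_on {1..}" using sum by (simp only: w_def[abs_def])
  qed (use w0 in auto)
  have "summable (\<lambda>k. (2 ^ Suc k) powr (p + 1) * f (2 ^ Suc k))"
  proof (rule summableI_nonneg_bounded)
    show "0 \<le> (2 ^ Suc n) powr (p + 1) * f (2 ^ Suc n)" for n using f(1)[of "2 ^ Suc n"] by simp
    fix m
    have "(\<Sum>k<m. (2 ^ Suc k) powr (p + 1) * f (2 ^ Suc k)) \<le> (\<Sum>k<m. 2 powr (p + 1) * sum w {2 ^ k<..2 ^ Suc k})"
      by (rule sum_mono) (rule block)
    also have "\<dots> = 2 powr (p + 1) * sum w {1<..2 ^ m}" by (simp only: sum_distrib_left[symmetric] blocks)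
    also have "\<dots> \<le> 2 powr (p + 1) * infsum w {1..}" using fin by (intro mult_left_mono) auto
    finally show "(\<Sum>k<m. (2 ^ Suc k) powr (p + 1) * f (2 ^ Suc k)) \<le> 2 powr (p + 1) * infsum w {1..}" .
  qed
  then show ?thesis by (subst (asm) summable_Suc_iff)
qed

lemma finite_bounded_height: "finite {P :: int poly. degree P \<le> 3 \<and> poly_height P < B}"
proof (rule finite_subset)
  show "{P :: int poly. degree P \<le> 3 \<and> poly_height P < B} \<subseteq> (\<lambda>(a, b, c, d). [:a, b, c, d:]) ` ({-B..B} \<times> {-B..B} \<times> {-B..B} \<times> {-B..B})"
  proof
    fix P :: "int poly" assume P: "P \<in> {P. degree P \<le> 3 \<and> poly_height P < B}"
    have c: "coeff P i \<in> {-B..B}" for i using coeff_le_height[of P i] P by auto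
    have "P = (\<lambda>(a, b, c, d). [:a, b, c, d:]) (coeff P 0, coeff P 1, coeff P 2, coeff P 3)"
      using int_poly_cubic_form[of P] P by simp
    then show "P \<in> (\<lambda>(a, b, c, d). [:a, b, c, d:]) ` ({-B..B} \<times> {-B..B} \<times> {-B..B} \<times> {-B..B})"
      by (rule image_eqI) (use c in auto)
  qed
qed simp

lemma ex_dyadic_block:
  fixes h :: int
  assumes "h \<ge> 2 ^ k"
  obtains j where "j \<ge> k" "2 ^ j \<le> h" "h < 2 ^ Suc j"
proof -
  have bound: "i \<le> nat h" if "2 ^ i \<le> h" for i
  proof -
    have "int i < 2 ^ i" using of_nat_less_two_power[of i, where 'a = int] .
    then show ?thesis using that by linarith
  qed
  define j where "j = (GREATEST i. 2 ^ i \<le> h)"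
  have "2 ^ j \<le> h" unfolding j_def
    by (rule GreatestI_nat[where P = "\<lambda>i. 2 ^ i \<le> h", OF assms bound])
  moreover have le: "i \<le> j" if "2 ^ i \<le> h" for i unfolding j_def
    by (rule Greatest_le_nat[where P = "\<lambda>i. 2 ^ i \<le> h", OF that bound])
  then have "k \<le> j" using assms by blast
  moreover have "h < 2 ^ Suc j" using le[of "Suc j"] by (meson Suc_n_not_le_n not_less)
  ultimately show ?thesis using that by blast
qed

section \<open>The Cantelli argument for the limsup set\<close>

theorem theorem4:
  fixes \<kappa> lam :: real and \<psi> g :: "real \<Rightarrow> real"
  assumes "0 \<le> lam" and "lam < 9 / 20" and "\<kappa> > 0"
    and "approximation_function \<psi>"
    and "dimension_function g"
    and "antimono_on {0<..} (\<lambda>q. g q / q)"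
    and "filterlim (\<lambda>q. g q / q) at_top (at_right 0)"
    and "(\<lambda>q::nat. g (\<psi> (real q) / real q) * real q powr (3 - 2 * lam / 3)) summable_on {1..}"
  shows "hausdorff_measure g (A3_star \<kappa> lam \<psi>) = 0"
proof -
  define p where "p = 3 - 2 * lam / 3"
  \<comment> \<open>This is the decay exponent that every block estimate assumes of
    \<delta>.\<close>
  have p: "p \<ge> 27 / 10" using assms(2) by (simp add: p_def)
  have \<psi>: "\<psi> r > 0" if "r > 0" for r using assms(4) that by (simp add: approximation_function_def)
  have \<psi>_dec: "\<psi> s \<le> \<psi> r" if "0 < r" "r \<le> s" for r s
    using assms(4) that by (auto simp: approximation_function_def monotone_on_def)
  have g: "g r > 0" if "r > 0" for r using assms(5) that by (simp add: dimension_function_def)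
  have g_mono: "g r \<le> g s" if "0 < r" "r \<le> s" for r s
    using assms(5) that by (auto simp: dimension_function_def monotone_on_def)
  have g_scale: "g (s * r) \<le> s * g r" if "s \<ge> 1" "r > 0" for s r
  proof -
    have "r \<le> s * r" using that by simp
    then have "g (s * r) / (s * r) \<le> g r / r" using assms(6) that by (auto simp: monotone_on_def)
    then show ?thesis using that by (simp add: field_simps)
  qed
  define r where "r k = \<psi> (2 ^ k) / 2 ^ k" for k :: nat
  have r0: "r k > 0" for k using \<psi>[of "2 ^ k"] by (simp add: r_def)
  \<comment> \<open>The weight \<open>Q powr (4 - 2 * lam / 3)\<close> of a block cover times
    \<open>g\<close> at the unit radius, hence up to a constant the g-sum of block
    \<open>k\<close>.\<close>
  define u where "u k = (2 ^ k) powr (p + 1) * g (r k)" for k :: nat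
  have u0: "u k \<ge> 0" for k using g[OF r0] by (simp add: u_def less_imp_le)
  have "summable u"
  proof -
    have "summable (\<lambda>k. (2 ^ k) powr (p + 1) * g (\<psi> (real (2 ^ k)) / real (2 ^ k)))"
    proof (rule summable_condensed)
      show "(\<lambda>q. g (\<psi> (real q) / real q) * real q powr p) summable_on {1..}" using assms(8) by (simp add: p_def)
      show "0 \<le> g (\<psi> (real q) / real q)" if "1 \<le> q" for q
        using g[of "\<psi> (real q) / real q"] \<psi>[of "real q"] that by (simp add: less_imp_le)
      fix q q' :: nat assume q: "1 \<le> q" "q \<le> q'"
      have "\<psi> (real q') / real q' \<le> \<psi> (real q) / real q"
        using q \<psi>_dec[of "real q" "real q'"] \<psi>[of "real q"] by (intro frac_le) (auto simp: less_imp_le)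
      then show "g (\<psi> (real q') / real q') \<le> g (\<psi> (real q) / real q)"
        using q \<psi>[of "real q'"] by (intro g_mono) auto
    qed (use p in simp)
    moreover have "u = (\<lambda>k. (2 ^ k) powr (p + 1) * g (\<psi> (real (2 ^ k)) / real (2 ^ k)))"
      by (simp add: fun_eq_iff u_def r_def)
    ultimately show ?thesis by simp
  qed
  have rlim: "filterlim r (at_right 0) sequentially"
    unfolding filterlim_at
  proof
    show "\<forall>\<^sub>F k in sequentially. r k \<in> {0<..} \<and> r k \<noteq> 0" 
    proof (intro always_eventually allI)
      show "r k \<in> {0<..} \<and> r k \<noteq> 0" for k using r0[of k] by simp
    qed
    have "(\<lambda>k. \<psi> 1 * (1 / 2) ^ k) \<longlonglongrightarrow> \<psi> 1 * 0" by (intro tendsto_mult_left LIMSEQ_power_zero) simp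
    then have "(\<lambda>k. \<psi> 1 * (1 / 2) ^ k) \<longlonglongrightarrow> 0" by simp
    then show "r \<longlonglongrightarrow> 0"
    proof (rule tendsto_sandwich[OF _ _ tendsto_const, rotated 2])
      show "\<forall>\<^sub>F k in sequentially. 0 \<le> r k" using r0 by (simp add: less_imp_le)
      show "\<forall>\<^sub>F k in sequentially. r k \<le> \<psi> 1 * (1 / 2) ^ k"
      proof (rule always_eventually, rule allI)
        fix k
        have "\<psi> (2 ^ k) \<le> \<psi> 1" by (rule \<psi>_dec) auto
        then show "r k \<le> \<psi> 1 * (1 / 2) ^ k" by (simp add: r_def power_divide divide_right_mono)
      qed
    qed
  qed
  have \<psi>_small: "\<forall>\<^sub>F k in sequentially. \<psi> (2 ^ k) \<le> (2 ^ k) powr (- 27 / 10)"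
  proof -
    have "\<forall>\<^sub>F x in at_right 0. 1 \<le> g x / x" using assms(7) by (auto simp: filterlim_at_top)
    then have 1: "\<forall>\<^sub>F k in sequentially. 1 \<le> g (r k) / r k" using rlim by (rule eventually_compose_filterlim)
    have 2: "\<forall>\<^sub>F k in sequentially. u k < 1"
      using order_tendstoD(2)[OF summable_LIMSEQ_zero[OF \<open>summable u\<close>]] by simp
    show ?thesis using 1 2
    proof eventually_elim
      case (elim k)
      define Q :: real where "Q = 2 ^ k"
      have Q: "Q \<ge> 1" by (simp add: Q_def)
      have "r k \<le> g (r k)" using elim(1) r0[of k] by (simp add: pos_le_divide_eq)
      then have "Q powr (p + 1) * r k \<le> Q powr (p + 1) * g (r k)" by (intro mult_left_mono) auto
      also have "\<dots> < 1" using elim(2) by (simp add: u_def Q_def)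
      also have "Q powr (p + 1) * r k = Q powr p * \<psi> Q" using Q by (simp add: powr_add r_def Q_def)
      finally have "\<psi> Q \<le> 1 / Q powr p" using Q by (simp add: pos_le_divide_eq mult.commute)
      also have "\<dots> = Q powr (- p)" by (simp add: powr_minus_divide)
      also have "\<dots> \<le> Q powr (- 27 / 10)" using Q p by (intro powr_mono) auto
      finally show ?case by (simp add: Q_def)
    qed
  qed
  define A where "A n = A3_star \<kappa> lam \<psi> \<inter> {x. \<bar>x\<bar> \<le> real (Suc n)}" for n
  show ?thesis
  proof (rule hausdorff_measure_null[where A = A])
    show "g r \<ge> 0" if "r > 0" for r using g[OF that] by simp
    show "A3_star \<kappa> lam \<psi> \<subseteq> (\<Union>n. A n)"
    proof
      fix x assume "x \<in> A3_star \<kappa> lam \<psi>"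
      moreover obtain n where "\<bar>x\<bar> \<le> real n" using real_arch_simple by blast
      ultimately have "x \<in> A n" by (simp add: A_def)
      then show "x \<in> (\<Union>n. A n)" by blast
    qed
    fix n and e \<rho> :: real assume e: "e > 0" and \<rho>: "\<rho> > 0"
    define N where "N = real (Suc n)"
    have N: "N \<ge> 1" by (simp add: N_def)
    obtain C m Q0 where C: "C > 0" and m: "m > 0" and cov: "\<And>Q \<delta>. Q \<ge> 1 \<Longrightarrow> Q \<ge> Q0 \<Longrightarrow> 0 < \<delta> \<Longrightarrow> \<delta> \<le> Q powr (- 27 / 10) \<Longrightarrow>
      coverable (\<delta> / Q) (m * Q^2) (C * Q powr (4 - 2 * lam / 3))
      {x. \<bar>x\<bar> \<le> N \<and> (\<exists>P\<in>P3_star \<kappa> lam. Q \<le> real_of_int (poly_height P) \<and> real_of_int (poly_height P) < 2 * Q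
         \<and> \<bar>poly (of_int_poly P) x\<bar> \<le> \<delta>)}"
    proof (rule block_cover[OF assms(1) less_imp_le[OF assms(2)] assms(3) N])
      fix C m Q0
      assume 1: "C > 0" "m > 0" and 2: "\<And>Q \<delta>. Q \<ge> 1 \<Longrightarrow> Q \<ge> Q0 \<Longrightarrow> 0 < \<delta> \<Longrightarrow> \<delta> \<le> Q powr (- 27 / 10) \<Longrightarrow>
        coverable (\<delta> / Q) (m * Q^2) (C * Q powr (4 - 2 * lam / 3))
        {x. \<bar>x\<bar> \<le> N \<and> (\<exists>P\<in>P3_star \<kappa> lam. Q \<le> real_of_int (poly_height P) \<and> real_of_int (poly_height P) < 2 * Q
           \<and> \<bar>poly (of_int_poly P) x\<bar> \<le> \<delta>)}"
      show thesis by (rule that[OF 1 2])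
    qed
    define X where "X k = {x. \<bar>x\<bar> \<le> N \<and> (\<exists>P\<in>P3_star \<kappa> lam. 2 ^ k \<le> real_of_int (poly_height P) \<and> real_of_int (poly_height P) < 2 * 2 ^ k
         \<and> \<bar>poly (of_int_poly P) x\<bar> \<le> \<psi> (2 ^ k))}" for k :: nat
    have two: "filterlim (\<lambda>k::nat. (2::real) ^ k) at_top sequentially"
      by (rule filterlim_at_top_mono[OF filterlim_real_sequentially]) (intro always_eventually allI less_imp_le of_nat_less_two_power)
    have "\<forall>\<^sub>F k in sequentially. \<psi> (2 ^ k) \<le> (2 ^ k) powr (- 27 / 10) \<and> Q0 \<le> 2 ^ k \<and> m / \<rho> \<le> 2 ^ k"
      using two \<psi>_small by (auto simp: filterlim_at_top eventually_conj_iff)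
    then obtain k1 where k1: "\<And>k. k \<ge> k1 \<Longrightarrow> \<psi> (2 ^ k) \<le> (2 ^ k) powr (- 27 / 10) \<and> Q0 \<le> 2 ^ k \<and> m / \<rho> \<le> 2 ^ k"
      by (auto simp: eventually_sequentially)
    have "summable (\<lambda>k. C * u k)" using \<open>summable u\<close> by (rule summable_mult)
    from suminf_exist_split[OF e this] obtain k2 where k2: "\<And>k. k \<ge> k2 \<Longrightarrow> norm (\<Sum>i. C * u (i + k)) < e" by blast
    define k0 where "k0 = max k1 k2"
    have "\<exists>S. thin_balls g \<rho> (C * u (j + k0)) S \<and> X (j + k0) \<subseteq> (\<Union>(c, r)\<in>S. ball c r)" for j
    proof -
      define k where "k = j + k0"
      define Q :: real where "Q = 2 ^ k"
      have Q: "Q \<ge> 1" by (simp add: Q_def)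
      have k: "\<psi> Q \<le> Q powr (- 27 / 10)" "Q0 \<le> Q" "m / \<rho> \<le> Q" using k1[of k] by (auto simp: k_def k0_def Q_def)
      have c: "coverable (r k) (m * Q^2) (C * Q powr (4 - 2 * lam / 3)) (X k)"
        using cov[OF Q k(2) _ k(1)] \<psi>[of Q] Q by (simp add: X_def r_def Q_def)
      \<comment> \<open>The largest radius of the block is at most \<open>m / Q\<close>, because
        \<psi>(Q) \<le> Q powr (- 2); so the radii fall below \<rho> once \<open>k\<close> is
        large.\<close>
      have "m * Q^2 * r k = m * (Q * \<psi> Q)" using Q by (simp add: r_def Q_def power2_eq_square)
      also have "\<dots> \<le> m * (Q * Q powr (- 2))"
        using k(1) Q m powr_mono[of "- 27 / 10" "- 2" Q] by (intro mult_left_mono) auto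
      also have "\<dots> = m / Q" using Q by (simp add: powr_minus_divide powr_numeral power2_eq_square)
      also have "\<dots> \<le> \<rho>" using k(3) Q \<rho> by (simp add: field_simps)
      finally have mr: "m * Q^2 * r k \<le> \<rho>" .
      obtain S where "thin_balls g \<rho> (C * Q powr (4 - 2 * lam / 3) * g (r k)) S" "X k \<subseteq> (\<Union>(c, r)\<in>S. ball c r)"
        by (rule coverable_imp_thin_balls[OF c r0 mr, of g]) (use g g_scale r0 in \<open>auto simp: less_imp_le\<close>)
      moreover have "C * Q powr (4 - 2 * lam / 3) * g (r k) = C * u k" by (simp add: u_def p_def Q_def)
      ultimately show ?thesis unfolding k_def[symmetric] by auto
    qed
    then have "\<forall>j. \<exists>S. thin_balls g \<rho> (C * u (j + k0)) S \<and> X (j + k0) \<subseteq> (\<Union>(c, r)\<in>S. ball c r)" by blast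
    then obtain S where "\<forall>j. thin_balls g \<rho> (C * u (j + k0)) (S j) \<and> X (j + k0) \<subseteq> (\<Union>(c, r)\<in>S j. ball c r)"
      by (rule choice[THEN exE])
    then have S: "thin_balls g \<rho> (C * u (j + k0)) (S j)" "X (j + k0) \<subseteq> (\<Union>(c, r)\<in>S j. ball c r)" for j by blast+
    show "\<exists>S. thin_balls g \<rho> e S \<and> A n \<subseteq> (\<Union>(c, r)\<in>S. ball c r)"
    proof (intro exI[of _ "\<Union>j. S j"] conjI)
      show "thin_balls g \<rho> e (\<Union>j. S j)"
      proof (rule thin_balls_UN[OF S(1)])
        show "g r \<ge> 0" if "r > 0" for r using g[OF that] by simp
        fix M
        have "summable (\<lambda>j. C * u (j + k0))" using \<open>summable (\<lambda>k. C * u k)\<close> by (subst summable_iff_shift)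
        then have "(\<Sum>j<M. C * u (j + k0)) \<le> (\<Sum>j. C * u (j + k0))" using C u0 by (intro sum_le_suminf) auto
        also have "\<dots> \<le> norm (\<Sum>j. C * u (j + k0))" by simp
        also have "\<dots> \<le> e" using k2[of k0] by (simp add: k0_def less_imp_le)
        finally show "(\<Sum>j<M. C * u (j + k0)) \<le> e" .
      qed
      show "A n \<subseteq> (\<Union>(c, r)\<in>(\<Union>j. S j). ball c r)"
      proof
        fix x assume "x \<in> A n"
        then have x: "\<bar>x\<bar> \<le> N" and inf: "infinite {P \<in> P3_star \<kappa> lam. \<bar>poly (of_int_poly P) x\<bar> \<le> \<psi> (real_of_int (poly_height P))}"
          by (auto simp: A_def A3_star_def N_def)
        \<comment> \<open>Only finitely many polynomials have height below 2^k0, so the tail of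
          blocks from \<open>k0\<close> on still covers \<open>A n\<close>, and its total g-sum is
          below \<open>e\<close>.\<close>
        have "\<not> {P \<in> P3_star \<kappa> lam. \<bar>poly (of_int_poly P) x\<bar> \<le> \<psi> (real_of_int (poly_height P))} \<subseteq> {P. degree P \<le> 3 \<and> poly_height P < 2 ^ k0}"
          using inf finite_bounded_height finite_subset by blast
        then obtain P where P: "P \<in> P3_star \<kappa> lam" "\<bar>poly (of_int_poly P) x\<bar> \<le> \<psi> (real_of_int (poly_height P))" "\<not> (degree P \<le> 3 \<and> poly_height P < 2 ^ k0)"
          by blast
        then have Pk: "poly_height P \<ge> 2 ^ k0" by (auto simp: P3_star_def)
        obtain k where k: "k \<ge> k0" "2 ^ k \<le> poly_height P" "poly_height P < 2 ^ Suc k"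
          using ex_dyadic_block[OF Pk] by blast
        have h: "2 ^ k \<le> real_of_int (poly_height P)" "real_of_int (poly_height P) < 2 * 2 ^ k"
        proof -
          have "real_of_int (2 ^ k) \<le> real_of_int (poly_height P)" "real_of_int (poly_height P) < real_of_int (2 ^ Suc k)"
            using k(2,3) by (simp_all only: of_int_le_iff of_int_less_iff)
          then show "2 ^ k \<le> real_of_int (poly_height P)" "real_of_int (poly_height P) < 2 * 2 ^ k" by simp_all
        qed
        \<comment> \<open>As \<psi> is decreasing, its value at the height is dominated by its value
          at the left end of the dyadic block.\<close>
        have "\<bar>poly (of_int_poly P) x\<bar> \<le> \<psi> (2 ^ k)" using P(2) \<psi>_dec[OF _ h(1)] by simp
        then have "x \<in> X k" unfolding X_def using x P(1) h by blast
        moreover obtain j where "k = j + k0" using k(1) le_add_diff_inverse2[of k0 k] by metis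
        ultimately have "x \<in> (\<Union>(c, r)\<in>S j. ball c r)" using S(2) by blast
        then show "x \<in> (\<Union>(c, r)\<in>(\<Union>j. S j). ball c r)" by blast
      qed
    qed
  qed
qed

end
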